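(* Let $n\ge 1$, let $Y=\mathbf R^{n\times n}$ with coordinates $y_{ij}$ ($1\le i,j\le n$), and let $\mu$ denote the Schwartz distribution on $Y$ associated with the Haar measure $\mu$ on the special orthogonal group $SO(n)\subset Y$, i.e. $\langle\mu,\varphi\rangle=\int_{SO(n)}\varphi|_{SO(n)}(y)\,\mu(dy)$ for test functions $\varphi$ on $Y$. Let $D_Y=\mathbf C\langle y_{ij},\partial_{ij} : 1\le i,j\le n\rangle$ be the Weyl algebra. Then the annihilating ideal $\mathrm{Ann}(\mu)=\{p\in D_Y : p\bullet\mu=0\}$ is generated, as a left ideal of $D_Y$, by $$\sum_{k=1}^n (y_{ki}\partial_{kj}-y_{kj}\partial_{ki}) \quad (1\leq i < j \leq n),$$ $$\delta_{ij}-\sum_{k=1}^n y_{ki}y_{kj},\qquad \delta_{ij}-\sum_{k=1}^n y_{ik}y_{jk}\quad (1\leq i\leq j \leq n),$$ $$1-\det y .$$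
   Context: $SO(n)=\{y\in\mathbf R^{n\times n} : y^\top y=e,\ \det y=1\}$, where $e$ is the identity matrix; its Haar measure is the unique invariant probability measure on it. Test functions are smooth compactly supported complex-valued functions on $Y$. $D_Y$ is the ring of linear differential operators with complex polynomial coefficients in the variables $y_{ij}$, where $\partial_{ij}=\partial/\partial y_{ij}$; it acts on distributions $u$ on $Y$ in the usual way, $\langle y_{ij}u,\varphi\rangle=\langle u,y_{ij}\varphi\rangle$ and $\langle\partial_{ij}u,\varphi\rangle=-\langle u,\partial_{ij}\varphi\rangle$, and $p\bullet u$ denotes the result of applying $p$ to $u$. $\delta_{ij}$ is the Kronecker symbol. *)

theory Defs
  imports "HOL-Probability.Probability"
begin

section \<open>Test functions\<close>

text \<open>
  The space \<open>Y\<close> of real matrices is \<^typ>\<open>real^'n^'n\<close>, with \<open>y $ i $ j\<close> the coordinate in row \<open>i\<close>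
  and column \<open>j\<close>.
\<close>

definition pd :: "'n::finite \<Rightarrow> 'n \<Rightarrow> (real^'n^'n \<Rightarrow> complex) \<Rightarrow> real^'n^'n \<Rightarrow> complex" where
  "pd i j f y = frechet_derivative f (at y) (axis i (axis j 1))"

fun iter_pd :: "('n::finite \<times> 'n) list \<Rightarrow> (real^'n^'n \<Rightarrow> complex) \<Rightarrow> real^'n^'n \<Rightarrow> complex" where
  "iter_pd [] f = f"
| "iter_pd ((i, j) # is) f = iter_pd is (pd i j f)"

text \<open>
  Every iterated partial derivative is required to be totally differentiable, so that all of them
  are continuous and no junk value of \<^const>\<open>frechet_derivative\<close> is involved.
\<close>

definition smooth :: "(real^'n::finite^'n \<Rightarrow> complex) \<Rightarrow> bool" where
  "smooth f \<longleftrightarrow> (\<forall>is. iter_pd is f differentiable_on UNIV)"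

lemma pd_eqI:
  assumes "(f has_derivative f') (at y)"
  shows "pd i j f y = f' (axis i (axis j 1))"
  unfolding pd_def using frechet_derivative_at[OF assms] by simp

lemma smooth_differentiable: "smooth f \<Longrightarrow> f differentiable (at y)"
  unfolding smooth_def by (metis UNIV_I differentiable_on_def iter_pd.simps(1))

lemma smooth_has_derivative:
  "smooth f \<Longrightarrow> (f has_derivative frechet_derivative f (at y)) (at y)"
  using smooth_differentiable frechet_derivative_works by blast

lemma smooth_continuous: "smooth f \<Longrightarrow> continuous_on UNIV f"
  by (meson continuous_at_imp_continuous_on differentiable_imp_continuous_within
      smooth_differentiable)

lemma smooth_pd: "smooth f \<Longrightarrow> smooth (pd i j f)"
  unfolding smooth_def by (metis iter_pd.simps(2))

lemma smooth_iter_pd: "smooth f \<Longrightarrow> smooth (iter_pd is f)"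
  by (induction "is" f rule: iter_pd.induct) (auto intro: smooth_pd)

lemma pd_add: "smooth f \<Longrightarrow> smooth g \<Longrightarrow> pd i j (\<lambda>y. f y + g y) = (\<lambda>y. pd i j f y + pd i j g y)"
  by (rule ext, subst pd_eqI)
    (auto intro!: has_derivative_add smooth_has_derivative simp: pd_def)

lemma pd_cmul: "smooth f \<Longrightarrow> pd i j (\<lambda>y. c * f y) = (\<lambda>y. c * pd i j f y)"
  by (rule ext, subst pd_eqI)
    (auto intro!: has_derivative_mult_right smooth_has_derivative simp: pd_def)

lemma pd_cnj: "smooth f \<Longrightarrow> pd i j (\<lambda>y. cnj (f y)) = (\<lambda>y. cnj (pd i j f y))"
  by (rule ext, subst pd_eqI)
    (auto intro!: has_derivative_cnj smooth_has_derivative simp: pd_def)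

lemma pd_mult:
  assumes "smooth f" "smooth g"
  shows "pd i j (\<lambda>y. f y * g y) = (\<lambda>y. f y * pd i j g y + pd i j f y * g y)"
  by (rule ext, subst pd_eqI)
    (rule has_derivative_mult[OF smooth_has_derivative smooth_has_derivative],
      use assms in \<open>auto simp: pd_def\<close>)

lemma has_derivative_coord:
  "((\<lambda>y. complex_of_real (y $ i $ j)) has_derivative (\<lambda>h. complex_of_real (h $ i $ j))) (at y)"
  by (intro bounded_linear_imp_has_derivative bounded_linear_compose[OF bounded_linear_of_real]
      bounded_linear_compose[OF bounded_linear_vec_nth bounded_linear_vec_nth])

lemma pd_coord_mult:
  assumes "smooth f"
  shows "pd k l (\<lambda>y. complex_of_real (y $ i $ j) * f y) =
    (\<lambda>y. of_bool (k = i \<and> l = j) * f y + complex_of_real (y $ i $ j) * pd k l f y)"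
  by (rule ext, subst pd_eqI)
    (rule has_derivative_mult[OF has_derivative_coord smooth_has_derivative],
      use assms in \<open>auto simp: pd_def axis_def\<close>)

lemma iter_pd_add:
  "smooth f \<Longrightarrow> smooth g \<Longrightarrow> iter_pd is (\<lambda>y. f y + g y) = (\<lambda>y. iter_pd is f y + iter_pd is g y)"
  by (induction "is" arbitrary: f g) (auto simp: pd_add smooth_pd)

lemma iter_pd_cmul: "smooth f \<Longrightarrow> iter_pd is (\<lambda>y. c * f y) = (\<lambda>y. c * iter_pd is f y)"
  by (induction "is" arbitrary: f) (auto simp: pd_cmul smooth_pd)

lemma iter_pd_cnj: "smooth f \<Longrightarrow> iter_pd is (\<lambda>y. cnj (f y)) = (\<lambda>y. cnj (iter_pd is f y))"
  by (induction "is" arbitrary: f) (auto simp: pd_cnj smooth_pd)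

lemma smooth_differentiable_on: "smooth f \<Longrightarrow> f differentiable_on A"
  using smooth_differentiable by (metis differentiable_at_imp_differentiable_on)

lemma smooth_add: "smooth f \<Longrightarrow> smooth g \<Longrightarrow> smooth (\<lambda>y. f y + g y)"
  unfolding smooth_def[of "\<lambda>y. f y + g y"]
  by (simp add: iter_pd_add differentiable_on_add smooth_differentiable_on smooth_iter_pd)

lemma smooth_cmul: "smooth f \<Longrightarrow> smooth (\<lambda>y. c * f y)"
  unfolding smooth_def[of "\<lambda>y. c * f y"]
  by (simp add: iter_pd_cmul differentiable_on_mult smooth_differentiable_on smooth_iter_pd)

lemma smooth_uminus: "smooth f \<Longrightarrow> smooth (\<lambda>y. - f y)"
  using smooth_cmul[of f "-1"] by simp

lemma smooth_cnj:
  assumes "smooth f"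
  shows "smooth (\<lambda>y. cnj (f y))"
  unfolding smooth_def
proof
  fix "is"
  have "(\<lambda>y. cnj (iter_pd is f y)) differentiable (at y)" for y
    using has_derivative_cnj[OF smooth_has_derivative[OF smooth_iter_pd[OF assms]]]
    by (auto simp: differentiable_def)
  then show "iter_pd is (\<lambda>y. cnj (f y)) differentiable_on UNIV"
    by (simp add: iter_pd_cnj assms differentiable_on_def)
qed

lemma smooth_zero: "smooth (\<lambda>y. 0)"
proof -
  have "pd i j (\<lambda>y. 0) = (\<lambda>y. 0)" for i j :: 'a
    by (rule ext, subst pd_eqI[OF has_derivative_const]) simp
  then have "iter_pd is (\<lambda>y::real^'a^'a. 0) = (\<lambda>y. 0)" for "is"
    by (induction "is") auto
  then show ?thesis by (simp add: smooth_def)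
qed

lemma iter_pd_coord_mult_form:
  assumes "smooth f" "smooth g"
  shows "\<exists>G. smooth G \<and> iter_pd is (\<lambda>y. g y + complex_of_real (y $ i $ j) * f y) =
    (\<lambda>y. G y + complex_of_real (y $ i $ j) * iter_pd is f y)"
  using assms
proof (induction "is" arbitrary: f g)
  case Nil
  then show ?case by auto
next
  case (Cons kl "is")
  obtain k l where kl: "kl = (k, l)" by fastforce
  have eq: "pd k l (\<lambda>y. g y + complex_of_real (y $ i $ j) * f y) =
    (\<lambda>y. (pd k l g y + of_bool (k = i \<and> l = j) * f y) + complex_of_real (y $ i $ j) * pd k l f y)"
    by (rule ext, subst pd_eqI)
      (rule has_derivative_add[OF smooth_has_derivative
          has_derivative_mult[OF has_derivative_coord smooth_has_derivative]],
        use Cons.prems in \<open>auto simp: pd_def axis_def\<close>)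
  show ?case
    unfolding kl iter_pd.simps eq
    by (rule Cons.IH) (intro smooth_pd smooth_add smooth_cmul Cons.prems)+
qed

lemma differentiable_on_coord: "(\<lambda>y. complex_of_real (y $ i $ j)) differentiable_on A"
  unfolding differentiable_on_def differentiable_def
  by (blast intro: has_derivative_at_withinI[OF has_derivative_coord])

lemma smooth_coord_mult:
  assumes "smooth f"
  shows "smooth (\<lambda>y. complex_of_real (y $ i $ j) * f y)"
  unfolding smooth_def
proof
  fix "is"
  obtain G where "smooth G" "iter_pd is (\<lambda>y. complex_of_real (y $ i $ j) * f y) =
    (\<lambda>y. G y + complex_of_real (y $ i $ j) * iter_pd is f y)"
    using iter_pd_coord_mult_form[OF assms smooth_zero, of "is" i j] by auto
  then show "iter_pd is (\<lambda>y. complex_of_real (y $ i $ j) * f y) differentiable_on UNIV"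
    by (simp add: differentiable_on_add differentiable_on_mult smooth_differentiable_on
        differentiable_on_coord smooth_iter_pd assms)
qed

typedef (overloaded) 'n::finite test =
  "{\<phi> :: real^'n^'n \<Rightarrow> complex. smooth \<phi> \<and> compact (closure {y. \<phi> y \<noteq> 0})}"
  morphisms test_fun Abs_test
  by (rule exI[of _ "\<lambda>y. 0"]) (simp add: smooth_zero)

declare [[coercion test_fun]]

setup_lifting type_definition_test

lemma compact_support_mono:
  fixes f g :: "'a::heine_borel \<Rightarrow> 'b::zero"
  assumes "compact (closure {y. f y \<noteq> 0})" "{y. g y \<noteq> 0} \<subseteq> closure {y. f y \<noteq> 0}"
  shows "compact (closure {y. g y \<noteq> 0})"
  using assms bounded_subset[OF bounded_closure assms(2)] by simp

lemma pd_support: "{y. pd i j f y \<noteq> 0} \<subseteq> closure {y. f y \<noteq> 0}"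
proof (intro subsetI, rule ccontr)
  fix y assume y: "y \<in> {y. pd i j f y \<noteq> 0}" and n: "y \<notin> closure {y. f y \<noteq> 0}"
  have "(f has_derivative (\<lambda>_. 0)) (at y)"
    by (rule has_derivative_transform_within_open
        [where f = "\<lambda>_. 0" and t = UNIV and s = "- closure {y. f y \<noteq> 0}"])
      (use n closure_subset[of "{y. f y \<noteq> 0}"] in auto)
  from pd_eqI[OF this] y show False by simp
qed

instantiation test :: (finite) ab_group_add
begin

lift_definition zero_test :: "'a test" is "\<lambda>y. 0"
  by (simp add: smooth_zero)

lift_definition plus_test :: "'a test \<Rightarrow> 'a test \<Rightarrow> 'a test" is "\<lambda>\<phi> \<psi> y. \<phi> y + \<psi> y"
proof -
  fix f g :: "real^'a^'a \<Rightarrow> complex"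
  assume f: "smooth f \<and> compact (closure {y. f y \<noteq> 0})"
    and g: "smooth g \<and> compact (closure {y. g y \<noteq> 0})"
  have "bounded ({y. f y \<noteq> 0} \<union> {y. g y \<noteq> 0})" using f g by simp
  then have "bounded {y. f y + g y \<noteq> 0}" by (rule bounded_subset) auto
  then show "smooth (\<lambda>y. f y + g y) \<and> compact (closure {y. f y + g y \<noteq> 0})"
    using f g by (simp add: smooth_add)
qed

lift_definition uminus_test :: "'a test \<Rightarrow> 'a test" is "\<lambda>\<phi> y. - \<phi> y"
  by (simp add: smooth_uminus)

definition minus_test :: "'a test \<Rightarrow> 'a test \<Rightarrow> 'a test" where
  "minus_test \<phi> \<psi> = \<phi> + - \<psi>"

instance
  by standard (unfold minus_test_def, (transfer; auto simp: fun_eq_iff)+)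

end

lift_definition test_scale :: "complex \<Rightarrow> 'n::finite test \<Rightarrow> 'n test" is "\<lambda>c \<phi> y. c * \<phi> y"
  by (auto intro: smooth_cmul bounded_subset)

lift_definition test_coord :: "'n::finite \<Rightarrow> 'n \<Rightarrow> 'n test \<Rightarrow> 'n test" is
  "\<lambda>i j \<phi> y. complex_of_real (y $ i $ j) * \<phi> y"
  by (auto intro: smooth_coord_mult bounded_subset)

lift_definition test_pd :: "'n::finite \<Rightarrow> 'n \<Rightarrow> 'n test \<Rightarrow> 'n test" is pd
  by (intro conjI smooth_pd; elim conjE compact_support_mono) (simp_all add: pd_support)

lift_definition test_cnj :: "'n::finite test \<Rightarrow> 'n test" is "\<lambda>\<phi> y. cnj (\<phi> y)"
  by (simp add: smooth_cnj)

lemma test_fun_simps [simp]: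
  "test_fun 0 y = 0" "test_fun (\<phi> + \<psi>) y = test_fun \<phi> y + test_fun \<psi> y"
  "test_fun (- \<phi>) y = - test_fun \<phi> y" "test_fun (\<phi> - \<psi>) y = test_fun \<phi> y - test_fun \<psi> y"
  "test_fun (test_scale c \<phi>) y = c * test_fun \<phi> y"
  "test_fun (test_coord i j \<phi>) y = complex_of_real (y $ i $ j) * test_fun \<phi> y"
  "test_fun (test_pd i j \<phi>) y = pd i j (test_fun \<phi>) y"
  "test_fun (test_cnj \<phi>) y = cnj (test_fun \<phi> y)"
  unfolding minus_test_def
  by (simp_all only: zero_test.rep_eq plus_test.rep_eq uminus_test.rep_eq
      test_scale.rep_eq test_coord.rep_eq test_pd.rep_eq test_cnj.rep_eq) simp

lemma test_eqI: "(\<And>y. test_fun \<phi> y = test_fun \<psi> y) \<Longrightarrow> \<phi> = \<psi>"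
  by (simp add: test_fun_inject[symmetric] fun_eq_iff)

lemma smooth_test_fun: "smooth (test_fun \<phi>)"
  using test_fun[of \<phi>] by simp

lemma test_fun_bounded_support: "bounded {y. test_fun \<phi> y \<noteq> 0}"
  using test_fun[of \<phi>] by simp

lemma test_pd_add: "test_pd i j (\<phi> + \<psi>) = test_pd i j \<phi> + test_pd i j \<psi>"
  by (rule test_eqI) (simp add: plus_test.rep_eq pd_add smooth_test_fun)

lemma test_pd_scale: "test_pd i j (test_scale c \<phi>) = test_scale c (test_pd i j \<phi>)"
  by (rule test_eqI) (simp add: test_scale.rep_eq pd_cmul smooth_test_fun)


section \<open>Distributions\<close>

text \<open>
  Convergence to \<open>0\<close> in the space of test functions; for linear functionals, sequential continuity
  for this convergence is the same as continuity for the usual inductive limit topology.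
\<close>

definition test_null :: "(nat \<Rightarrow> 'n::finite test) \<Rightarrow> bool" where
  "test_null \<phi> \<longleftrightarrow>
    (\<exists>K. compact K \<and> (\<forall>k. \<forall>y. y \<notin> K \<longrightarrow> \<phi> k y = 0)) \<and>
    (\<forall>is. uniform_limit UNIV (\<lambda>k. iter_pd is (\<phi> k)) (\<lambda>_. 0) sequentially)"

typedef (overloaded) 'n::finite distribution =
  "{u :: 'n test \<Rightarrow> complex.
     (\<forall>\<phi> \<psi>. u (\<phi> + \<psi>) = u \<phi> + u \<psi>) \<and>
     (\<forall>c \<phi>. u (test_scale c \<phi>) = c * u \<phi>) \<and>
     (\<forall>\<phi>. test_null \<phi> \<longrightarrow> (\<lambda>k. u (\<phi> k)) \<longlonglongrightarrow> 0)}"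
  morphisms pairing Abs_distribution
  by (rule exI[of _ "\<lambda>_. 0"]) simp

setup_lifting type_definition_distribution

instantiation distribution :: (finite) ab_group_add
begin

lift_definition zero_distribution :: "'a distribution" is "\<lambda>_. 0"
  by simp

lift_definition plus_distribution :: "'a distribution \<Rightarrow> 'a distribution \<Rightarrow> 'a distribution" is
  "\<lambda>u v \<phi>. u \<phi> + v \<phi>"
  by (auto simp: algebra_simps intro: tendsto_add_zero)

lift_definition uminus_distribution :: "'a distribution \<Rightarrow> 'a distribution" is "\<lambda>u \<phi>. - u \<phi>"
  by (auto simp: tendsto_minus_cancel_left[symmetric] intro: tendsto_eq_intros)

definition minus_distribution :: "'a distribution \<Rightarrow> 'a distribution \<Rightarrow> 'a distribution" where
  "minus_distribution u v = u + - v"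

instance
  by standard (unfold minus_distribution_def, (transfer; auto simp: fun_eq_iff)+)

end

lemma test_null_pd:
  assumes "test_null \<phi>"
  shows "test_null (\<lambda>k. test_pd i j (\<phi> k))"
proof -
  obtain K where K: "compact K" "\<And>k y. y \<notin> K \<Longrightarrow> \<phi> k y = 0"
    using assms unfolding test_null_def by blast
  have "closure {y. \<phi> k y \<noteq> 0} \<subseteq> K" for k
    using K by (intro closure_minimal) (auto intro: compact_imp_closed)
  then have "pd i j (\<phi> k) y = 0" if "y \<notin> K" for k y
    using pd_support[of i j "test_fun (\<phi> k)"] that by blast
  moreover have "test_fun (test_pd i j \<psi>) = pd i j (test_fun \<psi>)" for \<psi> by (simp add: fun_eq_iff)
  moreover have "uniform_limit UNIV (\<lambda>k. iter_pd ((i, j) # is) (\<phi> k)) (\<lambda>_. 0) sequentially" for "is"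
    using assms unfolding test_null_def by blast
  ultimately show ?thesis
    unfolding test_null_def using K(1) by auto
qed

lemma uniform_limit_cmul_0:
  assumes "uniform_limit A f (\<lambda>_. 0::complex) F"
  shows "uniform_limit A (\<lambda>k y. c * f k y) (\<lambda>_. 0) F"
  using bounded_linear.uniform_limit[OF bounded_linear_mult_right assms, of c] by simp

lemma test_null_scale:
  assumes "test_null \<phi>"
  shows "test_null (\<lambda>k. test_scale c (\<phi> k))"
proof -
  have "test_fun (test_scale c \<psi>) = (\<lambda>y. c * test_fun \<psi> y)" for \<psi> :: "'a test" by (simp add: fun_eq_iff)
  then show ?thesis
    using assms unfolding test_null_def
    by (auto simp: iter_pd_cmul smooth_test_fun intro!: uniform_limit_cmul_0)
qed

lemma test_null_add:
  assumes "test_null \<phi>" "test_null \<psi>"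
  shows "test_null (\<lambda>k. \<phi> k + \<psi> k)"
proof -
  obtain K where K: "compact K" "\<And>k y. y \<notin> K \<Longrightarrow> \<phi> k y = 0"
    using assms unfolding test_null_def by blast
  obtain L where L: "compact L" "\<And>k y. y \<notin> L \<Longrightarrow> \<psi> k y = 0"
    using assms unfolding test_null_def by blast
  have "uniform_limit UNIV (\<lambda>k. iter_pd is (test_fun (\<phi> k + \<psi> k))) (\<lambda>_. 0) sequentially" for "is"
  proof -
    have "test_fun (\<phi> k + \<psi> k) = (\<lambda>y. \<phi> k y + \<psi> k y)" for k by (simp add: fun_eq_iff)
    moreover have "uniform_limit UNIV (\<lambda>k y. iter_pd is (\<phi> k) y + iter_pd is (\<psi> k) y) (\<lambda>y. 0 + 0) sequentially"
      using assms unfolding test_null_def by (intro uniform_limit_add) auto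
    ultimately show ?thesis by (simp add: iter_pd_add smooth_test_fun)
  qed
  then show ?thesis
    unfolding test_null_def using compact_Un[OF K(1) L(1)] K(2) L(2)
    by (intro conjI exI[of _ "K \<union> L"]) auto
qed

lemma test_null_coord:
  assumes "test_null \<phi>"
  shows "test_null (\<lambda>k. test_coord i j (\<phi> k))"
proof -
  have lim: "uniform_limit UNIV (\<lambda>k. iter_pd is (\<lambda>y. complex_of_real (y $ i $ j) * \<phi> k y)) (\<lambda>_. 0) sequentially"
    if "test_null \<phi>" for "is" and \<phi> :: "nat \<Rightarrow> 'a test"
    using that
  proof (induction "is" arbitrary: \<phi>)
    case Nil
    then obtain K where K: "compact K" "\<And>k y. y \<notin> K \<Longrightarrow> \<phi> k y = 0"
      and lim: "uniform_limit UNIV (\<lambda>k. iter_pd [] (\<phi> k)) (\<lambda>_. 0) sequentially"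
      unfolding test_null_def by blast
    obtain B where B: "B > 0" "\<And>y. y \<in> K \<Longrightarrow> norm y \<le> B"
      using compact_imp_bounded[OF K(1)] bounded_pos by blast
    have bd: "norm (complex_of_real (y $ i $ j) * \<phi> k y) \<le> B * norm (\<phi> k y)" for k y
    proof (cases "y \<in> K")
      case True
      have "\<bar>y $ i $ j\<bar> \<le> norm (y $ i)" by (rule component_le_norm_cart)
      also have "\<dots> \<le> norm y" by (rule Finite_Cartesian_Product.norm_nth_le)
      finally have "\<bar>y $ i $ j\<bar> \<le> B" using B(2)[OF True] by simp
      then show ?thesis by (simp add: norm_mult mult_right_mono)
    qed (use K B in simp)
    show ?case
      unfolding iter_pd.simps
    proof (rule uniform_limitI)
      fix e :: real assume e: "e > 0"
      have "\<forall>\<^sub>F k in sequentially. \<forall>y\<in>UNIV. dist (\<phi> k y) 0 < e / B"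
        using uniform_limitD[OF lim, of "e / B"] e B(1) by simp
      then show "\<forall>\<^sub>F k in sequentially. \<forall>y\<in>UNIV. dist (complex_of_real (y $ i $ j) * \<phi> k y) 0 < e"
      proof eventually_elim
        case (elim k)
        then have "B * norm (\<phi> k y) < e" for y using B(1) by (simp add: field_simps)
        then show ?case using bd by (auto intro: le_less_trans)
      qed
    qed
  next
    case (Cons kl "is")
    obtain a b where kl: "kl = (a, b)" by fastforce
    have 1: "uniform_limit UNIV (\<lambda>k. iter_pd is (\<phi> k)) (\<lambda>_. 0) sequentially"
      using Cons.prems unfolding test_null_def by blast
    have eq: "test_fun (test_pd a b \<psi>) = pd a b (test_fun \<psi>)" for \<psi> :: "'a test" by (simp add: fun_eq_iff)
    have 2: "uniform_limit UNIV
      (\<lambda>k. iter_pd is (\<lambda>y. complex_of_real (y $ i $ j) * pd a b (\<phi> k) y)) (\<lambda>_. 0) sequentially"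
      using Cons.IH[OF test_null_pd[OF Cons.prems, of a b]] by (simp add: eq)
    have "uniform_limit UNIV
      (\<lambda>k y. of_bool (a = i \<and> b = j) * iter_pd is (\<phi> k) y +
         iter_pd is (\<lambda>y. complex_of_real (y $ i $ j) * pd a b (\<phi> k) y) y) (\<lambda>_. 0 + 0) sequentially"
      by (intro uniform_limit_add uniform_limit_cmul_0 1 2)
    then show ?case
      by (simp add: kl pd_coord_mult smooth_test_fun iter_pd_add iter_pd_cmul smooth_cmul
          smooth_coord_mult smooth_pd del: of_bool_eq_iff)
  qed
  have "test_fun (test_coord i j \<psi>) = (\<lambda>y. complex_of_real (y $ i $ j) * test_fun \<psi> y)" for \<psi> :: "'a test"
    by (simp add: fun_eq_iff)
  then show ?thesis
    using assms lim[OF assms] unfolding test_null_def by auto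
qed


section \<open>Integration by parts\<close>

lemma integrable_lborel_bounded_support:
  fixes f :: "'a::euclidean_space \<Rightarrow> complex"
  assumes "continuous_on UNIV f" "\<And>y. norm y > R \<Longrightarrow> f y = 0"
  shows "integrable lborel f"
proof -
  have "integrable lborel (\<lambda>x. indicator (cball 0 R) x *\<^sub>R f x)"
    using assms(1) by (intro borel_integrable_compact) (auto intro: continuous_on_subset)
  moreover have "(\<lambda>x. indicator (cball 0 R) x *\<^sub>R f x) = f"
    using assms(2) by (force simp: indicator_def)
  ultimately show ?thesis by simp
qed

lemma integral_translate_lborel:
  fixes f :: "'a::euclidean_space \<Rightarrow> complex"
  assumes "f \<in> borel_measurable borel"
  shows "(\<integral>y. f (c + y) \<partial>lborel) = (\<integral>y. f y \<partial>lborel)"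
proof -
  have "(\<integral>y. f y \<partial>distr lborel borel ((+) c)) = (\<integral>y. f (c + y) \<partial>lborel)"
    using assms by (intro integral_distr) auto
  then show ?thesis by (simp add: lborel_distr_plus)
qed

lemma norm_matrix_unit: "norm (axis i (axis j 1) :: real^'n::finite^'n) = 1"
  by (simp add: norm_eq_sqrt_inner inner_axis)

lemma integral_pd_eq_0:
  fixes h :: "real^'n::finite^'n \<Rightarrow> complex"
  assumes diff: "\<And>y. h differentiable (at y)" and cont: "continuous_on UNIV (pd i j h)"
    and supp: "bounded {y. h y \<noteq> 0}"
  shows "(\<integral>y. pd i j h y \<partial>lborel) = 0"
proof -
  define v :: "real^'n^'n" where "v = axis i (axis j 1)"
  define t where "t n = inverse (real (Suc n))" for n
  define s where "s n y = (h (t n *\<^sub>R v + y) - h y) /\<^sub>R t n" for n y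
  have v: "norm v = 1" by (simp add: v_def norm_matrix_unit)
  have t: "t n > 0" "t n \<le> 1" for n by (simp_all add: t_def inverse_eq_divide)
  have tlim: "t \<longlonglongrightarrow> 0" unfolding t_def by (rule LIMSEQ_inverse_real_of_nat)
  have der: "(h has_derivative frechet_derivative h (at y)) (at y)" for y
    using diff frechet_derivative_works by blast
  have dv: "frechet_derivative h (at y) v = pd i j h y" for y by (simp add: v_def pd_def)
  have hcont: "continuous_on UNIV h"
    by (meson continuous_at_imp_continuous_on differentiable_imp_continuous_within diff)
  obtain R where R: "R > 0" "\<And>y. h y \<noteq> 0 \<Longrightarrow> norm y \<le> R"
    using supp unfolding bounded_pos by blast
  have R0: "h y = 0" if "norm y > R" for y using R(2)[of y] that by auto
  have "closure {y. h y \<noteq> 0} \<subseteq> cball 0 R" using R by (intro closure_minimal) auto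
  then have pd0: "pd i j h y = 0" if "norm y > R" for y
    using pd_support[of i j h] that by fastforce
  have "compact (pd i j h ` cball 0 R)"
    using cont by (intro compact_continuous_image) (auto intro: continuous_on_subset)
  then obtain B where B: "B > 0" "\<And>y. y \<in> cball 0 R \<Longrightarrow> norm (pd i j h y) \<le> B"
    by (force dest!: compact_imp_bounded simp: bounded_pos)
  have B': "norm (pd i j h y) \<le> B" for y
    using B pd0[of y] by (cases "norm y \<le> R") auto
  have bound: "norm (s n y) \<le> B * indicator (cball 0 (R + 1)) y" for n y
  proof (cases "norm y \<le> R + 1")
    case True
    have dd: "((\<lambda>a. h (a *\<^sub>R v + y)) has_derivative (\<lambda>b. b *\<^sub>R pd i j h (a *\<^sub>R v + y))) (at a within {0..1})" for a
    proof -
      interpret D: bounded_linear "frechet_derivative h (at (a *\<^sub>R v + y))"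
        using der has_derivative_bounded_linear by blast
      have "((\<lambda>a. a *\<^sub>R v + y) has_derivative (\<lambda>b. b *\<^sub>R v)) (at a within {0..1})"
        by (auto intro!: derivative_eq_intros)
      from has_derivative_compose[OF this der] show ?thesis by (simp add: D.scaleR dv)
    qed
    have "norm (h (t n *\<^sub>R v + y) - h (0 *\<^sub>R v + y)) \<le> B * norm (t n - 0)"
    proof (rule differentiable_bound[where S = "{0..1::real}" and f = "\<lambda>a. h (a *\<^sub>R v + y)", OF _ dd])
      show "onorm (\<lambda>b. b *\<^sub>R pd i j h (a *\<^sub>R v + y)) \<le> B" for a
        by (rule onorm_bound) (use B B' in \<open>auto simp: mult.commute[of B] mult_left_mono\<close>)
    qed (use t[of n] in auto)
    then show ?thesis
      using True t[of n] by (simp add: s_def divide_inverse_commute[symmetric] pos_divide_le_eq indicator_def)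
  next
    case False
    have "norm y \<le> norm (t n *\<^sub>R v + y) + norm (t n *\<^sub>R v)"
      using norm_triangle_ineq4[of "t n *\<^sub>R v + y" "t n *\<^sub>R v"] by simp
    then have "norm (t n *\<^sub>R v + y) > R" using False t[of n] v by simp
    then show ?thesis using False R0 by (simp add: s_def)
  qed
  have lim: "(\<lambda>n. s n y) \<longlonglongrightarrow> pd i j h y" for y
  proof -
    have *: "((\<lambda>k. norm (h (y + k) - h y - frechet_derivative h (at y) k) / norm k) \<longlongrightarrow> 0) (at 0)"
      using der[of y] by (simp add: has_derivative_at)
    have "filterlim (\<lambda>n. t n *\<^sub>R v) (at 0) sequentially"
    proof (rule filterlim_atI)
      show "(\<lambda>n. t n *\<^sub>R v) \<longlonglongrightarrow> 0" using tendsto_scaleR[OF tlim tendsto_const[of v]] by simp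
      show "\<forall>\<^sub>F n in sequentially. t n *\<^sub>R v \<noteq> 0" using t v by (auto simp: less_imp_neq[symmetric])
    qed
    from filterlim_compose[OF * this]
    have "(\<lambda>n. norm (h (y + t n *\<^sub>R v) - h y - frechet_derivative h (at y) (t n *\<^sub>R v)) / norm (t n *\<^sub>R v)) \<longlonglongrightarrow> 0" .
    moreover have "norm (h (y + t n *\<^sub>R v) - h y - frechet_derivative h (at y) (t n *\<^sub>R v)) / norm (t n *\<^sub>R v)
       = norm (s n y - pd i j h y)" for n
    proof -
      interpret D: bounded_linear "frechet_derivative h (at y)"
        using der has_derivative_bounded_linear by blast
      have "h (y + t n *\<^sub>R v) - h y - frechet_derivative h (at y) (t n *\<^sub>R v) = t n *\<^sub>R (s n y - pd i j h y)"
        using t(1)[of n] by (simp add: s_def D.scaleR dv scaleR_diff_right add.commute)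
      then show ?thesis using t(1)[of n] v by simp
    qed
    ultimately have "(\<lambda>n. norm (s n y - pd i j h y)) \<longlonglongrightarrow> 0" by simp
    then show ?thesis by (simp add: tendsto_norm_zero_iff LIM_zero_iff)
  qed
  have hm: "h \<in> borel_measurable borel" using hcont by (rule borel_measurable_continuous_onI)
  have hi: "integrable lborel h" by (rule integrable_lborel_bounded_support[OF hcont R0])
  have hti: "integrable lborel (\<lambda>y. h (c + y))" for c
  proof (rule integrable_lborel_bounded_support)
    show "continuous_on UNIV (\<lambda>y. h (c + y))"
      by (intro continuous_on_compose2[OF hcont] continuous_intros) auto
    show "h (c + y) = 0" if "norm y > R + norm c" for y
    proof -
      have "norm y \<le> norm (c + y) + norm c" using norm_triangle_ineq4[of "c + y" c] by simp
      then show ?thesis using that by (intro R0) simp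
    qed
  qed
  have int0: "(\<integral>y. s n y \<partial>lborel) = 0" for n
    unfolding s_def using hti[of "t n *\<^sub>R v"] hi integral_translate_lborel[OF hm, of "t n *\<^sub>R v"] by simp
  have "(\<lambda>n. \<integral>y. s n y \<partial>lborel) \<longlonglongrightarrow> (\<integral>y. pd i j h y \<partial>lborel)"
  proof (rule integral_dominated_convergence[where w = "\<lambda>y. B * indicator (cball 0 (R + 1)) y"])
    show "pd i j h \<in> borel_measurable lborel"
      using borel_measurable_continuous_onI[OF cont] by simp
    show "s n \<in> borel_measurable lborel" for n
      unfolding s_def using borel_measurable_integrable[OF hti[of "t n *\<^sub>R v"]] borel_measurable_integrable[OF hi]
      by (intro borel_measurable_scaleR borel_measurable_diff) auto
    show "integrable lborel (\<lambda>y :: real^'n^'n. B * indicator (cball 0 (R + 1)) y)"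
      using emeasure_bounded_finite[of "cball 0 (R + 1) :: (real^'n^'n) set"]
      by (intro integrable_mult_right integrable_real_indicator) auto
  qed (rule AE_I2, rule lim, rule AE_I2, rule bound)
  then have "(\<lambda>n. 0) \<longlonglongrightarrow> (\<integral>y. pd i j h y \<partial>lborel)" unfolding int0 .
  from LIMSEQ_unique[OF this tendsto_const] show ?thesis .
qed

definition test_integral :: "'n::finite test \<Rightarrow> 'n test \<Rightarrow> complex" where
  "test_integral \<phi> \<psi> = (\<integral>y. \<phi> y * \<psi> y \<partial>lborel)"

lemma test_mult_integrable: "integrable lborel (\<lambda>y. test_fun \<phi> y * test_fun \<psi> y)"
proof -
  obtain R where R: "\<And>y. \<phi> y \<noteq> 0 \<Longrightarrow> norm y \<le> R"
    using test_fun_bounded_support[of \<phi>] unfolding bounded_pos by blast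
  show ?thesis
  proof (rule integrable_lborel_bounded_support[where R = R])
    show "continuous_on UNIV (\<lambda>y. test_fun \<phi> y * test_fun \<psi> y)"
      by (intro continuous_intros smooth_continuous smooth_test_fun)
    show "test_fun \<phi> y * test_fun \<psi> y = 0" if "norm y > R" for y
      using R[of y] that by auto
  qed
qed

lemma test_integral_add_left: "test_integral (\<phi> + \<phi>') \<psi> = test_integral \<phi> \<psi> + test_integral \<phi>' \<psi>"
  by (simp add: test_integral_def test_mult_integrable distrib_right)

lemma test_integral_add_right: "test_integral \<phi> (\<psi> + \<psi>') = test_integral \<phi> \<psi> + test_integral \<phi> \<psi>'"
  by (simp add: test_integral_def test_mult_integrable distrib_left)

lemma test_integral_diff_right: "test_integral \<phi> (\<psi> - \<psi>') = test_integral \<phi> \<psi> - test_integral \<phi> \<psi>'"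
  by (simp add: test_integral_def test_mult_integrable right_diff_distrib)

lemma test_integral_scale: "test_integral (test_scale c \<phi>) \<psi> = test_integral \<phi> (test_scale c \<psi>)"
  by (simp add: test_integral_def mult_ac)

lemma test_integral_coord: "test_integral (test_coord i j \<phi>) \<psi> = test_integral \<phi> (test_coord i j \<psi>)"
  by (simp add: test_integral_def mult_ac)

lemma test_integral_pd: "test_integral (test_pd i j \<phi>) \<psi> = test_integral \<phi> (- test_pd i j \<psi>)"
proof -
  have eq: "pd i j (\<lambda>y. \<phi> y * \<psi> y) = (\<lambda>y. \<phi> y * test_pd i j \<psi> y + test_pd i j \<phi> y * \<psi> y)"
    by (simp add: pd_mult smooth_test_fun)
  have "(\<integral>y. pd i j (\<lambda>y. \<phi> y * \<psi> y) y \<partial>lborel) = 0"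
  proof (rule integral_pd_eq_0)
    show "(\<lambda>y. test_fun \<phi> y * test_fun \<psi> y) differentiable (at y)" for y
      by (intro differentiable_mult smooth_differentiable smooth_test_fun)
    show "continuous_on UNIV (pd i j (\<lambda>y. test_fun \<phi> y * test_fun \<psi> y))"
      unfolding eq by (intro continuous_intros smooth_continuous smooth_test_fun)
    show "bounded {y. test_fun \<phi> y * test_fun \<psi> y \<noteq> 0}"
      by (rule bounded_subset[OF test_fun_bounded_support[of \<phi>]]) auto
  qed
  then have "test_integral \<phi> (test_pd i j \<psi>) + test_integral (test_pd i j \<phi>) \<psi> = 0"
    unfolding eq test_integral_def by (subst (asm) Bochner_Integration.integral_add) (rule test_mult_integrable)+
  then show ?thesis
    using test_integral_diff_right[of \<phi> 0 "test_pd i j \<psi>"] by (simp add: test_integral_def eq_neg_iff_add_eq_0 add.commute)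
qed

lemma test_integral_eq_0:
  assumes "test_integral (test_cnj \<psi>) \<psi> = 0"
  shows "\<psi> = 0"
proof -
  have c: "continuous_on UNIV (test_fun \<psi>)" by (intro smooth_continuous smooth_test_fun)
  have eq: "complex_of_real ((cmod (\<psi> y))\<^sup>2) = test_cnj \<psi> y * \<psi> y" for y
    by (simp only: complex_norm_square test_fun_simps mult.commute)
  have i: "integrable lborel (\<lambda>y. (cmod (\<psi> y))\<^sup>2)"
    using test_mult_integrable[of "test_cnj \<psi>" \<psi>] unfolding eq[symmetric] complex_of_real_integrable_eq .
  have "complex_of_real (\<integral>y. (cmod (\<psi> y))\<^sup>2 \<partial>lborel) = 0"
    using assms unfolding test_integral_def eq[symmetric] by (simp only: integral_complex_of_real)
  then have "AE y in lborel. (cmod (\<psi> y))\<^sup>2 = 0"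
    using integral_nonneg_eq_0_iff_AE[OF i] by simp
  then have "AE y in lborel. \<psi> y = 0" by simp
  moreover have op: "open {y. \<psi> y \<noteq> 0}"
    using open_Collect_neq[OF c continuous_on_const] .
  moreover have "{y \<in> space lborel. \<not> \<psi> y = 0} = {y. \<psi> y \<noteq> 0}" by simp
  ultimately have "{y. \<psi> y \<noteq> 0} \<in> null_sets lborel"
    using AE_iff_null[of lborel "\<lambda>y. \<psi> y = 0"] by simp
  then have "negligible {y. \<psi> y \<noteq> 0}"
    by (simp add: negligible_iff_null_sets null_sets_completionI)
  then have "{y. \<psi> y \<noteq> 0} = {}" using open_not_negligible[OF op] by blast
  then show ?thesis by (intro test_eqI) auto
qed


section \<open>The Weyl algebra\<close>

text \<open>
  Differential operators with polynomial coefficients are represented by their action on test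
  functions.
\<close>

inductive_set diff_ops :: "('n::finite test \<Rightarrow> 'n test) set" where
  scale: "test_scale c \<in> diff_ops"
| coord: "test_coord i j \<in> diff_ops"
| pd: "test_pd i j \<in> diff_ops"
| add: "P \<in> diff_ops \<Longrightarrow> Q \<in> diff_ops \<Longrightarrow> (\<lambda>\<phi>. P \<phi> + Q \<phi>) \<in> diff_ops"
| comp: "P \<in> diff_ops \<Longrightarrow> Q \<in> diff_ops \<Longrightarrow> (\<lambda>\<phi>. P (Q \<phi>)) \<in> diff_ops"

lemma diff_ops_add: "P \<in> diff_ops \<Longrightarrow> P (\<phi> + \<psi>) = P \<phi> + P \<psi>"
  by (induction P arbitrary: \<phi> \<psi> rule: diff_ops.induct)
    (auto simp: test_pd_add intro!: test_eqI simp: algebra_simps)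

lemma test_scale_simps:
  "test_scale 1 \<phi> = \<phi>" "test_scale 0 \<phi> = 0" "test_scale (-1) \<phi> = - \<phi>"
  "test_scale (a + b) \<phi> = test_scale a \<phi> + test_scale b \<phi>"
  "test_scale (a * b) \<phi> = test_scale a (test_scale b \<phi>)"
  by (auto intro!: test_eqI simp: algebra_simps)

lemma diff_ops_scale: "P \<in> diff_ops \<Longrightarrow> P (test_scale c \<phi>) = test_scale c (P \<phi>)"
proof (induction P arbitrary: \<phi> rule: diff_ops.induct)
  case (pd i j)
  then show ?case by (rule test_pd_scale)
qed (auto intro!: test_eqI simp: algebra_simps)

lemma diff_ops_uminus: "P \<in> diff_ops \<Longrightarrow> (\<lambda>\<phi>. - P \<phi>) \<in> diff_ops"
  using diff_ops.comp[OF diff_ops.scale[of "-1"]] by (auto simp: test_scale_simps)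

lemma diff_ops_id: "(\<lambda>\<phi> :: 'n::finite test. \<phi>) \<in> diff_ops"
proof -
  have "test_scale 1 = (\<lambda>\<phi> :: 'n test. \<phi>)" by (simp add: fun_eq_iff test_scale_simps)
  moreover have "(test_scale 1 :: 'n test \<Rightarrow> 'n test) \<in> diff_ops" by (rule diff_ops.scale)
  ultimately show ?thesis by simp
qed

lemma diff_ops_zero: "(\<lambda>\<phi> :: 'n::finite test. 0 :: 'n test) \<in> diff_ops"
proof -
  have "test_scale 0 = (\<lambda>\<phi> :: 'n test. 0)" by (simp add: fun_eq_iff test_scale_simps)
  moreover have "(test_scale 0 :: 'n test \<Rightarrow> 'n test) \<in> diff_ops" by (rule diff_ops.scale)
  ultimately show ?thesis by simp
qed

typedef (overloaded) 'n::finite weyl = "diff_ops :: ('n test \<Rightarrow> 'n test) set"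
  morphisms weyl_op Abs_weyl
  using diff_ops_id by blast

setup_lifting type_definition_weyl

instantiation weyl :: (finite) "{ring, monoid_mult}"
begin

lift_definition zero_weyl :: "'a weyl" is "\<lambda>\<phi>. 0"
  by (rule diff_ops_zero)

lift_definition one_weyl :: "'a weyl" is "\<lambda>\<phi>. \<phi>"
  by (rule diff_ops_id)

lift_definition plus_weyl :: "'a weyl \<Rightarrow> 'a weyl \<Rightarrow> 'a weyl" is "\<lambda>P Q \<phi>. P \<phi> + Q \<phi>"
  by (rule diff_ops.add)

lift_definition uminus_weyl :: "'a weyl \<Rightarrow> 'a weyl" is "\<lambda>P \<phi>. - P \<phi>"
  by (rule diff_ops_uminus)

definition minus_weyl :: "'a weyl \<Rightarrow> 'a weyl \<Rightarrow> 'a weyl" where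
  "minus_weyl p q = p + - q"

lift_definition times_weyl :: "'a weyl \<Rightarrow> 'a weyl \<Rightarrow> 'a weyl" is "\<lambda>P Q \<phi>. P (Q \<phi>)"
  by (rule diff_ops.comp)

instance
  by standard (unfold minus_weyl_def, (transfer; simp add: fun_eq_iff diff_ops_add add_ac)+)

end

lift_definition weyl_scalar :: "complex \<Rightarrow> 'n::finite weyl" is test_scale
  by (rule diff_ops.scale)

lift_definition weyl_y :: "'n::finite \<Rightarrow> 'n \<Rightarrow> 'n weyl" is test_coord
  by (rule diff_ops.coord)

lift_definition weyl_d :: "'n::finite \<Rightarrow> 'n \<Rightarrow> 'n weyl" is test_pd
  by (rule diff_ops.pd)

text \<open>
  The formal transpose is the anti-automorphism with \<open>y\<^sub>i\<^sub>j \<mapsto> y\<^sub>i\<^sub>j\<close> and \<open>\<partial>\<^sub>i\<^sub>j \<mapsto> - \<partial>\<^sub>i\<^sub>j\<close>. It is well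
  defined because it is the adjoint for the bilinear form \<^const>\<open>test_integral\<close>.
\<close>

inductive formal_transpose :: "('n::finite test \<Rightarrow> 'n test) \<Rightarrow> ('n test \<Rightarrow> 'n test) \<Rightarrow> bool" where
  scale: "formal_transpose (test_scale c) (test_scale c)"
| coord: "formal_transpose (test_coord i j) (test_coord i j)"
| pd: "formal_transpose (test_pd i j) (\<lambda>\<phi>. - test_pd i j \<phi>)"
| add: "formal_transpose P P' \<Longrightarrow> formal_transpose Q Q' \<Longrightarrow>
    formal_transpose (\<lambda>\<phi>. P \<phi> + Q \<phi>) (\<lambda>\<phi>. P' \<phi> + Q' \<phi>)"
| comp: "formal_transpose P P' \<Longrightarrow> formal_transpose Q Q' \<Longrightarrow>
    formal_transpose (\<lambda>\<phi>. P (Q \<phi>)) (\<lambda>\<phi>. Q' (P' \<phi>))"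

lemma formal_transpose_integral:
  "formal_transpose P P' \<Longrightarrow> test_integral (P \<phi>) \<psi> = test_integral \<phi> (P' \<psi>)"
  by (induction P P' arbitrary: \<phi> \<psi> rule: formal_transpose.induct)
    (simp_all only: test_integral_scale test_integral_coord test_integral_pd
      test_integral_add_left test_integral_add_right)

lemma formal_transpose_unique:
  assumes "formal_transpose P P'" "formal_transpose P P''"
  shows "P' = P''"
proof
  fix \<psi>
  have "test_integral \<phi> (P' \<psi> - P'' \<psi>) = 0" for \<phi>
    using assms by (simp add: test_integral_diff_right flip: formal_transpose_integral)
  then have "P' \<psi> - P'' \<psi> = 0" by (rule test_integral_eq_0)
  then show "P' \<psi> = P'' \<psi>" by simp
qed

lemma formal_transpose_exists: "P \<in> diff_ops \<Longrightarrow> \<exists>P' \<in> diff_ops. formal_transpose P P'"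
proof (induction P rule: diff_ops.induct)
  case (scale c)
  then show ?case using diff_ops.scale formal_transpose.scale by blast
next
  case (coord i j)
  then show ?case using diff_ops.coord formal_transpose.coord by blast
next
  case (pd i j)
  then show ?case using diff_ops_uminus[OF diff_ops.pd] formal_transpose.pd by blast
next
  case (add P Q)
  then show ?case using diff_ops.add formal_transpose.add by blast
next
  case (comp P Q)
  then show ?case using diff_ops.comp formal_transpose.comp by blast
qed

lemma formal_transpose_the: "formal_transpose P P' \<Longrightarrow> (THE Q. formal_transpose P Q) = P'"
  using formal_transpose_unique by (blast intro: the_equality)

lift_definition weyl_transpose :: "'n::finite weyl \<Rightarrow> 'n weyl" is "\<lambda>P. THE Q. formal_transpose P Q"
proof -
  fix P :: "'n test \<Rightarrow> 'n test"
  assume "P \<in> diff_ops"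
  then obtain Q where "Q \<in> diff_ops" "formal_transpose P Q"
    using formal_transpose_exists by blast
  then show "(THE Q. formal_transpose P Q) \<in> diff_ops"
    by (simp add: formal_transpose_the)
qed

lemma weyl_transpose_op: "formal_transpose (weyl_op p) (weyl_op (weyl_transpose p))"
  using formal_transpose_exists[OF weyl_op[of p]] formal_transpose_the
  by (auto simp: weyl_transpose.rep_eq)

lemma weyl_transposeI: "formal_transpose (weyl_op p) (weyl_op q) \<Longrightarrow> weyl_transpose p = q"
  using formal_transpose_unique weyl_transpose_op weyl_op_inject by blast

lemma weyl_transpose_scalar: "weyl_transpose (weyl_scalar c) = weyl_scalar c"
  by (rule weyl_transposeI) (simp add: weyl_scalar.rep_eq formal_transpose.scale)

lemma weyl_transpose_y: "weyl_transpose (weyl_y i j) = weyl_y i j"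
  by (rule weyl_transposeI) (simp add: weyl_y.rep_eq formal_transpose.coord)

lemma weyl_transpose_d: "weyl_transpose (weyl_d i j) = - weyl_d i j"
  by (rule weyl_transposeI) (simp add: weyl_d.rep_eq uminus_weyl.rep_eq formal_transpose.pd)

lemma weyl_transpose_add: "weyl_transpose (p + q) = weyl_transpose p + weyl_transpose q"
  by (rule weyl_transposeI, unfold plus_weyl.rep_eq)
    (rule formal_transpose.add[OF weyl_transpose_op weyl_transpose_op])

lemma weyl_transpose_mult: "weyl_transpose (p * q) = weyl_transpose q * weyl_transpose p"
  by (rule weyl_transposeI, unfold times_weyl.rep_eq)
    (rule formal_transpose.comp[OF weyl_transpose_op weyl_transpose_op])

lemma diff_ops_test_null: "P \<in> diff_ops \<Longrightarrow> test_null \<phi> \<Longrightarrow> test_null (\<lambda>k. P (\<phi> k))"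
  by (induction P arbitrary: \<phi> rule: diff_ops.induct)
    (simp_all add: test_null_scale test_null_coord test_null_pd test_null_add)

lift_definition weyl_act :: "'n::finite weyl \<Rightarrow> 'n distribution \<Rightarrow> 'n distribution" is
  "\<lambda>p u \<phi>. u (weyl_op (weyl_transpose p) \<phi>)"
  by (simp add: diff_ops_add diff_ops_scale diff_ops_test_null weyl_op)

lemma distribution_eqI: "(\<And>\<phi>. pairing u \<phi> = pairing v \<phi>) \<Longrightarrow> u = v"
  by (simp add: pairing_inject[symmetric] fun_eq_iff)

lemma pairing_simps [simp]:
  "pairing 0 \<phi> = 0" "pairing (u + v) \<phi> = pairing u \<phi> + pairing v \<phi>" "pairing (- u) \<phi> = - pairing u \<phi>"
  by (simp_all add: zero_distribution.rep_eq plus_distribution.rep_eq uminus_distribution.rep_eq)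

lemma pairing_linear:
  "pairing u (\<phi> + \<psi>) = pairing u \<phi> + pairing u \<psi>" "pairing u (test_scale c \<phi>) = c * pairing u \<phi>"
  using pairing[of u] by auto

lemma pairing_uminus: "pairing u (- \<phi>) = - pairing u \<phi>"
  using pairing_linear(2)[of u "-1" \<phi>] by (simp add: test_scale_simps)

lemma pairing_weyl_act_scalar: "pairing (weyl_act (weyl_scalar c) u) \<phi> = c * pairing u \<phi>"
  by (simp add: weyl_act.rep_eq weyl_transpose_scalar weyl_scalar.rep_eq pairing_linear)

lemma pairing_weyl_act_y: "pairing (weyl_act (weyl_y i j) u) \<phi> = pairing u (test_coord i j \<phi>)"
  by (simp add: weyl_act.rep_eq weyl_transpose_y weyl_y.rep_eq)

lemma pairing_weyl_act_d: "pairing (weyl_act (weyl_d i j) u) \<phi> = - pairing u (test_pd i j \<phi>)"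
  by (simp add: weyl_act.rep_eq weyl_transpose_d weyl_d.rep_eq uminus_weyl.rep_eq pairing_uminus)

lemma weyl_act_one: "weyl_act 1 u = u"
proof -
  have "weyl_scalar 1 = (1 :: 'a weyl)"
    by transfer (simp add: fun_eq_iff test_scale_simps)
  then show ?thesis
    using pairing_weyl_act_scalar[of 1 u] by (intro distribution_eqI) simp
qed

lemma weyl_act_add: "weyl_act (p + q) u = weyl_act p u + weyl_act q u"
  by (rule distribution_eqI)
    (simp add: weyl_act.rep_eq weyl_transpose_add plus_weyl.rep_eq pairing_linear)

lemma weyl_act_mult: "weyl_act (p * q) u = weyl_act p (weyl_act q u)"
  by (rule distribution_eqI)
    (simp add: weyl_act.rep_eq weyl_transpose_mult times_weyl.rep_eq)

definition weyl_ann :: "'n::finite distribution \<Rightarrow> 'n weyl set" where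
  "weyl_ann u = {p. weyl_act p u = 0}"

text \<open>
  The Leibniz formula; the factors commute, so the order of multiplication chosen here is immaterial.
\<close>

definition weyl_det :: "'n::{finite,linorder} weyl" where
  "weyl_det = (\<Sum>\<sigma> | \<sigma> permutes (UNIV :: 'n set).
     weyl_scalar (of_int (sign \<sigma>)) * prod_list (map (\<lambda>i. weyl_y i (\<sigma> i)) (sorted_list_of_set UNIV)))"

lemma weyl_op_sum: "test_fun (weyl_op (sum p A) \<phi>) y = (\<Sum>a\<in>A. test_fun (weyl_op (p a) \<phi>) y)"
  by (induction A rule: infinite_finite_induct) (simp_all add: zero_weyl.rep_eq plus_weyl.rep_eq)

lemma weyl_op_prod_list:
  "test_fun (weyl_op (prod_list (map (\<lambda>i. weyl_y i (\<sigma> i)) is)) \<phi>) y =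
    prod_list (map (\<lambda>i. complex_of_real (y $ i $ \<sigma> i)) is) * test_fun \<phi> y"
  by (induction "is") (simp_all add: one_weyl.rep_eq times_weyl.rep_eq weyl_y.rep_eq)

lemma weyl_op_det:
  "test_fun (weyl_op weyl_det \<phi>) y = complex_of_real (det y) * test_fun \<phi> y"
proof -
  have "prod_list (map (\<lambda>i. complex_of_real (y $ i $ \<sigma> i)) (sorted_list_of_set UNIV)) =
    (\<Prod>i\<in>UNIV. complex_of_real (y $ i $ \<sigma> i))" for \<sigma> :: "'a \<Rightarrow> 'a"
    using prod.distinct_set_conv_list[of "sorted_list_of_set (UNIV :: 'a set)"
        "\<lambda>i. complex_of_real (y $ i $ \<sigma> i)"] by simp
  then show ?thesis
    by (simp add: weyl_det_def weyl_op_sum weyl_op_prod_list times_weyl.rep_eq weyl_scalar.rep_eq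
        det_def sum_distrib_right mult.assoc)
qed


section \<open>Left ideals\<close>

definition left_ideal :: "'a::ring set \<Rightarrow> bool" where
  "left_ideal I \<longleftrightarrow> 0 \<in> I \<and> (\<forall>x\<in>I. \<forall>y\<in>I. x + y \<in> I) \<and> (\<forall>r. \<forall>x\<in>I. r * x \<in> I)"

definition left_ideal_generated :: "'a::ring set \<Rightarrow> 'a set" where
  "left_ideal_generated G = \<Inter>{I. left_ideal I \<and> G \<subseteq> I}"


section \<open>Haar measure on the special orthogonal group\<close>

definition SO :: "(real^'n::finite^'n) set" where
  "SO = {y. transpose y ** y = mat 1 \<and> det y = 1}"

text \<open>
  As \<^const>\<open>SO\<close> is a compact group, the left invariant probability measure is unique and also right
  invariant.
\<close>

definition SO_haar_measure :: "(real^'n::finite^'n) measure \<Rightarrow> bool" where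
  "SO_haar_measure M \<longleftrightarrow> sets M = sets (restrict_space borel SO) \<and> prob_space M \<and>
     (\<forall>g\<in>SO. distr M M (\<lambda>y. g ** y) = M)"

text \<open>
  Meaningful for measures whose integral is a distribution, in particular for the Haar measure
  (see \<open>pairing_SO_haar\<close>).
\<close>

definition measure_distribution :: "(real^'n::finite^'n) measure \<Rightarrow> 'n distribution" where
  "measure_distribution M = Abs_distribution (\<lambda>\<phi>. \<integral>y. \<phi> y \<partial>M)"

lemma test_integrable_SO_haar:
  assumes "SO_haar_measure M"
  shows "integrable M (test_fun \<phi>)"
proof -
  interpret prob_space M using assms by (simp add: SO_haar_measure_def)
  have c: "continuous_on UNIV (test_fun \<phi>)" by (intro smooth_continuous smooth_test_fun)
  have "test_fun \<phi> \<in> borel_measurable (restrict_space borel SO)"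
    using borel_measurable_continuous_onI[OF c] by (rule measurable_restrict_space1)
  then have m: "test_fun \<phi> \<in> borel_measurable M"
    using assms measurable_cong_sets[of M "restrict_space borel SO" "borel :: complex measure" borel]
    by (simp add: SO_haar_measure_def)
  have "compact (test_fun \<phi> ` closure {y. \<phi> y \<noteq> 0})"
    using test_fun[of \<phi>] c by (intro compact_continuous_image) (auto intro: continuous_on_subset)
  then obtain B where B: "B > 0" "\<And>y. y \<in> closure {y. \<phi> y \<noteq> 0} \<Longrightarrow> norm (\<phi> y) \<le> B"
    by (force dest!: compact_imp_bounded simp: bounded_pos)
  have "norm (\<phi> y) \<le> B" for y
    using B closure_subset[of "{y. \<phi> y \<noteq> 0}"] by (cases "\<phi> y = 0") auto
  then show ?thesis using m by (intro integrable_const_bound[of _ B]) auto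
qed

lemma pairing_SO_haar:
  assumes "SO_haar_measure M"
  shows "pairing (measure_distribution M) \<phi> = (\<integral>y. \<phi> y \<partial>M)"
proof -
  interpret prob_space M using assms by (simp add: SO_haar_measure_def)
  have "(\<lambda>k. \<integral>y. \<phi> k y \<partial>M) \<longlonglongrightarrow> 0" if "test_null \<phi>" for \<phi>
  proof (rule LIMSEQ_I)
    fix e :: real assume e: "e > 0"
    have "uniform_limit UNIV (\<lambda>k. iter_pd [] (\<phi> k)) (\<lambda>_. 0) sequentially"
      using that unfolding test_null_def by blast
    from uniform_limitD[OF this, of "e / 2"] e
    obtain N where N: "\<And>k y. k \<ge> N \<Longrightarrow> norm (\<phi> k y) < e / 2"
      unfolding eventually_sequentially by auto
    have "norm ((\<integral>y. \<phi> k y \<partial>M) - 0) < e" if "k \<ge> N" for k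
    proof -
      have "norm (\<integral>y. \<phi> k y \<partial>M) \<le> (\<integral>y. norm (\<phi> k y) \<partial>M)"
        by (rule integral_norm_bound)
      also have "\<dots> \<le> (\<integral>y. e / 2 \<partial>M)"
        using N[OF that] test_integrable_SO_haar[OF assms]
        by (intro integral_mono) (auto intro: less_imp_le)
      finally show ?thesis using e by (simp add: prob_space)
    qed
    then show "\<exists>N. \<forall>k\<ge>N. norm ((\<integral>y. \<phi> k y \<partial>M) - 0) < e" by blast
  qed
  then show ?thesis
    unfolding measure_distribution_def
    by (subst Abs_distribution_inverse)
      (auto simp: plus_test.rep_eq test_scale.rep_eq test_integrable_SO_haar[OF assms])
qed

end

theory Submission
  imports Defs
begin

text \<open>
  Let \<open>I\<close> be the ideal and let \<open>p\<close> be an operator of order \<open>k\<close> that annihilates \<open>\<mu>\<close>. The entries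
      \<open>u\<close> of
  \<open>y\<^sup>T y - 1\<close> annihilate \<open>\<mu>\<close>, so all commutators \<open>[p, u]\<close> annihilate \<open>\<mu>\<close>; they have smaller order,
      and by
  induction they belong to \<open>I\<close>. As \<open>I\<close> contains the tangent fields, an Euler type identity recovers
  \<open>2 k p\<close> from these commutators up to \<open>I\<close> and operators of smaller order,
      which reduces the claim to
  multiplication operators, that is, to polynomials \<open>f\<close> with \<open>f \<mu> =
      0\<close>. Such an \<open>f\<close> vanishes on the group
  because the Haar measure has full support.

  It remains to write a polynomial that vanishes on the real group as a combination of the
      equations.
  Where \<open>1 + g y\<close> is invertible the Cayley transform does this after multiplication with a power of
  \<open>det (1 + g y)\<close>, and for the diagonal sign matrices \<open>g\<close> of determinant 1 these determinants
      generate
  the unit ideal, since they add up to \<open>2\<^sup>n\<^sup>-\<^sup>1 (1 + det y)\<close>.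

  Conversely, left invariance shows that \<open>\<mu>\<close> is annihilated by the fields that generate left
  rotations, and the ones generating right rotations are combinations of these along the group.
\<close>

section \<open>Polynomial functions\<close>

text \<open>Polynomials are represented by the functions they define on real matrices. Nothing is
  lost: over an infinite field a polynomial is determined by its values, and its action on test
  functions depends on these values alone.\<close>

inductive_set polyfun :: "(real^'n::finite^'n \<Rightarrow> complex) set" where
  const: "(\<lambda>_. c) \<in> polyfun"
| coord: "(\<lambda>y. complex_of_real (y $ i $ j)) \<in> polyfun"
| add: "f \<in> polyfun \<Longrightarrow> g \<in> polyfun \<Longrightarrow> (\<lambda>y. f y + g y) \<in> polyfun"
| mult: "f \<in> polyfun \<Longrightarrow> g \<in> polyfun \<Longrightarrow> (\<lambda>y. f y * g y) \<in> polyfun"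

lemma polyfun_uminus: "f \<in> polyfun \<Longrightarrow> (\<lambda>y. - f y) \<in> polyfun"
  using polyfun.mult[OF polyfun.const[of "-1"], of f] by simp

lemma polyfun_diff: "f \<in> polyfun \<Longrightarrow> g \<in> polyfun \<Longrightarrow> (\<lambda>y. f y - g y) \<in> polyfun"
  using polyfun.add[OF _ polyfun_uminus, of f g] by simp

lemma polyfun_sum: "(\<And>a. a \<in> A \<Longrightarrow> f a \<in> polyfun) \<Longrightarrow> (\<lambda>y. \<Sum>a\<in>A. f a y) \<in> polyfun"
  by (induction A rule: infinite_finite_induct) (auto intro: polyfun.intros)

lemma polyfun_prod: "(\<And>a. a \<in> A \<Longrightarrow> f a \<in> polyfun) \<Longrightarrow> (\<lambda>y. \<Prod>a\<in>A. f a y) \<in> polyfun"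
  by (induction A rule: infinite_finite_induct) (auto intro: polyfun.intros)

lemma polyfun_power: "f \<in> polyfun \<Longrightarrow> (\<lambda>y. f y ^ k) \<in> polyfun"
  by (induction k) (auto intro: polyfun.intros)

lemmas polyfun_intros = polyfun.intros polyfun_uminus polyfun_diff polyfun_sum polyfun_prod
  polyfun_power

lemma polyfun_cnj: "f \<in> polyfun \<Longrightarrow> (\<lambda>y. cnj (f y)) \<in> polyfun"
  by (induction rule: polyfun.induct) (auto intro: polyfun.intros)

lemma smooth_const: "smooth (\<lambda>y. c)"
proof -
  have "pd i j (\<lambda>y. c) = (\<lambda>y. 0)" for i j :: 'a and c
    by (rule ext, subst pd_eqI[OF has_derivative_const]) simp
  then have "\<exists>c'. iter_pd is (\<lambda>y::real^'a^'a. c) = (\<lambda>y. c')" for "is"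
    by (induction "is" arbitrary: c) auto
  then show ?thesis
    unfolding smooth_def by (metis differentiable_on_const)
qed

text \<open>The smooth factor \<open>g\<close> makes the induction work: a product
  \<open>f1 * f2\<close> is absorbed one factor at a time.\<close>

lemma smooth_polyfun_mult: "f \<in> polyfun \<Longrightarrow> smooth g \<Longrightarrow> smooth (\<lambda>y. f y * g y)"
proof (induction arbitrary: g rule: polyfun.induct)
  case (mult f1 f2)
  then show ?case by (simp add: mult.assoc)
qed (simp_all add: smooth_cmul smooth_coord_mult smooth_add distrib_right)

lemma smooth_polyfun: "f \<in> polyfun \<Longrightarrow> smooth f"
  using smooth_polyfun_mult[OF _ smooth_const[of 1]] by simp

lemma pd_const: "pd i j (\<lambda>_. c) = (\<lambda>_. 0)"
  by (rule ext, subst pd_eqI[OF has_derivative_const]) simp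

lemma pd_coord: "pd k l (\<lambda>y. complex_of_real (y $ i $ j)) = (\<lambda>_. of_bool (k = i \<and> l = j))"
  by (rule ext, subst pd_eqI[OF has_derivative_coord]) (auto simp: axis_def)

lemma polyfun_pd: "f \<in> polyfun \<Longrightarrow> pd i j f \<in> polyfun"
  by (induction rule: polyfun.induct)
    (auto simp: pd_const pd_coord pd_add pd_mult smooth_polyfun intro!: polyfun.intros)

section \<open>Multiplication operators\<close>

lemma weyl_eqI: "(\<And>\<phi> y. test_fun (weyl_op p \<phi>) y = test_fun (weyl_op q \<phi>) y) \<Longrightarrow> p = q"
  by (metis ext test_eqI weyl_op_inject)

lemma weyl_op_simps [simp]:
  "weyl_op 0 \<phi> = 0" "weyl_op 1 \<phi> = \<phi>" "weyl_op (p + q) \<phi> = weyl_op p \<phi> + weyl_op q \<phi>"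
  "weyl_op (- p) \<phi> = - weyl_op p \<phi>" "weyl_op (p - q) \<phi> = weyl_op p \<phi> - weyl_op q \<phi>"
  "weyl_op (p * q) \<phi> = weyl_op p (weyl_op q \<phi>)" "weyl_op (weyl_scalar c) \<phi> = test_scale c \<phi>"
  "weyl_op (weyl_y i j) \<phi> = test_coord i j \<phi>" "weyl_op (weyl_d i j) \<phi> = test_pd i j \<phi>"
  by (simp_all only: minus_weyl_def minus_test_def zero_weyl.rep_eq one_weyl.rep_eq plus_weyl.rep_eq
      uminus_weyl.rep_eq times_weyl.rep_eq weyl_scalar.rep_eq weyl_y.rep_eq weyl_d.rep_eq)

text \<open>For polynomial \<open>f\<close> the choice is unique, because an element of the Weyl
  algebra is determined by its action on test functions (\<open>weyl_eqI\<close>).\<close>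

definition mulop :: "(real^'n::finite^'n \<Rightarrow> complex) \<Rightarrow> 'n weyl" where
  "mulop f = (SOME p. \<forall>\<phi> y. test_fun (weyl_op p \<phi>) y = f y * test_fun \<phi> y)"

lemma weyl_op_mulop [simp]:
  assumes "f \<in> polyfun"
  shows "test_fun (weyl_op (mulop f) \<phi>) y = f y * test_fun \<phi> y"
proof -
  have "\<exists>p. \<forall>\<phi> y. test_fun (weyl_op p \<phi>) y = f y * test_fun \<phi> y"
    using assms
  proof (induction rule: polyfun.induct)
    case (const c)
    show ?case by (rule exI[of _ "weyl_scalar c"]) simp
  next
    case (coord i j)
    show ?case by (rule exI[of _ "weyl_y i j"]) simp
  next
    case (add f g)
    then obtain p q where "\<forall>\<phi> y. test_fun (weyl_op p \<phi>) y = f y * test_fun \<phi> y"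
      "\<forall>\<phi> y. test_fun (weyl_op q \<phi>) y = g y * test_fun \<phi> y" by blast
    then show ?case by (intro exI[of _ "p + q"]) (simp add: distrib_right)
  next
    case (mult f g)
    then obtain p q where "\<forall>\<phi> y. test_fun (weyl_op p \<phi>) y = f y * test_fun \<phi> y"
      "\<forall>\<phi> y. test_fun (weyl_op q \<phi>) y = g y * test_fun \<phi> y" by blast
    then show ?case by (intro exI[of _ "p * q"]) (simp add: mult.assoc)
  qed
  from someI_ex[OF this] show ?thesis unfolding mulop_def by blast
qed

lemma weyl_scalar_mulop: "weyl_scalar c = mulop (\<lambda>_. c)"
  by (rule weyl_eqI) (simp add: polyfun.const)

lemma weyl_y_mulop: "weyl_y i j = mulop (\<lambda>y. complex_of_real (y $ i $ j))"
  by (rule weyl_eqI) (simp add: polyfun.coord)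

lemma weyl_one_mulop: "1 = mulop (\<lambda>_. 1)"
  by (rule weyl_eqI) (simp add: polyfun.const)

lemma mulop_zero: "mulop (\<lambda>_. 0) = 0"
  by (rule weyl_eqI) (simp add: polyfun.const)

lemma mulop_add:
  "f \<in> polyfun \<Longrightarrow> g \<in> polyfun \<Longrightarrow> mulop f + mulop g = mulop (\<lambda>y. f y + g y)"
  by (rule weyl_eqI) (simp add: polyfun_intros distrib_right)

lemma mulop_diff:
  "f \<in> polyfun \<Longrightarrow> g \<in> polyfun \<Longrightarrow> mulop f - mulop g = mulop (\<lambda>y. f y - g y)"
  by (rule weyl_eqI) (simp add: polyfun_intros left_diff_distrib)

lemma mulop_uminus: "f \<in> polyfun \<Longrightarrow> - mulop f = mulop (\<lambda>y. - f y)"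
  by (rule weyl_eqI) (simp add: polyfun_intros)

lemma mulop_mult:
  "f \<in> polyfun \<Longrightarrow> g \<in> polyfun \<Longrightarrow> mulop f * mulop g = mulop (\<lambda>y. f y * g y)"
  by (rule weyl_eqI) (simp add: polyfun_intros mult.assoc)

lemma mulop_sum:
  "(\<And>a. a \<in> A \<Longrightarrow> f a \<in> polyfun) \<Longrightarrow> (\<Sum>a\<in>A. mulop (f a)) = mulop (\<lambda>y. \<Sum>a\<in>A. f a y)"
  by (induction A rule: infinite_finite_induct) (auto simp: mulop_zero mulop_add polyfun_intros)

lemma mulop_commute: "f \<in> polyfun \<Longrightarrow> g \<in> polyfun \<Longrightarrow> mulop f * mulop g = mulop g * mulop f"
  by (simp add: mulop_mult mult.commute)

lemma polyfun_det:
  assumes "\<And>i j. (\<lambda>y. complex_of_real (A y $ i $ j)) \<in> polyfun"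
  shows "(\<lambda>y. complex_of_real (det (A y))) \<in> polyfun"
  unfolding det_def by (auto intro!: polyfun_intros assms)

lemma weyl_det_mulop: "weyl_det = mulop (\<lambda>y. complex_of_real (det y))"
  by (rule weyl_eqI) (simp add: polyfun_det polyfun.coord weyl_op_det)

text \<open>The Leibniz rule. Together with \<open>weyl_d_commute\<close> it yields the commutators
  that the order filtration needs.\<close>

lemma weyl_d_mulop:
  assumes "f \<in> polyfun"
  shows "weyl_d i j * mulop f = mulop f * weyl_d i j + mulop (pd i j f)"
proof (rule weyl_eqI)
  fix \<phi> :: "'a test" and y
  have "test_fun (weyl_op (mulop f) \<phi>) = (\<lambda>y. f y * test_fun \<phi> y)"
    using assms by auto
  then show "test_fun (weyl_op (weyl_d i j * mulop f) \<phi>) y =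
    test_fun (weyl_op (mulop f * weyl_d i j + mulop (pd i j f)) \<phi>) y"
    using assms by (simp add: pd_mult smooth_polyfun smooth_test_fun polyfun_pd)
qed

section \<open>Symmetry of mixed partial derivatives\<close>

lemma second_difference_mean_value:
  fixes f fa fab :: "'v::real_normed_vector \<Rightarrow> real"
  assumes fa: "\<And>y s. ((\<lambda>s. f (y + s *\<^sub>R a)) has_real_derivative fa (y + s *\<^sub>R a)) (at s)"
    and fab: "\<And>y s. ((\<lambda>s. fa (y + s *\<^sub>R b)) has_real_derivative fab (y + s *\<^sub>R b)) (at s)"
    and h: "h > 0"
  shows "\<exists>z. norm (z - y) \<le> h * (norm a + norm b) \<and>
    f (y + h *\<^sub>R a + h *\<^sub>R b) - f (y + h *\<^sub>R a) - f (y + h *\<^sub>R b) + f y = h * h * fab z"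
proof -
  \<comment> \<open>The mean value theorem is applied to the increment of \<open>f\<close> along
    \<open>h b\<close>, as a function of the step in direction \<open>a\<close>, and below to
    \<open>fa\<close> in direction \<open>b\<close>.\<close>
  have "\<exists>s>0. s < h \<and> (f (y + h *\<^sub>R b + h *\<^sub>R a) - f (y + h *\<^sub>R a)) - (f (y + h *\<^sub>R b +
      0 *\<^sub>R a) - f (y + 0 *\<^sub>R a)) =
    (h - 0) * (fa (y + h *\<^sub>R b + s *\<^sub>R a) - fa (y + s *\<^sub>R a))"
    by (rule MVT2[OF h]) (intro DERIV_diff fa)
  then obtain s where s: "0 < s" "s < h" and 1: "f (y + h *\<^sub>R a + h *\<^sub>R b) - f (y +
      h *\<^sub>R a) - f (y + h *\<^sub>R b) + f y =
    h * (fa (y + s *\<^sub>R a + h *\<^sub>R b) - fa (y + s *\<^sub>R a))"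
    by (auto simp: algebra_simps)
  have "\<exists>t>0. t < h \<and> fa (y + s *\<^sub>R a + h *\<^sub>R b) - fa (y + s *\<^sub>R a + 0 *\<^sub>R b) =
    (h - 0) * fab (y + s *\<^sub>R a + t *\<^sub>R b)"
    by (rule MVT2[OF h]) (rule fab)
  then obtain t where t: "0 < t" "t < h" and 2: "fa (y + s *\<^sub>R a + h *\<^sub>R b) - fa (y + s *\<^sub>R a) =
    h * fab (y + s *\<^sub>R a + t *\<^sub>R b)" by auto
  have "norm (s *\<^sub>R a + t *\<^sub>R b) \<le> h * (norm a + norm b)"
    using s t unfolding distrib_left
    by (intro norm_triangle_le add_mono) (auto intro: mult_right_mono)
  then show ?thesis
    using 1 2 by (intro exI[of _ "y + s *\<^sub>R a + t *\<^sub>R b"]) simp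
qed

text \<open>The second difference is symmetric in \<open>a\<close> and \<open>b\<close>, so for
  every step size the two mixed derivatives agree at some points \<open>z\<close> and
  \<open>w\<close> near \<open>y\<close>. These points converge to \<open>y\<close>, and continuity
  gives equality there.\<close>

lemma mixed_derivatives_eq:
  fixes f fa fb fab fba :: "'v::real_normed_vector \<Rightarrow> real"
  assumes fa: "\<And>y s. ((\<lambda>s. f (y + s *\<^sub>R a)) has_real_derivative fa (y + s *\<^sub>R a)) (at s)"
    and fab: "\<And>y s. ((\<lambda>s. fa (y + s *\<^sub>R b)) has_real_derivative fab (y + s *\<^sub>R b)) (at s)"
    and fb: "\<And>y s. ((\<lambda>s. f (y + s *\<^sub>R b)) has_real_derivative fb (y + s *\<^sub>R b)) (at s)"
    and fba: "\<And>y s. ((\<lambda>s. fb (y + s *\<^sub>R a)) has_real_derivative fba (y + s *\<^sub>R a)) (at s)"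
    and c: "continuous_on UNIV fab" "continuous_on UNIV fba"
  shows "fab y = fba y"
proof -
  define h where "h n = inverse (real (Suc n))" for n
  have h: "h n > 0" for n by (simp add: h_def)
  have hlim: "(\<lambda>n. h n * C) \<longlonglongrightarrow> 0" for C
    unfolding h_def using tendsto_mult_left_zero[OF LIMSEQ_inverse_real_of_nat] .
  have "\<exists>z w. norm (z - y) \<le> h n * (norm a + norm b) \<and> norm (w - y) \<le> h n * (norm b + norm a) \<and>
    fab z = fba w" for n
  proof -
    from second_difference_mean_value[OF fa fab h] second_difference_mean_value[OF fb fba h]
    obtain z w where *: "norm (z - y) \<le> h n * (norm a + norm b)" "norm (w - y) \<le> h n * (norm b +
        norm a)"
      "f (y + h n *\<^sub>R a + h n *\<^sub>R b) - f (y + h n *\<^sub>R a) - f (y + h n *\<^sub>R b) + f y =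
          h n * h n * fab z"
      "f (y + h n *\<^sub>R b + h n *\<^sub>R a) - f (y + h n *\<^sub>R b) - f (y + h n *\<^sub>R a) + f y =
          h n * h n * fba w"
      by meson
    then have "h n * h n * fab z = h n * h n * fba w" by (simp add: algebra_simps)
    then show ?thesis using * h[of n] by (intro exI[of _ z] exI[of _ w]) simp
  qed
  then obtain z w where zw: "\<And>n. norm (z n - y) \<le> h n * (norm a + norm b)"
    "\<And>n. norm (w n - y) \<le> h n * (norm b + norm a)" "\<And>n. fab (z n) = fba (w n)" by metis
  have "z \<longlonglongrightarrow> y" "w \<longlonglongrightarrow> y"
    by (auto intro!: LIM_zero_cancel Lim_null_comparison[OF _ hlim] zw always_eventually)
  then have "(\<lambda>n. fab (z n)) \<longlonglongrightarrow> fab y" "(\<lambda>n. fba (w n)) \<longlonglongrightarrow> fba y"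
    using c by (auto simp: continuous_on_eq_continuous_at isCont_tendsto_compose)
  then show ?thesis unfolding zw(3) by (rule LIMSEQ_unique)
qed

lemma has_vector_derivative_along_unit:
  assumes "smooth f"
  shows "((\<lambda>s. f (y + s *\<^sub>R axis i (axis j 1))) has_vector_derivative
    pd i j f (y + s *\<^sub>R axis i (axis j 1))) (at s)"
proof -
  let ?v = "axis i (axis j 1) :: real^'a^'a"
  interpret D: bounded_linear "frechet_derivative f (at (y + s *\<^sub>R ?v))"
    using smooth_has_derivative[OF assms] has_derivative_bounded_linear by blast
  have "((\<lambda>s. y + s *\<^sub>R ?v) has_derivative (\<lambda>r. r *\<^sub>R ?v)) (at s)"
    by (auto intro!: derivative_eq_intros)
  from has_derivative_compose[OF this smooth_has_derivative[OF assms]]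
  show ?thesis by (simp add: has_vector_derivative_def D.scaleR pd_def)
qed

lemma pd_commute:
  assumes "smooth f"
  shows "pd i j (pd k l f) = pd k l (pd i j f)"
proof -
  \<comment> \<open>The mean value theorem needs real values; \<open>L\<close> will be the real and
    the imaginary part.\<close>
  have "L (pd i j (pd k l f) y) = L (pd k l (pd i j f) y)" if L: "bounded_linear L"
    for L :: "complex \<Rightarrow> real" and y
  proof (rule mixed_derivatives_eq[where f = "\<lambda>y. L (f y)" and fa = "\<lambda>y. L (pd k l f y)"
        and fb = "\<lambda>y. L (pd i j f y)" and fab = "\<lambda>y. L (pd i j (pd k l f) y)"
        and fba = "\<lambda>y. L (pd k l (pd i j f) y)" and a = "axis k (axis l 1)" and b =
            "axis i (axis j 1)"])
    have *: "((\<lambda>s. L (g (y + s *\<^sub>R axis i (axis j 1)))) has_real_derivative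
      L (pd i j g (y + s *\<^sub>R axis i (axis j 1)))) (at s)" if "smooth g" for g y s i j
      using bounded_linear.has_vector_derivative[OF L has_vector_derivative_along_unit[OF that]]
      by (simp add: has_real_derivative_iff_has_vector_derivative)
    show "continuous_on UNIV (\<lambda>y. L (pd i j (pd k l f) y))"
      "continuous_on UNIV (\<lambda>y. L (pd k l (pd i j f) y))"
      using assms by (auto intro!: bounded_linear.continuous_on[OF L] smooth_continuous smooth_pd)
    show "((\<lambda>s. L (f (y + s *\<^sub>R axis k (axis l 1)))) has_real_derivative
        L (pd k l f (y + s *\<^sub>R axis k (axis l 1)))) (at s)"
      "((\<lambda>s. L (pd k l f (y + s *\<^sub>R axis i (axis j 1)))) has_real_derivative
        L (pd i j (pd k l f) (y + s *\<^sub>R axis i (axis j 1)))) (at s)"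
      "((\<lambda>s. L (f (y + s *\<^sub>R axis i (axis j 1)))) has_real_derivative
        L (pd i j f (y + s *\<^sub>R axis i (axis j 1)))) (at s)"
      "((\<lambda>s. L (pd i j f (y + s *\<^sub>R axis k (axis l 1)))) has_real_derivative
        L (pd k l (pd i j f) (y + s *\<^sub>R axis k (axis l 1)))) (at s)" for y s
      by (intro * smooth_pd assms)+
  qed
  from this[OF bounded_linear_Re] this[OF bounded_linear_Im] show ?thesis
    by (intro ext complex_eqI)
qed

lemma weyl_d_commute: "weyl_d i j * weyl_d k l = weyl_d k l * weyl_d i j"
  by (rule weyl_eqI) (simp only: weyl_op_simps test_pd.rep_eq pd_commute[OF smooth_test_fun,
      of i j k l])

section \<open>The order filtration\<close>

text \<open>The index is a strict bound for the order, so that \<open>0\<close> is the only operator at index \<open>0\<close>.\<close>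

inductive ops_below :: "'n::finite weyl \<Rightarrow> nat \<Rightarrow> bool" (infix \<open>below\<close> 50) where
  zero: "0 below k"
| mulop: "f \<in> polyfun \<Longrightarrow> mulop f below (Suc k)"
| d: "p below k \<Longrightarrow> weyl_d i j * p below (Suc k)"
| add: "p below k \<Longrightarrow> q below k \<Longrightarrow> p + q below k"

lemma ops_below_uminus: "p below k \<Longrightarrow> - p below k"
proof (induction rule: ops_below.induct)
  case (d p k i j)
  then show ?case using ops_below.d[of "- p" k i j] by simp
qed (auto simp: mulop_uminus polyfun_intros intro!: ops_below.intros ops_below.add[of "- p" for p,
    simplified])

lemma ops_below_diff: "p below k \<Longrightarrow> q below k \<Longrightarrow> p - q below k"
  using ops_below.add[OF _ ops_below_uminus, of p k q] by simp

lemma ops_below_sum: "(\<And>a. a \<in> A \<Longrightarrow> p a below k) \<Longrightarrow> sum p A below k"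
  by (induction A rule: infinite_finite_induct) (auto intro: ops_below.intros)

lemma ops_below_Suc: "p below k \<Longrightarrow> p below (Suc k)"
  by (induction rule: ops_below.induct) (auto intro: ops_below.intros)

lemma ops_below_mono: "p below k \<Longrightarrow> k \<le> m \<Longrightarrow> p below m"
  by (induction m) (auto simp: le_Suc_eq intro: ops_below_Suc)

lemma ops_below_0: "p below 0 \<Longrightarrow> p = 0"
proof -
  have "p below k \<Longrightarrow> k = 0 \<Longrightarrow> p = 0" for k
    by (induction rule: ops_below.induct) auto
  then show "p below 0 \<Longrightarrow> p = 0" by simp
qed

lemma ops_below_1: "p below 1 \<Longrightarrow> \<exists>f\<in>polyfun. p = mulop f"
proof -
  have zero: "\<exists>f\<in>polyfun. (0 :: 'a weyl) = mulop f"
    using mulop_zero polyfun.const by metis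
  have "p below k \<Longrightarrow> k = 1 \<Longrightarrow> \<exists>f\<in>polyfun. p = mulop f" for k
  proof (induction rule: ops_below.induct)
    case (d p k i j)
    then show ?case using ops_below_0[of p] zero by simp
  next
    case (add p k q)
    then show ?case by (metis mulop_add polyfun.add)
  qed (use zero in auto)
  then show "p below 1 \<Longrightarrow> \<exists>f\<in>polyfun. p = mulop f" by simp
qed

lemma ops_below_mulop_left: "p below k \<Longrightarrow> f \<in> polyfun \<Longrightarrow> mulop f * p below k"
proof (induction arbitrary: f rule: ops_below.induct)
  case (d p k i j)
  have "mulop f * (weyl_d i j * p) = weyl_d i j * (mulop f * p) - mulop (pd i j f) * p"
    using weyl_d_mulop[OF d.prems, of i j]
    by (simp add: algebra_simps flip: mult.assoc)
  then show ?case
    using d by (auto intro!: ops_below_diff ops_below.d intro: ops_below_Suc simp: polyfun_pd)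
qed (auto simp: mulop_mult distrib_left intro!: ops_below.intros polyfun_intros)

text \<open>Derivatives commute with one another, so only the coefficients get differentiated and
  the order does not grow.\<close>

lemma ops_below_d_commutator:
  "p below k \<Longrightarrow> weyl_d i j * p - p * weyl_d i j below k"
proof (induction rule: ops_below.induct)
  case (zero k)
  then show ?case by (simp add: ops_below.zero)
next
  case (mulop f k)
  then show ?case by (simp add: weyl_d_mulop polyfun_pd ops_below.mulop)
next
  case (d p k a b)
  have "weyl_d i j * (weyl_d a b * p) - weyl_d a b * p * weyl_d i j =
    weyl_d a b * (weyl_d i j * p - p * weyl_d i j)"
    by (simp add: right_diff_distrib weyl_d_commute[of i j a b] flip: mult.assoc)
  then show ?case using d by (simp add: ops_below.d)
next
  case (add p k q)
  have "weyl_d i j * (p + q) - (p + q) * weyl_d i j =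
    (weyl_d i j * p - p * weyl_d i j) + (weyl_d i j * q - q * weyl_d i j)"
    by (simp add: algebra_simps)
  then show ?case using add by (simp add: ops_below.add)
qed

lemma ops_below_d_right: "p below k \<Longrightarrow> p * weyl_d i j below (Suc k)"
  using ops_below_diff[OF ops_below.d[of p k i j] ops_below_Suc[OF ops_below_d_commutator[of p k i
      j]]]
  by simp

text \<open>Each commutator with a function removes one derivative, which is what drives the
  induction on the order. At \<open>k = 0\<close> the truncated \<open>k - 1\<close> is right
  because \<open>p = 0\<close>.\<close>

lemma ops_below_mulop_commutator:
  assumes "p below k" "f \<in> polyfun"
  shows "mulop f * p - p * mulop f below (k - 1)"
  using assms(1)
proof (induction rule: ops_below.induct)
  case (zero k)
  then show ?case by (simp add: ops_below.zero)
next
  case (mulop g k)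
  then show ?case using assms(2) by (simp add: mulop_commute ops_below.zero)
next
  case (d p k i j)
  have "mulop f * (weyl_d i j * p) - weyl_d i j * p * mulop f =
    weyl_d i j * (mulop f * p - p * mulop f) - mulop (pd i j f) * p"
    using weyl_d_mulop[OF assms(2), of i j] by (simp add: algebra_simps flip: mult.assoc)
  moreover have "weyl_d i j * (mulop f * p - p * mulop f) below k"
  proof (cases k)
    case 0
    then show ?thesis using ops_below_0[of p] d.hyps by (simp add: ops_below.zero)
  next
    case (Suc m)
    then show ?thesis using d.IH by (auto intro: ops_below.d)
  qed
  ultimately show ?case
    using d.hyps assms(2) by (simp add: ops_below_diff ops_below_mulop_left polyfun_pd)
next
  case (add p k q)
  have "mulop f * (p + q) - (p + q) * mulop f =
    (mulop f * p - p * mulop f) + (mulop f * q - q * mulop f)"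
    by (simp add: algebra_simps)
  then show ?case using add by (simp add: ops_below.add)
qed

text \<open>Orders add; as the indices are strict bounds, their sum is to be lowered by one.\<close>

lemma ops_below_mult: "p below j \<Longrightarrow> q below k \<Longrightarrow> p * q below (j + k - 1)"
proof (induction rule: ops_below.induct)
  case (d p j a b)
  show ?case
  proof (cases j)
    case 0
    then show ?thesis using d.hyps ops_below_0[of p] by (simp add: ops_below.zero)
  next
    case (Suc m)
    then show ?thesis using d ops_below.d[of "p * q" "m + k" a b] by (simp add: mult.assoc)
  qed
qed (auto simp: distrib_right intro: ops_below.intros ops_below_mono[OF ops_below_mulop_left])

lemma weyl_in_ops_below: "\<exists>k. p below k"
proof (induction p)
  case (Abs_weyl P)
  then show ?case
  proof (induction P rule: diff_ops.induct)
    case (scale c)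
    show ?case
      using ops_below.mulop[OF polyfun.const, of c 0] by (auto simp: weyl_scalar_def simp flip:
          weyl_scalar_mulop)
  next
    case (coord i j)
    show ?case
      using ops_below.mulop[OF polyfun.coord, of i j 0] by (auto simp: weyl_y_def simp flip:
          weyl_y_mulop)
  next
    case (pd i j)
    show ?case
      using ops_below.d[OF ops_below.mulop[OF polyfun.const[of 1]], of i j 0]
      by (auto simp: weyl_d_def simp flip: weyl_one_mulop)
  next
    case (add P Q)
    then obtain j k where "Abs_weyl P below j" "Abs_weyl Q below k" by blast
    then have "Abs_weyl P + Abs_weyl Q below (max j k)"
      by (intro ops_below.add) (auto elim: ops_below_mono)
    then show ?case using add.hyps by (auto simp: plus_weyl_def Abs_weyl_inverse)
  next
    case (comp P Q)
    then obtain j k where "Abs_weyl P below j" "Abs_weyl Q below k" by blast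
    then have "Abs_weyl P * Abs_weyl Q below (j + k - 1)" by (rule ops_below_mult)
    then show ?case using comp.hyps by (auto simp: times_weyl_def Abs_weyl_inverse)
  qed
qed

section \<open>Reduction to multiplication operators\<close>

lemma weyl_scalar_add: "weyl_scalar a + weyl_scalar b = weyl_scalar (a + b)"
  by (rule weyl_eqI) (simp add: distrib_right)

lemma weyl_scalar_mult: "weyl_scalar a * weyl_scalar b = weyl_scalar (a * b)"
  by (rule weyl_eqI) (simp add: mult.assoc)

lemma weyl_scalar_1: "weyl_scalar 1 = 1"
  by (rule weyl_eqI) simp

lemma weyl_d_scalar: "weyl_d i j * weyl_scalar c = weyl_scalar c * weyl_d i j"
  by (rule weyl_eqI) (simp add: test_pd_scale)

lemma weyl_d_y:
  "weyl_d k l * weyl_y i j = weyl_y i j * weyl_d k l + (if k = i \<and> l = j then 1 else 0)"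
  unfolding weyl_y_mulop by (simp add: weyl_d_mulop polyfun.coord pd_coord weyl_one_mulop
      mulop_zero)

section \<open>The generators and the vector fields behind them\<close>

definition rot_field :: "'n::finite \<Rightarrow> 'n \<Rightarrow> 'n weyl" where
  "rot_field i j = (\<Sum>k\<in>UNIV. weyl_y k i * weyl_d k j - weyl_y k j * weyl_d k i)"

text \<open>The derivative of \<open>y ** (mat 1 + t E)\<close> at \<open>t = 0\<close> for the
  matrix unit \<open>E\<close> at position \<open>(i, j)\<close>, a left invariant field of the
  general linear group. Its antisymmetrization \<open>rot_field\<close> generates right
  rotations.\<close>

definition col_field :: "'n::finite \<Rightarrow> 'n \<Rightarrow> 'n weyl" where
  "col_field i j = (\<Sum>k\<in>UNIV. weyl_y k i * weyl_d k j)"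

definition col_prod :: "'n::finite \<Rightarrow> 'n \<Rightarrow> 'n weyl" where
  "col_prod i j = (\<Sum>k\<in>UNIV. weyl_y k i * weyl_y k j)"

definition row_prod :: "'n::finite \<Rightarrow> 'n \<Rightarrow> 'n weyl" where
  "row_prod i j = (\<Sum>k\<in>UNIV. weyl_y i k * weyl_y j k)"

lemma rot_field_eq: "rot_field i j = col_field i j - col_field j i"
  by (simp add: rot_field_def col_field_def sum_subtractf)

lemma polyfun_sum_coord:
  "(\<lambda>y. \<Sum>k\<in>UNIV. complex_of_real (y $ a k $ b k) * complex_of_real (y $ c k $ d k)) \<in> polyfun"
  by (intro polyfun_intros)

lemma col_prod_mulop:
  "col_prod i j = mulop (\<lambda>y. \<Sum>k\<in>UNIV. complex_of_real (y $ k $ i) * complex_of_real (y $ k $ j))"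
  by (simp add: col_prod_def weyl_y_mulop mulop_mult mulop_sum polyfun_intros)

lemma row_prod_mulop:
  "row_prod i j = mulop (\<lambda>y. \<Sum>k\<in>UNIV. complex_of_real (y $ i $ k) * complex_of_real (y $ j $ k))"
  by (simp add: row_prod_def weyl_y_mulop mulop_mult mulop_sum polyfun_intros)

lemma weyl_d_col_prod:
  "weyl_d k q * col_prod m l - col_prod m l * weyl_d k q =
    (if q = m then weyl_y k l else 0) + (if q = l then weyl_y k m else 0)"
proof -
  have "weyl_d k q * (weyl_y b m * weyl_y b l) = weyl_y b m * weyl_y b l * weyl_d k q +
    ((if b = k then if q = m then weyl_y b l else 0 else 0) +
      (if b = k then if q = l then weyl_y b m else 0 else 0))" for b
    unfolding mult.assoc[symmetric] weyl_d_y
    by (auto simp: distrib_right distrib_left mult.assoc weyl_d_y)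
  then show ?thesis
    by (simp add: col_prod_def sum_distrib_left sum_distrib_right sum.distrib)
qed

lemma weyl_y_d_below: "weyl_y a b * weyl_d c d below 2"
  using ops_below_mulop_left[OF ops_below.d[OF ops_below.mulop[OF polyfun.const[of 1], of 0]],
      OF polyfun.coord, of a b c d]
  by (simp add: weyl_y_mulop numeral_2_eq_2 flip: weyl_one_mulop)

lemma col_field_below: "col_field i j below 2"
  unfolding col_field_def by (intro ops_below_sum weyl_y_d_below)

lemma rot_field_below: "rot_field i j below 2"
  unfolding rot_field_eq by (intro ops_below_diff col_field_below)

lemma weyl_y_commutator_mulop:
  assumes "p below 2"
  shows "\<exists>f\<in>polyfun. p * weyl_y i j = weyl_y i j * p + mulop f"
proof -
  have "weyl_y i j * p - p * weyl_y i j below 1"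
    using ops_below_mulop_commutator[OF assms polyfun.coord[of i j]] by (simp add: weyl_y_mulop)
  from ops_below_1[OF ops_below_uminus[OF this]] obtain f
    where "f \<in> polyfun" "- (weyl_y i j * p - p * weyl_y i j) = mulop f" by blast
  then show ?thesis by (intro bexI[of _ f]) (auto simp: algebra_simps)
qed

text \<open>
  On symbols, the commutators with the entries of \<open>y\<^sup>T y\<close> are the derivatives along the conormal
  directions of the group, and modulo the rotation fields \<^const>\<open>col_field\<close> is symmetric. Hence this is
  twice the Euler operator of the symbol.
\<close>

definition symbol_euler :: "'n::finite weyl \<Rightarrow> 'n weyl" where
  "symbol_euler p = (\<Sum>m\<in>UNIV. \<Sum>l\<in>UNIV. col_field m l * (p * col_prod m l - col_prod m l * p))"

lemma symbol_euler_add: "symbol_euler (p + q) = symbol_euler p + symbol_euler q"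
  by (simp add: symbol_euler_def algebra_simps sum.distrib sum_subtractf)

lemma symbol_euler_mulop: "f \<in> polyfun \<Longrightarrow> symbol_euler (mulop f) = 0"
  by (simp add: symbol_euler_def col_prod_mulop mulop_commute polyfun_intros)

text \<open>Commutation with \<open>col_prod m l\<close> is a derivation. The last sum arises from
  moving \<open>d\<close> to the left of \<open>col_field m l\<close>; it contains two commutators
  and is of smaller order when \<open>d\<close> is a derivative.\<close>

lemma symbol_euler_mult:
  "symbol_euler (d * p) = symbol_euler d * p + d * symbol_euler p +
    (\<Sum>m\<in>UNIV. \<Sum>l\<in>UNIV. (col_field m l * d - d * col_field m l) * (p * col_prod m l - col_prod m l
        * p))"
  by (simp add: symbol_euler_def sum_distrib_left sum_distrib_right algebra_simps flip: sum.distrib)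

lemma symbol_euler_d:
  "symbol_euler (weyl_d k q) = (\<Sum>m\<in>UNIV. (col_field q m + col_field m q) * weyl_y k m)"
proof -
  have "symbol_euler (weyl_d k q) = (\<Sum>m\<in>UNIV. if q =
      m then \<Sum>l\<in>UNIV. col_field m l * weyl_y k l else 0) +
    (\<Sum>m\<in>UNIV. col_field m q * weyl_y k m)"
    unfolding symbol_euler_def weyl_d_col_prod sum.distrib[symmetric]
    by (intro sum.cong refl)
      (auto simp: distrib_left sum.distrib if_distrib[of "\<lambda>x. _ * x"] cong: if_cong)
  then show ?thesis by (simp add: distrib_right sum.distrib)
qed

section \<open>Lowering the order modulo the ideal\<close>

locale orthogonal_ideal =
  fixes I :: "'n::finite weyl set"
  assumes left_ideal: "left_ideal I"
    and rot: "rot_field i j \<in> I"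
    and row: "(if i = j then 1 else 0) - row_prod i j \<in> I"
    and col: "(if i = j then 1 else 0) - col_prod i j \<in> I"
begin

lemma I_zero: "0 \<in> I" and I_add: "x \<in> I \<Longrightarrow> y \<in> I \<Longrightarrow> x + y \<in> I" and I_mult: "x \<in> I \<Longrightarrow> r * x \<in> I"
  using left_ideal unfolding left_ideal_def by blast+

lemma I_uminus: "x \<in> I \<Longrightarrow> - x \<in> I"
  using I_mult[of x "- 1"] by simp

lemma I_diff: "x \<in> I \<Longrightarrow> y \<in> I \<Longrightarrow> x - y \<in> I"
  using I_add[OF _ I_uminus, of x y] by simp

lemma I_sum: "(\<And>a. a \<in> A \<Longrightarrow> f a \<in> I) \<Longrightarrow> sum f A \<in> I"
  by (induction A rule: infinite_finite_induct) (auto intro: I_zero I_add)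

definition near :: "nat \<Rightarrow> 'n weyl set" where
  "near k = {x. \<exists>i\<in>I. x - i below k}"

lemma nearI: "i \<in> I \<Longrightarrow> x below k \<Longrightarrow> i + x \<in> near k"
  unfolding near_def by (auto intro!: bexI[of _ i])

lemma nearE:
  assumes "x \<in> near k"
  obtains i r where "i \<in> I" "r below k" "x = i + r"
proof -
  from assms obtain i where "i \<in> I" "x - i below k" unfolding near_def by blast
  then show ?thesis using that[of i "x - i"] by simp
qed

lemma near_below: "x below k \<Longrightarrow> x \<in> near k"
  using nearI[OF I_zero] by simp

lemma near_add: "x \<in> near k \<Longrightarrow> y \<in> near k \<Longrightarrow> x + y \<in> near k"
proof (elim nearE)
  fix i r j s assume "i \<in> I" "r below k" "x = i + r" "j \<in> I" "s below k" "y = j + s"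
  then show "x + y \<in> near k"
    using nearI[of "i + j" "r + s" k] by (simp add: I_add ops_below.add algebra_simps)
qed

lemma near_mulop_left: "x \<in> near k \<Longrightarrow> f \<in> polyfun \<Longrightarrow> mulop f * x \<in> near k"
  by (elim nearE) (simp add: distrib_left nearI I_mult ops_below_mulop_left)

lemma near_d: "x \<in> near k \<Longrightarrow> weyl_d i j * x \<in> near (Suc k)"
  by (elim nearE) (simp add: distrib_left nearI I_mult ops_below.d)

text \<open>Operators that behave like functions: modulo \<open>I\<close>, multiplying by them on
  the left does not raise the order. As \<open>I\<close> is only a left ideal, membership of
  \<open>x\<close> in \<open>I\<close> by itself says nothing about \<open>x * p\<close>.\<close>

definition lowering :: "'n weyl set" where
  "lowering = {x. \<forall>k p. p below k \<longrightarrow> x * p \<in> near k}"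

lemma lowering_add: "x \<in> lowering \<Longrightarrow> y \<in> lowering \<Longrightarrow> x + y \<in> lowering"
  unfolding lowering_def by (simp add: distrib_right near_add)

lemma lowering_mulop: "f \<in> polyfun \<Longrightarrow> mulop f \<in> lowering"
  unfolding lowering_def by (simp add: near_below ops_below_mulop_left)

lemma lowering_mulop_left: "f \<in> polyfun \<Longrightarrow> x \<in> lowering \<Longrightarrow> mulop f * x \<in> lowering"
  unfolding lowering_def by (simp add: mult.assoc near_mulop_left)

lemma lowering_uminus: "x \<in> lowering \<Longrightarrow> - x \<in> lowering"
proof -
  have "mulop (\<lambda>_. - 1) * x = - x" by (rule weyl_eqI) (simp add: polyfun.const)
  then show "x \<in> lowering \<Longrightarrow> - x \<in> lowering"
    using lowering_mulop_left[OF polyfun.const[of "-1"], of x] by simp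
qed

lemma lowering_diff: "x \<in> lowering \<Longrightarrow> y \<in> lowering \<Longrightarrow> x - y \<in> lowering"
  using lowering_add[OF _ lowering_uminus, of x y] by simp

lemma lowering_sum: "(\<And>a. a \<in> A \<Longrightarrow> f a \<in> lowering) \<Longrightarrow> sum f A \<in> lowering"
  using lowering_mulop[OF polyfun.const[of 0]]
  by (induction A rule: infinite_finite_induct) (auto intro: lowering_add simp: mulop_zero)

text \<open>Write \<open>x * p = p * x + (x * p - p * x)\<close>; the first summand is in the left
  ideal \<open>I\<close>.\<close>

lemma lowering_commutator:
  assumes "x \<in> I" "\<And>k p. p below k \<Longrightarrow> x * p - p * x below k"
  shows "x \<in> lowering"
  unfolding lowering_def
proof (intro CollectI allI impI)
  fix k and p :: "'n weyl" assume "p below k"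
  then show "x * p \<in> near k"
    using nearI[OF I_mult[OF assms(1)] assms(2), of p k p] by simp
qed

lemma lowering_rot: "rot_field i j \<in> lowering"
proof (rule lowering_commutator[OF rot])
  fix k and p :: "'n weyl" assume p: "p below k"
  have "weyl_y a b * weyl_d c d * p - p * (weyl_y a b * weyl_d c d) below k" for a b c d
  proof -
    have 1: "weyl_y a b * (weyl_d c d * p - p * weyl_d c d) below k"
      using p by (simp add: weyl_y_mulop polyfun.coord ops_below_mulop_left ops_below_d_commutator)
    have "weyl_y a b * p - p * weyl_y a b below (k - 1)"
      using ops_below_mulop_commutator[OF p polyfun.coord] by (simp add: weyl_y_mulop)
    \<comment> \<open>\<open>Suc (k - 1)\<close> is \<open>k\<close> except for
      \<open>k = 0\<close>, where \<open>p = 0\<close>.\<close>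
    from ops_below_d_right[OF this, of c d] have 2: "(weyl_y a b * p - p * weyl_y a b) * weyl_d c
        d below k"
      using p ops_below_0[of p] by (cases k) (auto intro: ops_below.zero)
    have "weyl_y a b * weyl_d c d * p - p * (weyl_y a b * weyl_d c d) =
      weyl_y a b * (weyl_d c d * p - p * weyl_d c d) +
          (weyl_y a b * p - p * weyl_y a b) * weyl_d c d"
      by (simp add: algebra_simps)
    then show ?thesis using ops_below.add[OF 1 2] by simp
  qed
  then have "(\<Sum>c\<in>UNIV. (weyl_y c i * weyl_d c j * p - p * (weyl_y c i * weyl_d c j)) -
      (weyl_y c j * weyl_d c i * p - p * (weyl_y c j * weyl_d c i))) below k"
    by - (rule ops_below_sum, rule ops_below_diff)
  then show "rot_field i j * p - p * rot_field i j below k"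
    by (simp add: rot_field_def sum_distrib_left sum_distrib_right sum_subtractf sum.distrib
        algebra_simps)
qed

text \<open>The function is moved to the right of \<open>weyl_d i j * p\<close>, where the left
  ideal absorbs it; the commutator loses the order that the derivative has added.\<close>

lemma lowering_mulop_d:
  assumes "f \<in> polyfun" "mulop f \<in> I"
  shows "mulop f * weyl_d i j \<in> lowering"
  unfolding lowering_def
proof (intro CollectI allI impI)
  fix k and p :: "'n weyl" assume "p below k"
  then have "mulop f * (weyl_d i j * p) - weyl_d i j * p * mulop f below k"
    using ops_below_mulop_commutator[OF ops_below.d assms(1)] by fastforce
  from nearI[OF I_mult[OF assms(2), of "weyl_d i j * p"] this]
  show "mulop f * weyl_d i j * p \<in> near k" by (simp add: mult.assoc)
qed

text \<open>Each of the two sums in \<open>symbol_euler_d\<close> is congruent to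
  \<open>weyl_d k q\<close>: the relation \<open>y y^T = 1\<close> contracts the coordinate with the
  coefficient of \<open>col_field\<close>, and swapping the indices of \<open>col_field\<close>
  costs a rotation field. Reordering a coordinate and a field costs only a function.\<close>

lemma symbol_euler_d_near: "symbol_euler (weyl_d k q) - (weyl_d k q + weyl_d k q) \<in> lowering"
proof -
  define V where "V a = (if k = a then 1 else 0) - row_prod k a" for a
  have V: "V a * weyl_d i j \<in> lowering" for a i j
  proof -
    have "V a = mulop (\<lambda>y. (if k = a then 1 else 0) - (\<Sum>m\<in>UNIV. complex_of_real (y $ k $ m) *
        complex_of_real (y $ a $ m)))"
      unfolding V_def row_prod_mulop
      by (simp add: weyl_one_mulop mulop_diff mulop_uminus polyfun_intros)
    moreover have "V a \<in> I" unfolding V_def by (rule row)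
    ultimately show ?thesis by (auto intro!: lowering_mulop_d polyfun_intros)
  qed
  have d: "(\<Sum>m\<in>UNIV. weyl_y k m * col_field m q) = weyl_d k q - (\<Sum>a\<in>UNIV. V a * weyl_d a q)"
  proof -
    have "(\<Sum>m\<in>UNIV. weyl_y k m * col_field m q) = (\<Sum>a\<in>UNIV. row_prod k a * weyl_d a q)"
      unfolding col_field_def row_prod_def sum_distrib_left sum_distrib_right mult.assoc
      by (rule sum.swap)
    also have "\<dots> = (\<Sum>a\<in>UNIV. (if k = a then 1 else 0) * weyl_d a q) - (\<Sum>a\<in>UNIV. V a * weyl_d a q)"
      by (simp add: V_def algebra_simps flip: sum_subtractf)
    also have "(\<Sum>a\<in>UNIV. (if k = a then 1 else 0) * weyl_d a q) = weyl_d k q"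
      by (simp add: if_distrib[of "\<lambda>x. x * _"] cong: if_cong)
    finally show ?thesis .
  qed
  have "col_field m q * weyl_y k m - weyl_y k m * col_field m q \<in> lowering" for m
    using weyl_y_commutator_mulop[OF col_field_below[of m q],
        of k m] by (auto intro: lowering_mulop)
  then have "(\<Sum>m\<in>UNIV. col_field m q * weyl_y k m - weyl_y k m * col_field m q) - (\<Sum>a\<in>UNIV. V a *
      weyl_d a q) \<in> lowering"
    by - (rule lowering_diff[OF lowering_sum lowering_sum[OF V]])
  then have 1: "(\<Sum>m\<in>UNIV. col_field m q * weyl_y k m) - weyl_d k q \<in> lowering"
    by (simp add: sum_subtractf d)
  have "rot_field m q * weyl_y k m \<in> lowering" for m
  proof -
    obtain f where f: "f \<in> polyfun" "rot_field m q * weyl_y k m = weyl_y k m * rot_field m q +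
        mulop f"
      using weyl_y_commutator_mulop[OF rot_field_below] by blast
    show ?thesis
      unfolding f(2) using f(1)
      by (auto simp: weyl_y_mulop intro!: lowering_add lowering_mulop lowering_mulop_left
          lowering_rot polyfun.coord)
  qed
  then have 2: "(\<Sum>m\<in>UNIV. rot_field m q * weyl_y k m) \<in> lowering" by (rule lowering_sum)
  \<comment> \<open>This uses \<open>col_field q m = col_field m q - rot_field m q\<close>.\<close>
  have "symbol_euler (weyl_d k q) - (weyl_d k q + weyl_d k q) =
    ((\<Sum>m\<in>UNIV. col_field m q * weyl_y k m) - weyl_d k q) +
        ((\<Sum>m\<in>UNIV. col_field m q * weyl_y k m) - weyl_d k q)
      - (\<Sum>m\<in>UNIV. rot_field m q * weyl_y k m)"
    by (simp add: symbol_euler_d rot_field_eq algebra_simps sum.distrib sum_subtractf)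
  then show ?thesis using lowering_diff[OF lowering_add[OF 1 1] 2] by (simp only:)
qed

text \<open>Euler's identity: by \<open>symbol_euler_mult\<close> and
  \<open>symbol_euler_d_near\<close>, each of the \<open>k\<close> derivatives in the leading part
  contributes \<open>2 p\<close>, and the other terms have smaller order.\<close>

lemma symbol_euler_near:
  "p below m \<Longrightarrow> m = Suc k \<Longrightarrow> symbol_euler p - weyl_scalar (of_nat (2 * k)) * p \<in> near k"
proof (induction arbitrary: k rule: ops_below.induct)
  case (zero m)
  then show ?case by (simp add: symbol_euler_def near_below ops_below.zero)
next
  case (mulop f m)
  show ?case
  proof (cases k)
    case 0
    then show ?thesis
      using mulop by (simp add: symbol_euler_mulop near_below weyl_scalar_mulop mulop_zero
          ops_below.zero)
  next
    case (Suc j)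
    \<comment> \<open>For \<open>k > 0\<close> a function is itself below \<open>k\<close>, so the
      term \<open>2 k f\<close> is harmless.\<close>
    then have "mulop f below k" using mulop by (simp add: ops_below.mulop)
    then show ?thesis
      using mulop by (auto simp: symbol_euler_mulop weyl_scalar_mulop
          intro!: near_below ops_below_uminus ops_below_mulop_left polyfun.const)
  qed
next
  case (d p m a b)
  then have m: "m = k" by simp
  show ?case
  proof (cases k)
    case 0
    then have "p = 0" using d.hyps m ops_below_0 by blast
    then show ?thesis by (simp add: symbol_euler_def near_below ops_below.zero)
  next
    case (Suc j)
    let ?D = "weyl_d a b" and ?c = "\<lambda>k. weyl_scalar (of_nat (2 * k)) :: 'n weyl"
    have 1: "(symbol_euler ?D - (?D + ?D)) * p \<in> near k"
      using symbol_euler_d_near[of a b] d.hyps m by (simp add: lowering_def)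
    have 2: "?D * (symbol_euler p - ?c j * p) \<in> near k"
      using near_d[OF d.IH[of j]] Suc m by simp
    have "(col_field s t * ?D - ?D * col_field s t) * (p * col_prod s t - col_prod s t * p) below
        k" for s t
    proof -
      have "?D * col_field s t - col_field s t * ?D below 2"
        by (rule ops_below_d_commutator[OF col_field_below])
      moreover have "col_prod s t * p - p * col_prod s t below j"
        using ops_below_mulop_commutator[OF d.hyps, of "\<lambda>y. \<Sum>k\<in>UNIV. complex_of_real (y $ k $ s) *
            complex_of_real (y $ k $ t)"]
        by (simp add: col_prod_mulop polyfun_sum_coord m Suc)
      ultimately have "- (?D * col_field s t - col_field s t * ?D) * - (col_prod s t * p - p *
          col_prod s t) below (2 + j - 1)"
        by (intro ops_below_mult ops_below_uminus)
      then show ?thesis using Suc by simp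
    qed
    then have 3: "(\<Sum>s\<in>UNIV. \<Sum>t\<in>UNIV. (col_field s t * ?D - ?D * col_field s t) * (p * col_prod s t
        - col_prod s t * p)) \<in> near k"
      by (intro near_below ops_below_sum)
    have "?c k = weyl_scalar 1 + weyl_scalar 1 + ?c j"
      unfolding weyl_scalar_add by (simp add: Suc)
    then have c: "?c k * (?D * p) = ?D * p + ?D * p + ?D * (?c j * p)"
      using weyl_d_scalar[of a b "of_nat (2 * j)"]
      by (simp add: weyl_scalar_1 distrib_right flip: mult.assoc)
    have "symbol_euler (?D * p) - ?c k * (?D * p) = (symbol_euler ?D - (?D + ?D)) * p +
      ?D * (symbol_euler p - ?c j * p) +
      (\<Sum>s\<in>UNIV. \<Sum>t\<in>UNIV. (col_field s t * ?D - ?D * col_field s t) * (p * col_prod s t - col_prod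
          s t * p))"
      unfolding symbol_euler_mult c by (simp add: left_diff_distrib right_diff_distrib
          distrib_right mult.assoc)
    then show ?thesis using near_add[OF near_add[OF 1 2] 3] by simp
  qed
next
  case (add p m q)
  have "symbol_euler (p + q) - weyl_scalar (of_nat (2 * k)) * (p + q) =
    (symbol_euler p - weyl_scalar (of_nat (2 * k)) * p) +
        (symbol_euler q - weyl_scalar (of_nat (2 * k)) * q)"
    by (simp add: symbol_euler_add algebra_simps)
  then show ?case using near_add[OF add.IH(1)[OF add.prems] add.IH(2)[OF add.prems]] by simp
qed

theorem ideal_eqI:
  assumes A: "left_ideal A" "I \<subseteq> A" and base: "\<And>f. f \<in> polyfun \<Longrightarrow> mulop f \<in> A \<Longrightarrow> mulop f \<in> I"
  shows "A = I"
proof -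
  have A_add: "x + y \<in> A" if "x \<in> A" "y \<in> A" for x y
    using A(1) that unfolding left_ideal_def by blast
  have A_mult: "r * x \<in> A" if "x \<in> A" for r x
    using A(1) that unfolding left_ideal_def by blast
  have A_diff: "x - y \<in> A" if "x \<in> A" "y \<in> A" for x y
    using A_add[OF that(1) A_mult[OF that(2), of "- 1"]] by simp
  have "p below k \<Longrightarrow> p \<in> A \<Longrightarrow> p \<in> I" for p k
  proof (induction k arbitrary: p)
    case 0
    then show ?case using ops_below_0[of p] I_zero by blast
  next
    case (Suc k)
    show ?case
    proof (cases "k = 0")
      case True
      then show ?thesis using Suc.prems base ops_below_1[of p] by auto
    next
      case False
      have "p * col_prod m l - col_prod m l * p \<in> I" for m l
      proof (rule Suc.IH)
        have "col_prod m l * p - p * col_prod m l below k"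
          using ops_below_mulop_commutator[OF Suc.prems(1),
              of "\<lambda>y. \<Sum>k\<in>UNIV. complex_of_real (y $ k $ m) * complex_of_real (y $ k $ l)"]
          by (simp add: col_prod_mulop polyfun_sum_coord)
        from ops_below_uminus[OF this] show "p * col_prod m l - col_prod m l * p below k" by simp
        \<comment> \<open>Up to sign \<open>w\<close> has the same commutators as
          \<open>col_prod m l\<close>, but it lies in \<open>A\<close>; hence \<open>w * p\<close>
          and \<open>p * w\<close> both belong to the left ideal \<open>A\<close>.\<close>
        define w :: "'n weyl" where "w = (if m = l then 1 else 0) - col_prod m l"
        have "w \<in> A" using A(2) col unfolding w_def by blast
        moreover have "p * col_prod m l - col_prod m l * p = w * p - p * w"
          by (simp add: w_def algebra_simps)
        ultimately show "p * col_prod m l - col_prod m l * p \<in> A"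
          using Suc.prems(2) by (simp add: A_diff A_mult)
      qed
      then have T: "symbol_euler p \<in> I"
        unfolding symbol_euler_def by (intro I_sum I_mult)
      obtain i r where ir: "i \<in> I" "r below k" "symbol_euler p - weyl_scalar (of_nat (2 * k)) * p
          = i + r"
        using symbol_euler_near[OF Suc.prems(1) refl] by (rule nearE)
      let ?c = "weyl_scalar (1 / of_nat (2 * k)) :: 'n weyl"
      have "p = ?c * (weyl_scalar (of_nat (2 * k)) * p)"
        using False by (simp add: weyl_scalar_mult weyl_scalar_1 flip: mult.assoc)
      also have "weyl_scalar (of_nat (2 * k)) * p = symbol_euler p - i - r"
        using ir(3) by (simp add: algebra_simps)
      finally have p: "p = ?c * (symbol_euler p - i) - ?c * r"
        by (simp add: right_diff_distrib)
      have 1: "?c * (symbol_euler p - i) \<in> I" by (intro I_mult I_diff T ir(1))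
      \<comment> \<open>The remainder is a difference of elements of \<open>A\<close> and has
        smaller order, so the induction hypothesis applies a second time.\<close>
      have "?c * r = ?c * (symbol_euler p - i) - p" using p by (simp add: algebra_simps)
      then have "?c * r \<in> A" using 1 A(2) Suc.prems(2) A_diff by auto
      moreover have "?c * r below k"
        using ir(2) by (simp add: weyl_scalar_mulop ops_below_mulop_left polyfun.const)
      ultimately have "?c * r \<in> I" by (intro Suc.IH)
      from I_diff[OF 1 this] show ?thesis using p by simp
    qed
  qed
  then show ?thesis using A(2) weyl_in_ops_below by blast
qed

end

section \<open>Polynomials vanishing on the special orthogonal group\<close>

lemma matrix_ring_simps:
  fixes A B :: "real^'n^'m" and C D :: "real^'p^'n"
  shows "(A + B) ** C = A ** C + B ** C" "A ** (C + D) = A ** C + A ** D"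
    "(A - B) ** C = A ** C - B ** C" "A ** (C - D) = A ** C - A ** D"
    "(r *\<^sub>R A) ** C = r *\<^sub>R (A ** C)" "A ** (r *\<^sub>R C) = r *\<^sub>R (A ** C)"
    "(- A) ** C = - (A ** C)" "A ** (- C) = - (A ** C)"
  by (simp_all add: matrix_matrix_mult_def vec_eq_iff sum.distrib sum_subtractf sum_negf
      sum_distrib_left
      distrib_left distrib_right left_diff_distrib right_diff_distrib mult_ac)

lemma transpose_ring_simps:
  fixes A B :: "real^'n^'m"
  shows "transpose (A + B) = transpose A + transpose B" "transpose (A - B) =
      transpose A - transpose B"
    "transpose (r *\<^sub>R A) = r *\<^sub>R transpose A"
  by (simp_all add: transpose_def vec_eq_iff)

lemma det_scaleR_mat_1: "det (c *\<^sub>R mat 1 :: real^'n::finite^'n) = c ^ CARD('n)"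
  by (subst det_diagonal) (auto simp: mat_def)

text \<open>Cramer's rule without the division: the entries are determinants and so stay polynomial
  in the entries of \<open>A\<close>.\<close>

definition adjugate :: "real^'n::finite^'n \<Rightarrow> real^'n^'n" where
  "adjugate A = (\<chi> i j. det (\<chi> k l. if l = i then axis j 1 $ k else A $ k $ l))"

text \<open>Obtained from Cramer's rule, hence for nonzero determinant. This suffices below, where
  the points with a vanishing determinant are absorbed by \<open>localized_eqI\<close>.\<close>

lemma adjugate_mult:
  fixes A :: "real^'n::finite^'n"
  assumes "det A \<noteq> 0"
  shows "A ** adjugate A = det A *\<^sub>R mat 1" "adjugate A ** A = det A *\<^sub>R mat 1"
proof -
  define B where "B = inverse (det A) *\<^sub>R adjugate A"
  have "(A ** B) $ k $ j = mat 1 $ k $ j" for k j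
  proof -
    have "A *v (\<chi> i. B $ i $ j) = axis j 1"
      unfolding cramer[OF assms] by (simp add: B_def adjugate_def vec_eq_iff divide_inverse_commute)
    then have "(A *v (\<chi> i. B $ i $ j)) $ k = axis j 1 $ k" by simp
    then show ?thesis
      by (simp add: matrix_matrix_mult_def matrix_vector_mult_def mat_def axis_def)
  qed
  then have 1: "A ** B = mat 1" by (simp add: vec_eq_iff)
  moreover from this have 2: "B ** A = mat 1" by (rule matrix_left_right_inverse[THEN iffD1])
  have 3: "adjugate A = det A *\<^sub>R B" using assms by (simp add: B_def)
  show "A ** adjugate A = det A *\<^sub>R mat 1" "adjugate A ** A = det A *\<^sub>R mat 1"
    unfolding 3 matrix_ring_simps 1 2 by simp_all
qed

abbreviation rpoly :: "(real^'n::finite^'n \<Rightarrow> real) \<Rightarrow> bool" where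
  "rpoly h \<equiv> (\<lambda>y. complex_of_real (h y)) \<in> polyfun"

definition mpoly :: "(real^'n::finite^'n \<Rightarrow> real^'m::finite^'m) \<Rightarrow> bool" where
  "mpoly A \<longleftrightarrow> (\<forall>i j. rpoly (\<lambda>y. A y $ i $ j))"

lemma mpoly_const: "mpoly (\<lambda>_. A)"
  by (simp add: mpoly_def polyfun.const)

lemma mpoly_id: "mpoly (\<lambda>y. y)"
  by (simp add: mpoly_def polyfun.coord)

lemma mpoly_add: "mpoly A \<Longrightarrow> mpoly B \<Longrightarrow> mpoly (\<lambda>y. A y + B y)"
  by (simp add: mpoly_def polyfun_intros)

lemma mpoly_diff: "mpoly A \<Longrightarrow> mpoly B \<Longrightarrow> mpoly (\<lambda>y. A y - B y)"
  by (simp add: mpoly_def polyfun_intros)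

lemma mpoly_scaleR: "rpoly r \<Longrightarrow> mpoly B \<Longrightarrow> mpoly (\<lambda>y. r y *\<^sub>R B y)"
  by (simp add: mpoly_def polyfun_intros)

lemma mpoly_mult: "mpoly A \<Longrightarrow> mpoly B \<Longrightarrow> mpoly (\<lambda>y. A y ** B y)"
  by (simp add: mpoly_def matrix_matrix_mult_def polyfun_intros)

lemma mpoly_transpose: "mpoly A \<Longrightarrow> mpoly (\<lambda>y. transpose (A y))"
  by (simp add: mpoly_def transpose_def)

lemma rpoly_det: "mpoly A \<Longrightarrow> rpoly (\<lambda>y. det (A y))"
  unfolding mpoly_def by (intro polyfun_det) blast

lemma mpoly_adjugate:
  assumes "mpoly A"
  shows "mpoly (\<lambda>y. adjugate (A y))"
proof -
  have "rpoly (\<lambda>y. det (\<chi> k l. if l = i then axis j 1 $ k else A y $ k $ l))" for i j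
  proof (rule polyfun_det)
    show "rpoly (\<lambda>y. (\<chi> k l. if l = i then axis j 1 $ k else A y $ k $ l) $ k $ l)" for k l
      using assms polyfun.const by (cases "l = i") (auto simp: mpoly_def)
  qed
  then show ?thesis by (simp add: mpoly_def adjugate_def)
qed

lemmas mpoly_intros = mpoly_const mpoly_id mpoly_add mpoly_diff mpoly_scaleR mpoly_mult
  mpoly_transpose mpoly_adjugate

section \<open>Congruences, radicals and localization of polynomial ideals\<close>

locale polyfun_ideal =
  fixes J :: "(real^'n::finite^'n \<Rightarrow> complex) set"
  assumes J_polyfun: "f \<in> J \<Longrightarrow> f \<in> polyfun"
    and J_zero: "(\<lambda>_. 0) \<in> J"
    and J_add: "f \<in> J \<Longrightarrow> g \<in> J \<Longrightarrow> (\<lambda>y. f y + g y) \<in> J"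
    and J_mult: "f \<in> polyfun \<Longrightarrow> g \<in> J \<Longrightarrow> (\<lambda>y. f y * g y) \<in> J"
begin

lemma J_mult_right: "g \<in> J \<Longrightarrow> f \<in> polyfun \<Longrightarrow> (\<lambda>y. g y * f y) \<in> J"
  using J_mult[of f g] by (simp add: mult.commute)

lemma J_diff: "f \<in> J \<Longrightarrow> g \<in> J \<Longrightarrow> (\<lambda>y. f y - g y) \<in> J"
  using J_add[OF _ J_mult[OF polyfun.const[of "-1"]], of f g] by simp

lemma J_sum: "(\<And>a. a \<in> A \<Longrightarrow> f a \<in> J) \<Longrightarrow> (\<lambda>y. \<Sum>a\<in>A. f a y) \<in> J"
  by (induction A rule: infinite_finite_induct) (auto intro: J_zero J_add)

lemma mult_cong:
  assumes "f \<in> polyfun" "g' \<in> polyfun" "(\<lambda>y. f y - f' y) \<in> J" "(\<lambda>y. g y - g' y) \<in> J"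
  shows "(\<lambda>y. f y * g y - f' y * g' y) \<in> J"
  using J_add[OF J_mult[OF assms(1,4)] J_mult_right[OF assms(3,2)]] by (simp add: algebra_simps)

lemma prod_cong:
  assumes "\<And>a. a \<in> A \<Longrightarrow> f a \<in> polyfun" "\<And>a. a \<in> A \<Longrightarrow> g a \<in> polyfun"
    "\<And>a. a \<in> A \<Longrightarrow> (\<lambda>y. f a y - g a y) \<in> J"
  shows "(\<lambda>y. (\<Prod>a\<in>A. f a y) - (\<Prod>a\<in>A. g a y)) \<in> J"
  using assms
proof (induction A rule: infinite_finite_induct)
  case (insert a A)
  then show ?case by (simp add: mult_cong polyfun_prod)
qed (simp_all add: J_zero)

lemma power_cong:
  "f \<in> polyfun \<Longrightarrow> g \<in> polyfun \<Longrightarrow> (\<lambda>y. f y - g y) \<in> J \<Longrightarrow> (\<lambda>y. f y ^ k - g y ^ k) \<in> J"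
  using prod_cong[of "{..<k}" "\<lambda>_. f" "\<lambda>_. g"] by simp

lemma det_cong:
  assumes "mpoly A" "mpoly B" "\<And>i j. (\<lambda>y. complex_of_real (A y $ i $ j - B y $ i $ j)) \<in> J"
  shows "(\<lambda>y. complex_of_real (det (A y) - det (B y))) \<in> J"
proof -
  have "(\<lambda>y. \<Sum>p | p permutes UNIV. of_int (sign p) *
    ((\<Prod>i\<in>UNIV. complex_of_real (A y $ i $ p i)) - (\<Prod>i\<in>UNIV. complex_of_real (B y $ i $ p i)))) \<in> J"
    using assms by (intro J_sum J_mult polyfun.const prod_cong) (auto simp: mpoly_def)
  then show ?thesis by (simp add: det_def right_diff_distrib flip: sum_subtractf)
qed

text \<open>In the binomial term with exponents \<open>i\<close> and \<open>k + l - i\<close>,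
  either \<open>k \<le> i\<close> or \<open>l \<le> k + l - i\<close>.\<close>

lemma radical_add:
  assumes f: "f \<in> polyfun" "(\<lambda>y. f y ^ k) \<in> J" and g: "g \<in> polyfun" "(\<lambda>y. g y ^ l) \<in> J"
  shows "(\<lambda>y. (f y + g y) ^ (k + l)) \<in> J"
proof -
  have "(\<lambda>y. of_nat ((k + l) choose i) * (f y ^ i * g y ^ (k + l - i))) \<in> J" for i
  proof (rule J_mult[OF polyfun.const], cases "i \<ge> k")
    case True
    then have "(\<lambda>y. f y ^ i * g y ^ (k + l - i)) = (\<lambda>y. (f y ^ (i - k) * g y ^ (k +
        l - i)) * f y ^ k)"
      by (auto simp flip: power_add)
    then show "(\<lambda>y. f y ^ i * g y ^ (k + l - i)) \<in> J"
      using f g by (simp only: J_mult polyfun_intros)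
  next
    case False
    then have "k + l - i = (k - i) + l" by simp
    then have "(\<lambda>y. f y ^ i * g y ^ (k + l - i)) = (\<lambda>y. (f y ^ i * g y ^ (k - i)) * g y ^ l)"
      by (simp add: power_add mult.assoc)
    then show "(\<lambda>y. f y ^ i * g y ^ (k + l - i)) \<in> J"
      using f g by (simp only: J_mult polyfun_intros)
  qed
  then have "(\<lambda>y. \<Sum>i\<le>k + l. of_nat ((k + l) choose i) * (f y ^ i * g y ^ (k + l - i))) \<in> J"
    by (rule J_sum)
  then show ?thesis by (simp add: binomial_ring mult.assoc)
qed

lemma radical_sum:
  assumes "\<And>a. a \<in> A \<Longrightarrow> f a \<in> polyfun" "\<And>a. a \<in> A \<Longrightarrow> \<exists>k. (\<lambda>y. f a y ^ k) \<in> J"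
  shows "\<exists>k. (\<lambda>y. (\<Sum>a\<in>A. f a y) ^ k) \<in> J"
  using assms
proof (induction A rule: infinite_finite_induct)
  case (insert a A)
  then obtain k l where "(\<lambda>y. f a y ^ k) \<in> J" "(\<lambda>y. (\<Sum>a\<in>A. f a y) ^ l) \<in> J" by (metis insertCI)
  from radical_add[OF _ this(1) _ this(2)] show ?case
    using insert by (auto simp: polyfun_sum)
qed (auto intro!: exI[of _ 1] simp: J_zero)

text \<open>The saturation of \<open>J\<close> by powers of \<open>d\<close>: the polynomials that
  fall into the extension of \<open>J\<close> once \<open>d\<close> is inverted.\<close>

definition localized :: "(real^'n^'n \<Rightarrow> real) \<Rightarrow> (real^'n^'n \<Rightarrow> complex) set" where
  "localized d = {h \<in> polyfun. \<exists>k. (\<lambda>y. complex_of_real (d y) ^ k * h y) \<in> J}"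

lemma localized_base: "h \<in> J \<Longrightarrow> h \<in> localized d"
  unfolding localized_def using J_polyfun by (auto intro!: exI[of _ 0])

lemma localized_cancel:
  assumes "(\<lambda>y. complex_of_real (d y) ^ k * h y) \<in> localized d" "h \<in> polyfun"
  shows "h \<in> localized d"
proof -
  obtain l where "(\<lambda>y. complex_of_real (d y) ^ l * (complex_of_real (d y) ^ k * h y)) \<in> J"
    using assms(1) unfolding localized_def by blast
  then have "(\<lambda>y. complex_of_real (d y) ^ (l + k) * h y) \<in> J" by (simp add: power_add mult.assoc)
  then show ?thesis using assms(2) unfolding localized_def by blast
qed

text \<open>Functions that agree where \<open>d\<close> does not vanish become equal after multiplication with \<open>d\<close>.\<close>

lemma localized_eqI:
  assumes "h' \<in> localized d" "h \<in> polyfun" "\<And>y. d y \<noteq> 0 \<Longrightarrow> h y = h' y"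
    and d: "rpoly d"
  shows "h \<in> localized d"
proof -
  obtain k where "(\<lambda>y. complex_of_real (d y) ^ k * h' y) \<in> J"
    using assms(1) unfolding localized_def by blast
  from J_mult[OF d this] have "(\<lambda>y. complex_of_real (d y) ^ Suc k * h' y) \<in> J"
      by (simp add: mult.assoc)
  moreover have "(\<lambda>y. complex_of_real (d y) ^ Suc k * h' y) =
      (\<lambda>y. complex_of_real (d y) ^ Suc k * h y)"
  proof
    show "complex_of_real (d y) ^ Suc k * h' y = complex_of_real (d y) ^ Suc k * h y" for y
      using assms(3)[of y] by (cases "d y = 0") auto
  qed
  ultimately have "(\<lambda>y. complex_of_real (d y) ^ Suc k * h y) \<in> J" by simp
  then show ?thesis using assms(2) unfolding localized_def by blast
qed

lemma localized_ideal:
  assumes d: "rpoly d"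
  shows "polyfun_ideal (localized d)"
proof
  fix f g assume f: "f \<in> localized d" and g: "g \<in> localized d"
  then obtain k l where k: "(\<lambda>y. complex_of_real (d y) ^ k * f y) \<in> J"
    and l: "(\<lambda>y. complex_of_real (d y) ^ l * g y) \<in> J" unfolding localized_def by blast
  have "(\<lambda>y. complex_of_real (d y) ^ (k + l) * (f y + g y)) \<in> J"
    using J_add[OF J_mult[OF polyfun_power[OF d, of l] k] J_mult[OF polyfun_power[OF d, of k] l]]
    by (simp add: algebra_simps power_add)
  then show "(\<lambda>y. f y + g y) \<in> localized d"
    using f g unfolding localized_def by (auto intro: polyfun_intros)
next
  fix f g :: "real^'n^'n \<Rightarrow> complex" assume f: "f \<in> polyfun" and g: "g \<in> localized d"
  then obtain k where k: "(\<lambda>y. complex_of_real (d y) ^ k * g y) \<in> J"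
      unfolding localized_def by blast
  have "(\<lambda>y. complex_of_real (d y) ^ k * (f y * g y)) \<in> J"
    using J_mult[OF f k] by (simp add: mult.left_commute)
  then show "(\<lambda>y. f y * g y) \<in> localized d"
    using f g unfolding localized_def by (auto intro: polyfun_intros)
qed (auto simp: localized_def polyfun.const J_zero)

end

section \<open>The Cayley transform\<close>

lemma SO_transpose: "g \<in> SO \<Longrightarrow> transpose g \<in> SO"
  by (simp add: SO_def matrix_left_right_inverse)

lemma SO_mult:
  assumes "U \<in> SO" "V \<in> SO"
  shows "U ** V \<in> SO"
proof -
  have "transpose (U ** V) ** (U ** V) = transpose V ** (transpose U ** U) ** V"
    by (simp add: matrix_transpose_mul matrix_mul_assoc)
  then show ?thesis using assms by (simp add: SO_def det_mul)
qed

text \<open>For skew \<open>s\<close> the form \<open>v \<bullet> (s *v v)\<close> vanishes, so a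
  kernel vector \<open>v\<close> satisfies \<open>d * (v \<bullet> v) = 0\<close>.\<close>

lemma skew_det_nonzero:
  fixes s :: "real^'n::finite^'n"
  assumes "transpose s = - s" "d \<noteq> 0"
  shows "det (d *\<^sub>R mat 1 + s) \<noteq> 0"
proof -
  have "v = 0" if "(d *\<^sub>R mat 1 + s) *v v = 0" for v
  proof -
    have "v \<bullet> (s *v v) = (transpose s *v v) \<bullet> v"
      by (simp only: dot_lmul_matrix transpose_matrix_vector)
    also have "\<dots> = - (v \<bullet> (s *v v))"
      unfolding assms(1) using matrix_vector_mult_diff_rdistrib[of 0 s v] by (simp add:
          inner_commute)
    finally have "v \<bullet> (s *v v) = 0" by simp
    moreover have "v \<bullet> ((d *\<^sub>R mat 1 + s) *v v) = d * (v \<bullet> v) + v \<bullet> (s *v v)"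
      by (simp add: matrix_vector_mult_add_rdistrib inner_add_right flip:
          scaleR_matrix_vector_assoc)
    ultimately show ?thesis using that assms(2) by simp
  qed
  then have "\<exists>B. B ** (d *\<^sub>R mat 1 + s) = mat 1"
    unfolding matrix_left_invertible_ker by blast
  then have "invertible (d *\<^sub>R mat 1 + s)" unfolding invertible_left_inverse .
  then show ?thesis by (simp add: invertible_det_nz)
qed

text \<open>This is \<open>(d - s) (d + s)^(-1)\<close>. The matrices \<open>d - s\<close> and
  \<open>d + s\<close> commute and are transposes of each other, so the quotient is orthogonal of
  determinant 1.\<close>

lemma cayley_in_SO:
  fixes s :: "real^'n::finite^'n"
  assumes s: "transpose s = - s" and d: "d \<noteq> 0"
  shows "inverse (det (d *\<^sub>R mat 1 + s)) *\<^sub>R ((d *\<^sub>R mat 1 - s) ** adjugate (d *\<^sub>R mat 1 + s)) \<in> SO"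
proof -
  let ?P = "d *\<^sub>R mat 1 + s" and ?M = "d *\<^sub>R mat 1 - s"
  define B where "B = inverse (det ?P) *\<^sub>R adjugate ?P"
  have nz: "det ?P \<noteq> 0" using skew_det_nonzero[OF s d] .
  have B: "?P ** B = mat 1" "B ** ?P = mat 1"
    using adjugate_mult[OF nz] nz by (simp_all add: B_def matrix_ring_simps(5,6))
  have tP: "transpose ?P = ?M" and tM: "transpose ?M = ?P"
    by (simp_all add: transpose_ring_simps s)
  have comm: "?M ** ?P = ?P ** ?M" by (simp add: matrix_ring_simps algebra_simps)
  have tB: "transpose B ** ?M = mat 1"
    using arg_cong[OF B(1), of transpose] by (simp add: matrix_transpose_mul tP)
  have "transpose (?M ** B) ** (?M ** B) = transpose B ** (?P ** ?M) ** B"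
    by (simp add: matrix_transpose_mul tM matrix_mul_assoc)
  also have "\<dots> = transpose B ** ?M ** (?P ** B)"
    unfolding comm[symmetric] by (simp add: matrix_mul_assoc)
  also have "\<dots> = mat 1" by (simp add: tB B)
  finally have 1: "transpose (?M ** B) ** (?M ** B) = mat 1" .
  have "det (?M ** B) = det (?P ** B)"
    using det_transpose[of ?P] by (simp add: det_mul tP)
  then have "det (?M ** B) = 1" by (simp add: B)
  with 1 show ?thesis by (simp add: SO_def B_def matrix_ring_simps)
qed

locale SO_polyfun_ideal = polyfun_ideal J for J :: "(real^'n::finite^'n \<Rightarrow> complex) set" +
  assumes J_col: "(\<lambda>y. complex_of_real ((mat 1 - transpose y ** y) $ i $ j)) \<in> J"
    and J_det: "(\<lambda>y. 1 - complex_of_real (det y)) \<in> J"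
begin

text \<open>
  Where \<open>1 + g y\<close> is invertible, \<open>y\<close> is congruent to the point \<open>g\<^sup>T (e\<^sup>-\<^sup>1 R)\<close> of the group,
      obtained by
  replacing the Cayley transform of \<open>g y\<close> by its skew part; so a polynomial that vanishes on the
  group is congruent to \<open>0\<close> there.
\<close>

lemma vanishing_localized:
  assumes g: "g \<in> SO" and f: "f \<in> polyfun" and van: "\<And>y. y \<in> SO \<Longrightarrow> f y = 0"
  shows "f \<in> localized (\<lambda>y. det (mat 1 + g ** y))"
proof -
  define x where "x y = g ** y" for y :: "real^'n^'n"
  define N where "N y = mat 1 + x y" for y
  define d where "d y = det (N y)" for y
  define B where "B y = adjugate (N y)" for y
  \<comment> \<open>Where \<open>d y\<close> is nonzero, \<open>a y\<close> is \<open>d y\<close>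
    times the Cayley transform of \<open>x y\<close>, with symmetric part \<open>t y\<close> and
    skew part \<open>s y\<close>. Below, \<open>R y\<close> is \<open>e y\<close> times the Cayley
    transform of \<open>s y / d y\<close>. The factors \<open>d\<close> and \<open>e\<close> keep
    all entries polynomial.\<close>
  define a where "a y = (mat 1 - x y) ** B y" for y
  define t where "t y = (1/2) *\<^sub>R (a y + transpose (a y))" for y
  define s where "s y = (1/2) *\<^sub>R (a y - transpose (a y))" for y
  define P where "P y = d y *\<^sub>R mat 1 + s y" for y
  define e where "e y = det (P y)" for y
  define C where "C y = adjugate (P y)" for y
  define R where "R y = (d y *\<^sub>R mat 1 - s y) ** C y" for y
  define R' where "R' y = transpose g ** R y" for y
  have xp: "mpoly x" unfolding x_def by (intro mpoly_intros)
  have Np: "mpoly N" unfolding N_def by (intro mpoly_intros xp)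
  have dp: "rpoly d" unfolding d_def by (intro rpoly_det Np)
  have Bp: "mpoly B" unfolding B_def by (intro mpoly_intros Np)
  have ap: "mpoly a" unfolding a_def by (intro mpoly_intros xp Bp)
  have sp: "mpoly s" and tp: "mpoly t"
    unfolding s_def t_def by (intro mpoly_intros ap polyfun.const)+
  have Pp: "mpoly P" unfolding P_def by (intro mpoly_intros dp sp)
  have ep: "rpoly e" unfolding e_def by (intro rpoly_det Pp)
  have Cp: "mpoly C" unfolding C_def by (intro mpoly_intros Pp)
  have Rp: "mpoly R" unfolding R_def by (intro mpoly_intros Cp dp sp)
  have R'p: "mpoly R'" unfolding R'_def by (intro mpoly_intros Rp)
  let ?L = "localized d"
  interpret L: polyfun_ideal "?L" by (rule localized_ideal[OF dp])
  define mloc where "mloc A = (\<forall>i j. (\<lambda>y. complex_of_real (A y $ i $ j)) \<in> ?L)" for A ::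
      "real^'n^'n \<Rightarrow> real^'n^'n"
  have mloc_mult: "mloc (\<lambda>y. U y ** A y)" "mloc (\<lambda>y. A y ** U y)" if "mloc A" "mpoly U" for A U
  proof -
    show "mloc (\<lambda>y. U y ** A y)"
      using that unfolding mloc_def mpoly_def matrix_matrix_mult_def
      by (auto intro!: L.J_sum L.J_mult)
    show "mloc (\<lambda>y. A y ** U y)"
      using that unfolding mloc_def mpoly_def matrix_matrix_mult_def
      by (auto intro!: L.J_sum L.J_mult_right)
  qed
  have mloc_eqI: "mloc A" if "mloc A'" "mpoly A" "\<And>y. d y \<noteq> 0 \<Longrightarrow> A y = A' y" for A A'
    unfolding mloc_def
  proof (intro allI)
    fix i j
    have "(\<lambda>y. complex_of_real (A' y $ i $ j)) \<in> ?L" "rpoly (\<lambda>y. A y $ i $ j)"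
      using that unfolding mloc_def mpoly_def by auto
    then show "(\<lambda>y. complex_of_real (A y $ i $ j)) \<in> ?L"
      by (rule localized_eqI) (simp_all add: that(3) dp)
  qed
  have gg: "transpose g ** g = mat 1" "det g = 1" using g by (auto simp: SO_def)
  then have gg': "g ** transpose g = mat 1" by (simp add: matrix_left_right_inverse)
  have xx: "transpose (x y) ** x y = transpose y ** y" for y
  proof -
    have "transpose (x y) ** x y = transpose y ** (transpose g ** g) ** y"
      by (simp add: x_def matrix_transpose_mul matrix_mul_assoc)
    then show ?thesis by (simp add: gg)
  qed
  have NB: "N y ** B y = d y *\<^sub>R mat 1" "B y ** N y = d y *\<^sub>R mat 1" if "d y \<noteq> 0" for y
    using that by (simp_all add: B_def d_def adjugate_mult)
  have tBN: "transpose (B y) ** transpose (N y) = d y *\<^sub>R mat 1" if "d y \<noteq> 0" for y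
    using arg_cong[OF NB(1)[OF that], of transpose] by (simp add: matrix_transpose_mul
        transpose_ring_simps)
  \<comment> \<open>The symmetric part measures the failure of orthogonality:
    \<open>d t = B^T (1 - y^T y) B\<close> where \<open>d\<close> is nonzero.\<close>
  have t_mloc: "mloc t"
  proof -
    have "mloc (\<lambda>y. mat 1 - transpose y ** y)"
      unfolding mloc_def using J_col by (auto intro: localized_base)
    then have "mloc (\<lambda>y. transpose (B y) ** (mat 1 - transpose y ** y) ** B y)"
      by (intro mloc_mult mpoly_intros Bp)
    then have "mloc (\<lambda>y. d y *\<^sub>R t y)"
    proof (rule mloc_eqI)
      show "mpoly (\<lambda>y. d y *\<^sub>R t y)" by (intro mpoly_intros dp tp)
      fix y assume d: "d y \<noteq> 0"
      have 1: "transpose (B y) ** (transpose (N y) ** ((mat 1 - x y) ** B y)) = d y *\<^sub>R a y"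
        unfolding matrix_mul_assoc tBN[OF d] a_def by (simp add: matrix_ring_simps(5))
      have 2: "transpose (B y) ** (transpose (mat 1 - x y) ** (N y ** B y)) =
          d y *\<^sub>R transpose (a y)"
        unfolding NB(1)[OF d] a_def by (simp add: matrix_ring_simps(6) matrix_transpose_mul)
      have 3: "transpose (N y) ** (mat 1 - x y) + transpose (mat 1 - x y) ** N y =
        2 *\<^sub>R (mat 1 - transpose y ** y)"
        unfolding xx[of y, symmetric] N_def
        by (simp add: matrix_ring_simps(1-4) transpose_ring_simps(1,2)) (simp add: vec_eq_iff)
      have "d y *\<^sub>R t y = (1/2) *\<^sub>R (d y *\<^sub>R a y + d y *\<^sub>R transpose (a y))"
        by (simp add: t_def scaleR_add_right mult.commute)
      also have "d y *\<^sub>R a y + d y *\<^sub>R transpose (a y) = transpose (B y) **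
        (transpose (N y) ** (mat 1 - x y) + transpose (mat 1 - x y) ** N y) ** B y"
        unfolding 1[symmetric] 2[symmetric] by (simp add: matrix_ring_simps(1,2) matrix_mul_assoc)
      finally show "d y *\<^sub>R t y = transpose (B y) ** (mat 1 - transpose y ** y) ** B y"
        unfolding 3 by (simp add: matrix_ring_simps(5,6))
    qed
    then have "(\<lambda>y. complex_of_real (d y) ^ 1 * complex_of_real (t y $ i $ j)) \<in> ?L" for i j
      unfolding mloc_def by simp
    then show ?thesis using tp unfolding mloc_def mpoly_def by (blast intro: localized_cancel)
  qed
  have sa: "s y = a y - t y" for y
    by (simp add: s_def t_def scaleR_add_right scaleR_diff_right vec_eq_iff)
  have s_skew: "transpose (s y) = - s y" for y
    by (simp add: s_def transpose_ring_simps scaleR_diff_right)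
  have da: "d y *\<^sub>R mat 1 + a y = 2 *\<^sub>R B y" "d y *\<^sub>R mat 1 - a y =
      2 *\<^sub>R (x y ** B y)" if "d y \<noteq> 0" for y
    unfolding NB(1)[OF that, symmetric] a_def N_def by (simp_all add: matrix_ring_simps scaleR_2)
  \<comment> \<open>The exact relation \<open>d - a = x (d + a)\<close> becomes
    \<open>(d - s) - x (d + s) = N t\<close> when \<open>a\<close> is replaced by
    \<open>s = a - t\<close>. Multiplication by \<open>C\<close> on the right turns the left-hand
    side into \<open>R - e x\<close>.\<close>
  have "mloc (\<lambda>y. N y ** t y)" by (rule mloc_mult(1)[OF t_mloc Np])
  then have "mloc (\<lambda>y. (N y ** t y) ** C y)" by (rule mloc_mult(2)[OF _ Cp])
  then have "mloc (\<lambda>y. (transpose g ** ((N y ** t y) ** C y)))"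
      by (rule mloc_mult(1)[OF _ mpoly_const])
  then have key: "mloc (\<lambda>y. R' y - e y *\<^sub>R y)"
  proof (rule mloc_eqI)
    show "mpoly (\<lambda>y. R' y - e y *\<^sub>R y)" by (intro mpoly_intros R'p ep)
    fix y assume d: "d y \<noteq> 0"
    have e: "det (P y) \<noteq> 0" unfolding P_def by (rule skew_det_nonzero[OF s_skew d])
    have "N y ** t y = (d y *\<^sub>R mat 1 - a y) + t y - x y ** ((d y *\<^sub>R mat 1 + a y) - t y)"
      unfolding da[OF d] N_def by (simp add: matrix_ring_simps)
    also have "\<dots> = (d y *\<^sub>R mat 1 - s y) - x y ** P y"
      unfolding P_def sa by (simp add: algebra_simps)
    finally have "(N y ** t y) ** C y = R y - x y ** (P y ** C y)"
      by (simp add: R_def matrix_ring_simps(3) matrix_mul_assoc)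
    also have "P y ** C y = e y *\<^sub>R mat 1" unfolding C_def e_def by (rule adjugate_mult[OF e])
    finally have "transpose g ** ((N y ** t y) ** C y) = R' y - e y *\<^sub>R ((transpose g ** g) ** y)"
      unfolding R'_def x_def by (simp add: matrix_ring_simps(4,5,6) matrix_mul_assoc)
    then show "R' y - e y *\<^sub>R y = transpose g ** ((N y ** t y) ** C y)" by (simp add: gg)
  qed
  have R'_SO: "inverse (e y) *\<^sub>R R' y \<in> SO" if "d y \<noteq> 0" for y
  proof -
    have "inverse (e y) *\<^sub>R R y \<in> SO"
      unfolding e_def R_def C_def P_def by (rule cayley_in_SO[OF s_skew that])
    then have "transpose g ** (inverse (e y) *\<^sub>R R y) \<in> SO"
      by (intro SO_mult SO_transpose g)
    then show ?thesis by (simp add: R'_def matrix_ring_simps)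
  qed
  \<comment> \<open>Substituting \<open>R' / e\<close> for \<open>y\<close> and clearing
    denominators by \<open>e ^ k\<close> gives a polynomial \<open>h\<close>; it is congruent to
    \<open>e ^ k * f\<close> because \<open>R'\<close> is congruent to \<open>e y\<close>.\<close>
  have "\<exists>k h. h \<in> polyfun \<and> (\<lambda>y. complex_of_real (e y) ^ k * f y - h y) \<in> ?L \<and>
    (\<forall>y. e y \<noteq> 0 \<longrightarrow> h y = complex_of_real (e y) ^ k * f (inverse (e y) *\<^sub>R R' y))"
    using f
  proof (induction rule: polyfun.induct)
    case (const c)
    show ?case by (intro exI[of _ 0] exI[of _ "\<lambda>_. c"]) (simp add: polyfun.const L.J_zero)
  next
    case (coord i j)
    have "(\<lambda>y. complex_of_real (e y *\<^sub>R y $ i $ j - R' y $ i $ j)) \<in> ?L"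
      using key L.J_mult[OF polyfun.const[of "-1"]] unfolding mloc_def by fastforce
    then show ?case
      using R'p by (intro exI[of _ 1] exI[of _ "\<lambda>y. complex_of_real (R' y $ i $ j)"])
        (simp add: mpoly_def)
  next
    case (add f1 f2)
    then obtain k1 h1 k2 h2 where
      1: "h1 \<in> polyfun" "(\<lambda>y. complex_of_real (e y) ^ k1 * f1 y - h1 y) \<in> ?L"
        "\<forall>y. e y \<noteq> 0 \<longrightarrow> h1 y = complex_of_real (e y) ^ k1 * f1 (inverse (e y) *\<^sub>R R' y)" and
      2: "h2 \<in> polyfun" "(\<lambda>y. complex_of_real (e y) ^ k2 * f2 y - h2 y) \<in> ?L"
        "\<forall>y. e y \<noteq> 0 \<longrightarrow> h2 y = complex_of_real (e y) ^ k2 * f2 (inverse (e y) *\<^sub>R R' y)" by blast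
    show ?case
    proof (intro exI[of _ "k1 + k2"] exI[of _ "\<lambda>y. complex_of_real (e y) ^ k2 * h1 y +
        complex_of_real (e y) ^ k1 * h2 y"] conjI)
      show "(\<lambda>y. complex_of_real (e y) ^ (k1 + k2) * (f1 y + f2 y) -
        (complex_of_real (e y) ^ k2 * h1 y + complex_of_real (e y) ^ k1 * h2 y)) \<in> ?L"
        using L.J_add[OF L.J_mult[OF polyfun_power[OF ep,
            of k2] 1(2)] L.J_mult[OF polyfun_power[OF ep, of k1] 2(2)]]
        by (simp add: algebra_simps power_add)
    qed (use 1 2 ep in \<open>auto simp: power_add algebra_simps intro!: polyfun_intros\<close>)
  next
    case (mult f1 f2)
    then obtain k1 h1 k2 h2 where
      1: "h1 \<in> polyfun" "(\<lambda>y. complex_of_real (e y) ^ k1 * f1 y - h1 y) \<in> ?L"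
        "\<forall>y. e y \<noteq> 0 \<longrightarrow> h1 y = complex_of_real (e y) ^ k1 * f1 (inverse (e y) *\<^sub>R R' y)" and
      2: "h2 \<in> polyfun" "(\<lambda>y. complex_of_real (e y) ^ k2 * f2 y - h2 y) \<in> ?L"
        "\<forall>y. e y \<noteq> 0 \<longrightarrow> h2 y = complex_of_real (e y) ^ k2 * f2 (inverse (e y) *\<^sub>R R' y)" by blast
    show ?case
    proof (intro exI[of _ "k1 + k2"] exI[of _ "\<lambda>y. h1 y * h2 y"] conjI)
      show "(\<lambda>y. complex_of_real (e y) ^ (k1 + k2) * (f1 y * f2 y) - h1 y * h2 y) \<in> ?L"
        using L.mult_cong[OF _ 2(1) 1(2) 2(2)] mult ep by (simp add: polyfun_intros power_add
            mult_ac)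
    qed (use 1 2 ep in \<open>auto simp: power_add algebra_simps intro!: polyfun_intros\<close>)
  qed
  then obtain k h where h: "h \<in> polyfun" "(\<lambda>y. complex_of_real (e y) ^ k * f y - h y) \<in> ?L"
    "\<And>y. e y \<noteq> 0 \<Longrightarrow> h y = complex_of_real (e y) ^ k * f (inverse (e y) *\<^sub>R R' y)" by blast
  \<comment> \<open>Where \<open>d\<close> is nonzero, \<open>h\<close> is a multiple of the value
    of \<open>f\<close> at a point of the group, hence \<open>0\<close>.\<close>
  have "h \<in> ?L"
  proof (rule localized_eqI[OF L.J_zero h(1) _ dp])
    fix y assume d: "d y \<noteq> 0"
    have "e y \<noteq> 0" unfolding e_def P_def by (rule skew_det_nonzero[OF s_skew d])
    then show "h y = 0" using h(3) van[OF R'_SO[OF d]] by simp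
  qed
  from L.J_add[OF h(2) this] have ef: "(\<lambda>y. complex_of_real (e y) ^ k * f y) \<in> ?L" by simp
  let ?n = "CARD('n)"
  \<comment> \<open>The factor \<open>e\<close> is now traded for \<open>d\<close>. As
    \<open>P = 2 B - t\<close> and \<open>B N = d\<close>, the product \<open>P N\<close> is
    congruent to the scalar matrix \<open>2 d\<close>; taking determinants, \<open>e d\<close> is
    congruent to \<open>(2 d) ^ n\<close>.\<close>
  have "mloc (\<lambda>y. P y ** N y - (2 * d y) *\<^sub>R mat 1)"
  proof (rule mloc_eqI)
    show "mloc (\<lambda>y. t y ** ((-1) *\<^sub>R N y))"
        by (intro mloc_mult t_mloc mpoly_intros Np polyfun.const)
    show "mpoly (\<lambda>y. P y ** N y - (2 * d y) *\<^sub>R mat 1)"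
      using dp by (intro mpoly_intros Pp Np) (simp add: polyfun_intros)
    fix y assume d: "d y \<noteq> 0"
    have "P y = 2 *\<^sub>R B y - t y" unfolding P_def sa da(1)[OF d, symmetric] by simp
    then show "P y ** N y - (2 * d y) *\<^sub>R mat 1 = t y ** ((-1) *\<^sub>R N y)"
      unfolding matrix_ring_simps(6) using NB(2)[OF d] by (simp add: matrix_ring_simps(3,5))
  qed
  then have "(\<lambda>y. complex_of_real (det (P y ** N y) - det ((2 * d y) *\<^sub>R mat 1 :: real^'n^'n))) \<in>
      ?L"
    unfolding mloc_def using dp
    by (intro L.det_cong mpoly_intros Pp Np) (simp_all add: polyfun_intros)
  then have "(\<lambda>y. complex_of_real (e y) * complex_of_real (d y) - (2 * complex_of_real (d y)) ^
      ?n) \<in> ?L"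
    by (simp add: det_mul det_scaleR_mat_1 e_def d_def)
  then have "(\<lambda>y. (complex_of_real (e y) * complex_of_real (d y)) ^ k - ((2 * complex_of_real (d
      y)) ^ ?n) ^ k) \<in> ?L"
    by (intro L.power_cong polyfun_intros ep dp)
  from L.J_diff[OF L.J_mult[OF polyfun_power[OF dp, of k] ef] L.J_mult[OF f this]]
  have "(\<lambda>y. 2 ^ (?n * k) * (complex_of_real (d y) ^ (?n * k) * f y)) \<in> ?L"
    by (simp add: algebra_simps power_mult_distrib flip: power_mult)
  from L.J_mult[OF polyfun.const[of "1 / 2 ^ (?n * k)"] this]
  have "(\<lambda>y. complex_of_real (d y) ^ (?n * k) * f y) \<in> ?L" by simp
  from localized_cancel[OF this f] show ?thesis by (simp add: d_def N_def x_def[abs_def])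
qed

end

section \<open>Sign matrices and the unit ideal\<close>

definition sign_matrix :: "('n::finite \<Rightarrow> real) \<Rightarrow> real^'n^'n" where
  "sign_matrix \<epsilon> = (\<chi> i j. if i = j then \<epsilon> i else 0)"

lemma det_sign_matrix: "det (sign_matrix \<epsilon>) = prod \<epsilon> UNIV"
  unfolding sign_matrix_def by (subst det_diagonal) auto

lemma sign_matrix_mult: "(sign_matrix \<epsilon> ** y) $ i $ j = \<epsilon> i * y $ i $ j"
  by (simp add: sign_matrix_def matrix_matrix_mult_def if_distrib[of "\<lambda>x. x * _"] cong: if_cong)

text \<open>
  Modulo \<open>1 - det y\<close> the right-hand side is a nonzero constant, and the summands with
  \<open>prod \<epsilon> UNIV = - 1\<close> vanish. So some \<open>1 + g y\<close> with a sign matrix \<open>g\<close> in the group is invertible.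
\<close>

lemma sum_sign_matrix_det:
  fixes y :: "real^'n::finite^'n"
  shows "(\<Sum>\<epsilon>\<in>UNIV \<rightarrow>\<^sub>E {-1, 1}. (1 + prod \<epsilon> UNIV) * det (mat 1 + sign_matrix \<epsilon> ** y)) =
    2 ^ CARD('n) * (1 + det y)"
proof -
  let ?E = "UNIV \<rightarrow>\<^sub>E {-1, 1 :: real}"
  have "(\<Sum>\<epsilon>\<in>?E. det (mat 1 + sign_matrix \<epsilon> ** y)) =
    (\<Sum>p | p permutes UNIV. of_int (sign p) * (\<Sum>\<epsilon>\<in>?E. \<Prod>i\<in>UNIV. mat 1 $ i $ p i + \<epsilon> i * y $ i $ p i))"
    unfolding det_def sum_distrib_left by (subst sum.swap) (simp add: sign_matrix_mult)
  \<comment> \<open>The sum over all signs factors over the rows, and the terms carrying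
    \<open>\<epsilon> i\<close> cancel.\<close>
  also have "\<dots> = (\<Sum>p | p permutes UNIV. of_int (sign p) * (\<Prod>i\<in>UNIV. 2 * (mat 1 :: real^'n^'n) $ i
      $ p i))"
    by (subst prod_sum_PiE[symmetric]) auto
  also have "\<dots> = 2 ^ CARD('n) * det (mat 1 :: real^'n^'n)"
    unfolding det_def by (simp add: prod.distrib sum_distrib_left mult.left_commute)
  finally have 1: "(\<Sum>\<epsilon>\<in>?E. det (mat 1 + sign_matrix \<epsilon> ** y)) = 2 ^ CARD('n)" by simp
  have "(\<Sum>\<epsilon>\<in>?E. prod \<epsilon> UNIV * det (mat 1 + sign_matrix \<epsilon> ** y)) =
    (\<Sum>p | p permutes UNIV. of_int (sign p) * (\<Sum>\<epsilon>\<in>?E. \<Prod>i\<in>UNIV. \<epsilon> i * (mat 1 $ i $ p i +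
        \<epsilon> i * y $ i $ p i)))"
    unfolding det_def sum_distrib_left by (subst sum.swap) (simp add: sign_matrix_mult
        prod.distrib mult.left_commute)
  \<comment> \<open>With the extra factor \<open>\<epsilon> i\<close> it is the entries of the
    identity that cancel, because \<open>\<epsilon> i * \<epsilon> i = 1\<close>.\<close>
  also have "\<dots> = (\<Sum>p | p permutes UNIV. of_int (sign p) * (\<Prod>i\<in>UNIV. 2 * y $ i $ p i))"
    by (subst prod_sum_PiE[symmetric]) auto
  also have "\<dots> = 2 ^ CARD('n) * det y"
    unfolding det_def by (simp add: prod.distrib sum_distrib_left mult.left_commute)
  finally show ?thesis using 1 by (simp add: distrib_right sum.distrib distrib_left)
qed

context SO_polyfun_ideal
begin

text \<open>By \<open>vanishing_localized\<close> the quotient ideal \<open>Q = (J : f)\<close>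
  contains a power of \<open>det (1 + g y)\<close> for every sign matrix \<open>g\<close> of
  determinant 1. So it contains a power of the weighted sum of these, which modulo
  \<open>1 - det y\<close> is a nonzero constant; thus \<open>1\<close> is in
  \<open>Q\<close>.\<close>

theorem vanishing_in_ideal:
  assumes f: "f \<in> polyfun" and van: "\<And>y. y \<in> SO \<Longrightarrow> f y = 0"
  shows "f \<in> J"
proof -
  define Q where "Q = {h \<in> polyfun. (\<lambda>y. h y * f y) \<in> J}"
  interpret Q: polyfun_ideal Q
  proof
    show "(\<lambda>y. g y + h y) \<in> Q" if "g \<in> Q" "h \<in> Q" for g h
      using that J_add unfolding Q_def by (auto simp: distrib_right intro: polyfun_intros)
    show "(\<lambda>y. g y * h y) \<in> Q" if "g \<in> polyfun" "h \<in> Q" for g h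
      using that J_mult unfolding Q_def by (auto simp: mult.assoc intro: polyfun_intros)
  qed (auto simp: Q_def J_zero polyfun.const)
  let ?E = "UNIV \<rightarrow>\<^sub>E {-1, 1 :: real}" and ?n = "CARD('n)"
  define r where "r \<epsilon> y = complex_of_real ((1 + prod \<epsilon> UNIV) * det (mat 1 + sign_matrix \<epsilon> ** y))"
    for \<epsilon> and y :: "real^'n^'n"
  have dp: "rpoly (\<lambda>y. det (mat 1 + sign_matrix \<epsilon> ** y))" for \<epsilon> :: "'n \<Rightarrow> real"
    by (intro rpoly_det mpoly_intros)
  then have rp: "r \<epsilon> \<in> polyfun" for \<epsilon>
    unfolding r_def[abs_def] of_real_mult by (intro polyfun_intros)
  have "\<exists>k. (\<lambda>y. r \<epsilon> y ^ k) \<in> Q" if "\<epsilon> \<in> ?E" for \<epsilon>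
  proof -
    have pm: "\<epsilon> i = - 1 \<or> \<epsilon> i = 1" for i using that by (auto simp: PiE_def Pi_def)
    show ?thesis
    proof (cases "prod \<epsilon> UNIV = 1")
      case True
      have \<epsilon>1: "\<epsilon> i * \<epsilon> i = 1" for i using pm[of i] by auto
      have "transpose (sign_matrix \<epsilon>) = sign_matrix \<epsilon>"
        by (simp add: sign_matrix_def transpose_def vec_eq_iff)
      moreover have "sign_matrix \<epsilon> ** sign_matrix \<epsilon> = mat 1"
        by (auto simp: vec_eq_iff sign_matrix_mult mat_def) (auto simp: sign_matrix_def \<epsilon>1)
      ultimately have "sign_matrix \<epsilon> \<in> SO" using True by (simp add: SO_def det_sign_matrix)
      from vanishing_localized[OF this f van] obtain k
        where "(\<lambda>y. complex_of_real (det (mat 1 + sign_matrix \<epsilon> ** y)) ^ k * f y) \<in> J"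
        unfolding localized_def by blast
      then have "(\<lambda>y. complex_of_real (det (mat 1 + sign_matrix \<epsilon> ** y)) ^ k) \<in> Q"
        using dp unfolding Q_def by (auto intro: polyfun_intros)
      from Q.J_mult[OF polyfun.const this, of "2 ^ k"] show ?thesis
        by (auto simp: r_def True power_mult_distrib)
    next
      case False
      have "\<bar>prod \<epsilon> UNIV\<bar> = 1"
        unfolding abs_prod
      proof (intro prod.neutral ballI)
        show "\<bar>\<epsilon> i\<bar> = 1" for i using pm[of i] by auto
      qed
      with False have "prod \<epsilon> UNIV = - 1" by linarith
      then show ?thesis by (intro exI[of _ 1]) (simp add: r_def Q.J_zero)
    qed
  qed
  then have "\<exists>m. (\<lambda>y. (\<Sum>\<epsilon>\<in>?E. r \<epsilon> y) ^ m) \<in> Q" by (rule Q.radical_sum[OF rp])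
  then obtain m where m: "(\<lambda>y. (\<Sum>\<epsilon>\<in>?E. r \<epsilon> y) ^ m) \<in> Q" ..
  have "(\<Sum>\<epsilon>\<in>?E. r \<epsilon> y) = 2 ^ ?n * (1 + complex_of_real (det y))" for y
    using arg_cong[OF sum_sign_matrix_det[of y], of complex_of_real] by (simp add: r_def)
  with m have m: "(\<lambda>y. (2 ^ ?n * (1 + complex_of_real (det y))) ^ m) \<in> Q" by simp
  have detp: "rpoly (det :: real^'n^'n \<Rightarrow> real)" by (intro rpoly_det mpoly_intros)
  then have "(\<lambda>y. 1 - complex_of_real (det y)) \<in> Q"
    unfolding Q_def using J_mult_right[OF J_det f] by (auto intro: polyfun_intros)
  from Q.J_mult[OF polyfun.const[of "2 ^ ?n"] this]
  have "(\<lambda>y. 2 ^ Suc ?n - 2 ^ ?n * (1 + complex_of_real (det y))) \<in> Q"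
    by (simp add: algebra_simps)
  from Q.power_cong[OF _ _ this, of m]
  have "(\<lambda>y. (2 ^ Suc ?n) ^ m - (2 ^ ?n * (1 + complex_of_real (det y))) ^ m) \<in> Q"
    using detp by (simp only: polyfun_intros)
  from Q.J_add[OF this m] have "(\<lambda>_. (2 ^ Suc ?n) ^ m) \<in> Q" by simp
  from Q.J_mult[OF polyfun.const[of "1 / (2 ^ Suc ?n) ^ m"] this]
  have "(\<lambda>_. 1) \<in> Q" by (simp del: power_Suc)
  then show ?thesis by (simp add: Q_def)
qed

end

section \<open>A bump function\<close>

definition flat_exp :: "nat \<Rightarrow> real \<Rightarrow> real" where
  "flat_exp m x = (if x > 0 then inverse x ^ m * exp (- inverse x) else 0)"

lemma flat_tendsto_0: "(flat_exp m \<longlongrightarrow> 0) (at 0)"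
proof (rule filterlim_split_at)
  show "(flat_exp m \<longlongrightarrow> 0) (at_left 0)"
    by (rule tendsto_eventually) (auto simp: flat_exp_def eventually_at_filter)
  have "((\<lambda>x. inverse x ^ m / exp (inverse x)) \<longlongrightarrow> 0) (at_right (0::real))"
    by (rule filterlim_compose[OF tendsto_power_div_exp_0 filterlim_inverse_at_top_right])
  then show "(flat_exp m \<longlongrightarrow> 0) (at_right 0)"
    by (rule Lim_transform_eventually)
      (auto simp: flat_exp_def eventually_at_filter exp_minus divide_inverse)
qed

lemma flat_has_derivative:
  "(flat_exp m has_real_derivative flat_exp (m + 2) x - of_nat m * flat_exp (m + 1) x) (at x)"
proof -
  consider "x > 0" | "x < 0" | "x = 0" by linarith
  then show ?thesis
  proof cases
    case 1
    let ?u = "inverse x"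
    have i: "(inverse has_real_derivative - (?u * ?u)) (at x)"
      using DERIV_inverse[of x] 1 by (simp add: power2_eq_square)
    have "((\<lambda>x. inverse x ^ m * exp (- inverse x)) has_real_derivative
      (of_nat m * (- (?u * ?u) * ?u ^ (m - Suc 0))) * exp (- ?u) +
          (exp (- ?u) * - (- (?u * ?u))) * ?u ^ m) (at x)"
      by (intro DERIV_mult DERIV_power DERIV_chain'[OF DERIV_minus DERIV_exp] i)
    moreover have "(of_nat m * (- (?u * ?u) * ?u ^ (m - Suc 0))) * exp (- ?u) +
        (exp (- ?u) * - (- (?u * ?u))) * ?u ^ m =
      flat_exp (m + 2) x - of_nat m * flat_exp (m + 1) x"
      using 1 by (cases m) (simp_all add: flat_exp_def algebra_simps)
    ultimately have "((\<lambda>x. inverse x ^ m * exp (- inverse x)) has_real_derivative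
      flat_exp (m + 2) x - of_nat m * flat_exp (m + 1) x) (at x)" by simp
    then show ?thesis
      by (rule has_field_derivative_transform_within_open[of _ _ _ "{0<..}"])
        (use 1 in \<open>auto simp: flat_exp_def\<close>)
  next
    case 2
    have "((\<lambda>_. 0) has_real_derivative flat_exp (m + 2) x - of_nat m * flat_exp (m + 1) x) (at x)"
      using 2 by (simp add: flat_exp_def)
    then show ?thesis
      by (rule has_field_derivative_transform_within_open[of _ _ _ "{..<0}"])
        (use 2 in \<open>auto simp: flat_exp_def\<close>)
  next
    case 3
    \<comment> \<open>At \<open>0\<close> the difference quotient of \<open>flat_exp m\<close> is
      \<open>flat_exp (m + 1)\<close>, which tends to \<open>0\<close>.\<close>
    have "(\<lambda>h. (flat_exp m (0 + h) - flat_exp m 0) / h) = flat_exp (m + 1)"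
      by (auto simp: flat_exp_def divide_inverse mult_ac)
    then show ?thesis
      unfolding 3 has_field_derivative_iff using flat_tendsto_0[of "m +
          1"] by (simp add: flat_exp_def)
  qed
qed

definition bump_arg :: "real \<Rightarrow> 'a::real_inner \<Rightarrow> real" where
  "bump_arg c y = c - y \<bullet> y"

text \<open>A class of differentiable functions that contains the bump and is closed under partial
  derivatives; this closure gives smoothness.\<close>

inductive_set flatfun :: "real \<Rightarrow> (real^'n::finite^'n \<Rightarrow> complex) set" for c where
  base: "f \<in> polyfun \<Longrightarrow> (\<lambda>y. f y * complex_of_real (flat_exp m (bump_arg c y))) \<in> flatfun c"
| add: "f \<in> flatfun c \<Longrightarrow> g \<in> flatfun c \<Longrightarrow> (\<lambda>y. f y + g y) \<in> flatfun c"

lemma flat_bump_arg_has_derivative: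
  fixes y :: "'a::real_inner"
  shows "((\<lambda>y. complex_of_real (flat_exp m (bump_arg c y))) has_derivative
    (\<lambda>h. complex_of_real ((flat_exp (m + 2) (bump_arg c y) - of_nat m * flat_exp (m +
        1) (bump_arg c y)) * (- 2 * (y \<bullet> h))))) (at y)"
proof -
  have "(bump_arg c has_derivative (\<lambda>h. - 2 * (y \<bullet> h))) (at y)"
    unfolding bump_arg_def[abs_def] by (auto intro!: derivative_eq_intros simp: inner_commute)
  from has_derivative_compose[OF this flat_has_derivative[THEN
      has_field_derivative_imp_has_derivative]]
  show ?thesis by (intro has_derivative_of_real) 
qed

lemma flatfun_differentiable_pd:
  assumes "f \<in> flatfun c"
  shows "(\<forall>y. f differentiable (at y)) \<and> (\<forall>i j. pd i j f \<in> flatfun c)"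
  using assms
proof (induction rule: flatfun.induct)
  case (base f m)
  let ?q = "bump_arg c"
  note d = has_derivative_mult[OF smooth_has_derivative[OF smooth_polyfun[OF base]]
      flat_bump_arg_has_derivative]
  have "pd i j (\<lambda>y. f y * complex_of_real (flat_exp m (?q y))) = (\<lambda>y.
     pd i j f y * complex_of_real (flat_exp m (?q y)) +
     ((f y * ((- 2) * complex_of_real (y $ i $ j))) * complex_of_real (flat_exp (m + 2) (?q y)) +
     (f y * ((2 * of_nat m) * complex_of_real (y $ i $ j))) * complex_of_real (flat_exp (m +
         1) (?q y))))" for i j
    by (rule ext, subst pd_eqI[OF d]) (simp add: pd_def inner_axis algebra_simps)
  moreover have "(\<lambda>y. pd i j f y * complex_of_real (flat_exp m (?q y)) +
     ((f y * ((- 2) * complex_of_real (y $ i $ j))) * complex_of_real (flat_exp (m + 2) (?q y)) +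
     (f y * ((2 * of_nat m) * complex_of_real (y $ i $ j))) * complex_of_real (flat_exp (m +
         1) (?q y)))) \<in> flatfun c" for i j
    by (intro flatfun.intros polyfun_intros polyfun_pd base)
  ultimately show ?case using d unfolding differentiable_def by fastforce
next
  case (add f g)
  have "pd i j (\<lambda>y. f y + g y) = (\<lambda>y. pd i j f y + pd i j g y)" for i j
    using add.IH by (intro ext, subst pd_eqI[OF has_derivative_add])
      (auto simp: pd_def frechet_derivative_works[symmetric])
  then show ?case using add.IH by (auto intro: flatfun.add differentiable_add)
qed

lemma smooth_flatfun:
  assumes "f \<in> flatfun c"
  shows "smooth f"
proof -
  have "iter_pd is f \<in> flatfun c" for "is"
    using assms by (induction "is" f rule: iter_pd.induct) (auto simp: flatfun_differentiable_pd)
  then show ?thesis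
    unfolding smooth_def using flatfun_differentiable_pd
    by (blast intro: differentiable_at_imp_differentiable_on)
qed

text \<open>Taking \<open>c\<close> above \<open>CARD('n)\<close>, the value of
  \<open>y \<bullet> y\<close> on the group, makes the bump positive on the whole group.\<close>

lemma bump_exists:
  "\<exists>\<beta> :: 'n::finite test. \<forall>y. \<exists>r\<ge>0. test_fun \<beta> y = complex_of_real r \<and> (y \<bullet> y < c \<longrightarrow> r > 0)"
proof -
  define f :: "real^'n^'n \<Rightarrow> complex" where "f y =
      1 * complex_of_real (flat_exp 0 (bump_arg c y))" for y
  have "f \<in> flatfun c" unfolding f_def by (intro flatfun.base polyfun.const)
  then have "smooth f" by (rule smooth_flatfun)
  moreover have "bounded {y. f y \<noteq> 0}"
    unfolding bounded_iff
  proof (intro exI ballI)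
    show "norm y \<le> sqrt c" if "y \<in> {y. f y \<noteq> 0}" for y
      using that by (auto simp: f_def flat_exp_def bump_arg_def norm_eq_sqrt_inner split: if_splits)
  qed
  ultimately have "test_fun (Abs_test f) = f" by (intro Abs_test_inverse) simp
  then have "test_fun (Abs_test f) y = complex_of_real (flat_exp 0 (bump_arg c y))" for y
    by (simp add: f_def)
  moreover have "flat_exp 0 (bump_arg c y) \<ge> 0" "y \<bullet> y < c \<Longrightarrow>
      flat_exp 0 (bump_arg c y) > 0" for y :: "real^'n^'n"
    by (simp_all add: flat_exp_def bump_arg_def)
  ultimately show ?thesis by blast
qed

section \<open>The Haar measure\<close>

lemma SO_columns:
  assumes "y \<in> SO"
  shows "(\<Sum>k\<in>UNIV. y $ k $ i * y $ k $ j) = (if i = j then 1 else 0)"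
proof -
  have "(transpose y ** y) $ i $ j = mat 1 $ i $ j" using assms by (simp add: SO_def)
  then show ?thesis by (simp add: matrix_matrix_mult_def transpose_def mat_def)
qed

lemma SO_rows: "y \<in> SO \<Longrightarrow> (\<Sum>k\<in>UNIV. y $ i $ k * y $ j $ k) = (if i = j then 1 else 0)"
  using SO_columns[OF SO_transpose, of y i j] by (simp add: transpose_def)

lemma SO_inner_self:
  fixes y :: "real^'n::finite^'n"
  assumes "y \<in> SO"
  shows "y \<bullet> y = CARD('n)"
  using SO_rows[OF assms, of i i for i] by (simp add: inner_vec_def)

lemma compact_SO: "compact (SO :: (real^'n::finite^'n) set)"
proof -
  have "closed ({y :: real^'n^'n. transpose y ** y = mat 1} \<inter> {y. det y = 1})"
    unfolding transpose_def matrix_matrix_mult_def det_def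
    by (intro closed_Int closed_Collect_eq continuous_intros)
  then have "closed (SO :: (real^'n^'n) set)" by (simp add: SO_def Collect_conj_eq)
  moreover have "bounded (SO :: (real^'n^'n) set)"
    unfolding bounded_iff
    by (intro exI[of _ "sqrt CARD('n)"]) (simp add: norm_eq_sqrt_inner SO_inner_self)
  ultimately show ?thesis by (simp add: compact_eq_bounded_closed)
qed

locale SO_haar =
  fixes M :: "(real^'n::finite^'n) measure"
  assumes haar: "SO_haar_measure M"
begin

sublocale prob_space M
  using haar by (simp add: SO_haar_measure_def)

lemma sets_M: "sets M = sets (restrict_space borel SO)"
  using haar by (simp add: SO_haar_measure_def)

lemma space_M: "space M = SO"
  using sets_eq_imp_space_eq[OF sets_M] by (simp add: space_restrict_space)

lemma mult_measurable: "g \<in> SO \<Longrightarrow> (\<lambda>y. g ** y) \<in> measurable M M"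
proof -
  assume g: "g \<in> SO"
  have "(\<lambda>y. g ** y) \<in> borel_measurable borel"
    unfolding matrix_matrix_mult_def
    by (intro borel_measurable_continuous_onI continuous_intros)
  then have "(\<lambda>y. g ** y) \<in> measurable (restrict_space borel SO) (restrict_space borel SO)"
    using SO_mult[OF g] by (intro measurable_restrict_space3) auto
  then show ?thesis by (simp add: measurable_cong_sets[OF sets_M sets_M])
qed

lemma distr_mult: "g \<in> SO \<Longrightarrow> distr M M (\<lambda>y. g ** y) = M"
  using haar by (simp add: SO_haar_measure_def)

lemma borel_measurable_M:
  fixes f :: "real^'n^'n \<Rightarrow> 'b::real_normed_vector"
  shows "f \<in> borel_measurable borel \<Longrightarrow> f \<in> borel_measurable M"
  unfolding measurable_cong_sets[OF sets_M refl] by (rule measurable_restrict_space1)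

lemma test_fun_measurable: "test_fun \<phi> \<in> borel_measurable borel"
  by (intro borel_measurable_continuous_onI smooth_continuous smooth_test_fun)

lemma integrable_test: "integrable M (test_fun \<phi>)"
  by (rule test_integrable_SO_haar[OF haar])

lemma integral_translate:
  assumes "g \<in> SO"
  shows "(\<integral>y. test_fun \<phi> (g ** y) \<partial>M) = (\<integral>y. test_fun \<phi> y \<partial>M)"
    and "integrable M (\<lambda>y. test_fun \<phi> (g ** y))"
  using integral_distr[OF mult_measurable[OF assms] borel_measurable_M[OF test_fun_measurable]]
    integrable_distr[OF mult_measurable[OF assms], of "test_fun \<phi>"] integrable_test
  by (simp_all add: distr_mult[OF assms])

text \<open>Finitely many translates of a nonempty open subset cover the compact group.\<close>

lemma integral_zero_imp_zero:
  fixes F :: "real^'n^'n \<Rightarrow> real"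
  assumes F: "integrable M F" "continuous_on UNIV F" "\<And>y. F y \<ge> 0" "(\<integral>y. F y \<partial>M) = 0"
    and g: "g \<in> SO"
  shows "F g = 0"
proof (rule ccontr)
  assume "F g \<noteq> 0"
  with F(3)[of g] have pos: "F g > 0" by simp
  \<comment> \<open>For \<open>h\<close> in the group, \<open>V h\<close> is a neighbourhood of
    \<open>h\<close>, because \<open>g h^T\<close> moves \<open>h\<close> to \<open>g\<close>, where
    \<open>F\<close> is positive.\<close>
  define V where "V h = {y. F ((g ** transpose h) ** y) > 0}" for h :: "real^'n^'n"
  have "open (V h)" for h
  proof -
    have "continuous_on UNIV (\<lambda>y. F ((g ** transpose h) ** y))"
      by (rule continuous_on_compose2[OF F(2)])
          (auto simp: matrix_matrix_mult_def intro!: continuous_intros)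
    then show ?thesis unfolding V_def by (intro open_Collect_less continuous_on_const)
  qed
  moreover have "SO \<subseteq> (\<Union>h\<in>SO. V h)"
  proof
    fix h :: "real^'n^'n" assume h: "h \<in> SO"
    then have "(g ** transpose h) ** h = g" by (simp add: SO_def flip: matrix_mul_assoc)
    then have "h \<in> V h" using pos by (simp add: V_def)
    then show "h \<in> (\<Union>h\<in>SO. V h)" using h by blast
  qed
  ultimately obtain T where T: "T \<subseteq> SO" "finite T" "SO \<subseteq> (\<Union>h\<in>T. V h)"
    using compactE_image[OF compact_SO] by metis
  have AE: "AE y in M. F y = 0"
    using F integral_nonneg_eq_0_iff_AE[OF F(1)] by simp
  have "AE y in M. F ((g ** transpose h) ** y) = 0" if "h \<in> T" for h
  proof -
    have k: "g ** transpose h \<in> SO" using T that g by (auto intro: SO_mult SO_transpose)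
    have "AE y in distr M M (\<lambda>y. (g ** transpose h) ** y). F y = 0"
      using AE by (simp only: distr_mult[OF k])
    from AE_distrD[OF mult_measurable[OF k] this] show ?thesis .
  qed
  \<comment> \<open>By invariance every translate of \<open>F\<close> vanishes almost everywhere,
    yet at each point of the group one of these finitely many translates is positive.\<close>
  then have "AE y in M. \<forall>h\<in>T. F ((g ** transpose h) ** y) = 0"
    using T(2) by (simp add: AE_finite_all)
  moreover have "\<not> (\<forall>h\<in>T. F ((g ** transpose h) ** y) = 0)" if "y \<in> space M" for y
    using T(3) that unfolding space_M V_def by fastforce
  ultimately have "AE y in M. False"
    by (auto elim!: AE_mp intro!: AE_I2)
  then show False by simp
qed

abbreviation \<mu> where "\<mu> \<equiv> measure_distribution M"

text \<open>A multiplication operator is its own transpose: transposition reverses products, but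
  these factors commute.\<close>

lemma pairing_mulop:
  "f \<in> polyfun \<Longrightarrow> pairing (weyl_act (mulop f) u) \<phi> = pairing u (weyl_op (mulop f) \<phi>)"
proof (induction arbitrary: u \<phi> rule: polyfun.induct)
  case (const c)
  then show ?case by (simp add: pairing_weyl_act_scalar pairing_linear flip: weyl_scalar_mulop)
next
  case (coord i j)
  then show ?case by (simp add: pairing_weyl_act_y flip: weyl_y_mulop)
next
  case (add f g)
  then show ?case by (simp add: weyl_act_add pairing_linear flip: mulop_add)
next
  case (mult f g)
  have "pairing (weyl_act (mulop f * mulop g) u) \<phi> = pairing u (weyl_op (mulop g * mulop f) \<phi>)"
    by (simp add: weyl_act_mult mult.IH)
  then show ?case using mult.hyps by (simp add: mulop_mult mult.commute)
qed

text \<open>Pair \<open>f \<mu>\<close> with \<open>cnj f * \<beta>\<close>, where the bump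
  \<open>\<beta>\<close> is positive on the group. The result is the integral of
  \<open>|f|^2 \<beta>\<close>, a continuous nonnegative function, which therefore vanishes on the
  group by \<open>integral_zero_imp_zero\<close>.\<close>

lemma mulop_annihilates_imp_zero:
  assumes f: "f \<in> polyfun" and ann: "weyl_act (mulop f) \<mu> = 0" and y: "y \<in> SO"
  shows "f y = 0"
proof -
  obtain \<beta> :: "'n test" and r where
    \<beta>: "\<And>y. r y \<ge> 0" "\<And>y. test_fun \<beta> y = complex_of_real (r y)" "\<And>y. y \<bullet> y < real CARD('n) + 1 \<Longrightarrow>
        r y > 0"
    using bump_exists[of "real CARD('n) + 1"] by metis
  define \<psi> where "\<psi> = weyl_op (mulop f) (weyl_op (mulop (\<lambda>y. cnj (f y))) \<beta>)"
  define F where "F y = (cmod (f y))\<^sup>2 * r y" for y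
  have \<psi>: "test_fun \<psi> y = complex_of_real (F y)" for y
    using f by (simp only: \<psi>_def F_def weyl_op_mulop polyfun_cnj \<beta> of_real_mult
        complex_norm_square mult.assoc)
  have F: "F = (\<lambda>y. Re (test_fun \<psi> y))" by (simp add: \<psi>)
  have "(\<integral>y. test_fun \<psi> y \<partial>M) = pairing (weyl_act (mulop f) \<mu>) (weyl_op (mulop (\<lambda>y. cnj (f y))) \<beta>)"
    by (simp add: \<psi>_def pairing_mulop f pairing_SO_haar[OF haar])
  also have "\<dots> = 0" by (simp add: ann)
  finally have "(\<integral>y. F y \<partial>M) = 0" unfolding \<psi> integral_complex_of_real by simp
  moreover have "integrable M F" unfolding F by (intro integrable_Re integrable_test)
  moreover have "continuous_on UNIV F"
    unfolding F by (intro continuous_intros smooth_continuous smooth_test_fun)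
  moreover have "F y \<ge> 0" for y using \<beta>(1) by (simp add: F_def)
  ultimately have "F y = 0" by (intro integral_zero_imp_zero[of F y] y)
  moreover have "r y > 0" by (rule \<beta>(3)) (simp add: SO_inner_self[OF y])
  ultimately show ?thesis by (simp add: F_def)
qed

lemma mulop_annihilates:
  assumes f: "f \<in> polyfun" and z: "\<And>y. y \<in> SO \<Longrightarrow> f y = 0"
  shows "weyl_act (mulop f) \<mu> = 0"
proof (rule distribution_eqI)
  fix \<phi>
  have "(\<integral>y. test_fun (weyl_op (mulop f) \<phi>) y \<partial>M) = (\<integral>y. 0 \<partial>M)"
    using f z by (intro Bochner_Integration.integral_cong) (simp_all add: space_M)
  then show "pairing (weyl_act (mulop f) \<mu>) \<phi> = pairing 0 \<phi>"
    by (simp add: pairing_mulop f pairing_SO_haar[OF haar])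
qed

end

section \<open>Rotations\<close>

definition plane_proj :: "'n::finite \<Rightarrow> 'n \<Rightarrow> real^'n^'n" where
  "plane_proj k l = (\<chi> a b. if a = b \<and> (a = k \<or> a = l) then 1 else 0)"

definition plane_skew :: "'n::finite \<Rightarrow> 'n \<Rightarrow> real^'n^'n" where
  "plane_skew k l = (\<chi> a b. if a = k \<and> b = l then 1 else if a = l \<and> b = k then - 1 else 0)"

text \<open>For \<open>k \<noteq> l\<close> this is the closed form of the exponential of
  \<open>t *\<^sub>R plane_skew k l\<close>, since the square of \<open>plane_skew k l\<close> is
  \<open>- plane_proj k l\<close>.\<close>

definition rotation :: "'n::finite \<Rightarrow> 'n \<Rightarrow> real \<Rightarrow> real^'n^'n" where
  "rotation k l t = mat 1 + (cos t - 1) *\<^sub>R plane_proj k l + sin t *\<^sub>R plane_skew k l"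

lemma plane_proj_mult: "plane_proj k l ** y = (\<chi> a b. if a = k \<or> a = l then y $ a $ b else 0)"
proof -
  have "(plane_proj k l ** y) $ a $ b = (if a = k \<or> a = l then y $ a $ b else 0)" for a b
    by (cases "a = k \<or> a = l")
      (auto simp: plane_proj_def matrix_matrix_mult_def if_distrib[of "\<lambda>x. x * _"] cong: if_cong)
  then show ?thesis by (simp add: vec_eq_iff)
qed

lemma plane_skew_mult:
  assumes "k \<noteq> l"
  shows "plane_skew k l ** y = (\<chi> a b. if a = k then y $ l $ b else if a =
      l then - y $ k $ b else 0)"
proof -
  have "(plane_skew k l ** y) $ a $ b = (if a = k then y $ l $ b else if a =
      l then - y $ k $ b else 0)" for a b
    using assms by (cases "a = k"; cases "a = l")
      (auto simp: plane_skew_def matrix_matrix_mult_def if_distrib[of "\<lambda>x. x * _"] cong: if_cong)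
  then show ?thesis by (simp add: vec_eq_iff)
qed

lemma plane_mult:
  assumes "k \<noteq> l"
  shows "plane_proj k l ** plane_proj k l = plane_proj k l"
    "plane_proj k l ** plane_skew k l = plane_skew k l"
    "plane_skew k l ** plane_proj k l = plane_skew k l"
    "plane_skew k l ** plane_skew k l = - plane_proj k l"
  using assms unfolding plane_proj_mult plane_skew_mult[OF assms]
  by (auto simp: vec_eq_iff plane_proj_def plane_skew_def)

lemma rotation_add:
  assumes "k \<noteq> l"
  shows "rotation k l s ** rotation k l t = rotation k l (s + t)"
  unfolding rotation_def
  by (simp add: matrix_ring_simps plane_mult[OF assms]) (simp add: vec_eq_iff cos_add sin_add
      algebra_simps)

lemma rotation_0: "rotation k l 0 = mat 1"
  by (simp add: rotation_def)

lemma transpose_rotation: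
  assumes "k \<noteq> l"
  shows "transpose (rotation k l t) = rotation k l (- t)"
  using assms by (auto simp: rotation_def transpose_def vec_eq_iff mat_def plane_proj_def
      plane_skew_def)

text \<open>The determinant is \<open>1\<close> and not \<open>- 1\<close> because the rotation is
  the square of the one by \<open>t / 2\<close>.\<close>

lemma rotation_in_SO:
  assumes "k \<noteq> l"
  shows "rotation k l t \<in> SO"
proof -
  have 1: "transpose (rotation k l t) ** rotation k l t = mat 1"
    "rotation k l t ** transpose (rotation k l t) = mat 1" for t
    by (simp_all add: transpose_rotation[OF assms] rotation_add[OF assms] rotation_0)
  then have "orthogonal_matrix (rotation k l (t / 2))" by (simp add: orthogonal_matrix_def)
  then have "det (rotation k l (t / 2)) * det (rotation k l (t / 2)) = 1"
    using det_orthogonal_matrix by fastforce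
  then have "det (rotation k l t) = 1"
    using det_mul[of "rotation k l (t / 2)" "rotation k l (t / 2)"] by (simp add: rotation_add[OF
        assms])
  with 1 show ?thesis by (simp add: SO_def)
qed

text \<open>For \<open>k \<noteq> l\<close> the derivative of \<open>\<phi>\<close> along the right
  invariant field with value \<open>plane_skew k l ** y\<close> at \<open>y\<close>, the
  infinitesimal form of left multiplication by \<open>rotation k l t\<close>.\<close>

definition left_rot :: "'n::finite \<Rightarrow> 'n \<Rightarrow> 'n test \<Rightarrow> 'n test" where
  "left_rot k l \<phi> = (\<Sum>a\<in>UNIV. test_coord l a (test_pd k a \<phi>) - test_coord k a (test_pd l a \<phi>))"

lemma test_fun_sum: "test_fun (sum f A) y = (\<Sum>a\<in>A. test_fun (f a) y)"
  by (induction A rule: infinite_finite_induct) simp_all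

lemma left_rot_fun:
  "test_fun (left_rot k l \<phi>) y = (\<Sum>a\<in>UNIV. complex_of_real (y $ l $ a) * pd k a (test_fun \<phi>) y -
    complex_of_real (y $ k $ a) * pd l a (test_fun \<phi>) y)"
  by (simp add: left_rot_def test_fun_sum)

lemma has_vector_derivative_rotation:
  assumes "k \<noteq> l"
  shows "((\<lambda>t. test_fun \<phi> (rotation k l t ** y)) has_vector_derivative
    test_fun (left_rot k l \<phi>) (rotation k l t ** y)) (at t within S)"
proof -
  let ?P = "plane_proj k l" and ?J = "plane_skew k l" and ?z = "rotation k l t ** y"
  define D where "D = frechet_derivative (test_fun \<phi>) (at ?z)"
  have dD: "(test_fun \<phi> has_derivative D) (at ?z)"
    unfolding D_def by (rule smooth_has_derivative[OF smooth_test_fun])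
  then interpret D: bounded_linear D by (rule has_derivative_bounded_linear)
  have "((\<lambda>t. y + (cos t - 1) *\<^sub>R (?P ** y) + sin t *\<^sub>R (?J ** y)) has_derivative
    (\<lambda>h. h *\<^sub>R (cos t *\<^sub>R (?J ** y) - sin t *\<^sub>R (?P ** y)))) (at t within S)"
    by (auto intro!: derivative_eq_intros simp: algebra_simps)
  moreover have "rotation k l t ** y = y + (cos t - 1) *\<^sub>R (?P ** y) + sin t *\<^sub>R (?J ** y)" for t
    by (simp add: rotation_def matrix_ring_simps)
  \<comment> \<open>The derivative of a one-parameter group is its generator times its current
    value.\<close>
  moreover have "cos t *\<^sub>R (?J ** y) - sin t *\<^sub>R (?P ** y) = ?J ** ?z"
    by (simp add: rotation_def matrix_ring_simps matrix_mul_assoc plane_mult[OF assms])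
      (simp add: vec_eq_iff algebra_simps plane_proj_mult)
  ultimately have "((\<lambda>t. rotation k l t ** y) has_derivative (\<lambda>h. h *\<^sub>R (?J ** ?z))) (at t within
      S)"
    by simp
  from has_derivative_compose[OF this dD]
  have "((\<lambda>t. test_fun \<phi> (rotation k l t ** y)) has_derivative (\<lambda>h. h *\<^sub>R D (?J ** ?z))) (at t
      within S)"
    by (simp add: D.scaleR)
  moreover have "D (?J ** ?z) = test_fun (left_rot k l \<phi>) ?z"
  proof -
    have "?J ** ?z = (\<Sum>a\<in>UNIV. ?z $ l $ a *\<^sub>R axis k (axis a 1) - ?z $ k $ a *\<^sub>R axis l (axis a 1))"
      using assms unfolding plane_skew_mult[OF assms]
      by (auto simp: vec_eq_iff axis_def if_distrib[of "\<lambda>x. _ * x"] sum_subtractf sum_negf cong: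
          if_cong)
    then show ?thesis
      by (simp add: D.sum D.diff D.scaleR left_rot_fun pd_def flip: D_def)
        (simp add: scaleR_conv_of_real)
  qed
  ultimately show ?thesis by (simp add: has_vector_derivative_def)
qed

lemma test_fun_bounded: "\<exists>B. \<forall>y. norm (test_fun \<phi> y) \<le> B"
proof -
  have "compact (test_fun \<phi> ` closure {y. \<phi> y \<noteq> 0})"
    using test_fun[of \<phi>]
    by (intro compact_continuous_image) (auto intro: continuous_on_subset[OF smooth_continuous])
  then obtain B where B: "B > 0" "\<And>y. y \<in> closure {y. \<phi> y \<noteq> 0} \<Longrightarrow> norm (\<phi> y) \<le> B"
    by (force dest!: compact_imp_bounded simp: bounded_pos)
  have "norm (\<phi> y) \<le> B" for y
    using B closure_subset[of "{y. \<phi> y \<noteq> 0}"] by (cases "\<phi> y = 0") auto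
  then show ?thesis by blast
qed

context SO_haar
begin

text \<open>Left invariance makes the integrals of the difference quotients along rotations vanish.
  By the mean value inequality the quotients are bounded by a bound of
  \<open>left_rot k l \<phi>\<close>, so the limit may be taken under the integral.\<close>

lemma integral_left_rot: "(\<integral>y. test_fun (left_rot k l \<phi>) y \<partial>M) = 0"
proof (cases "k = l")
  case True
  then show ?thesis by (simp add: left_rot_fun)
next
  case False
  define t where "t n = inverse (real (Suc n))" for n
  have t: "t n > 0" for n by (simp add: t_def)
  have tlim: "t \<longlonglongrightarrow> 0" unfolding t_def by (rule LIMSEQ_inverse_real_of_nat)
  define s where "s n y = (test_fun \<phi> (rotation k l (t n) ** y) - test_fun \<phi> y) /\<^sub>R t n" for n y
  note d = has_vector_derivative_rotation[OF False, of \<phi>]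
  obtain B where B: "\<And>y. norm (test_fun (left_rot k l \<phi>) y) \<le> B"
    using test_fun_bounded by blast
  have bound: "norm (s n y) \<le> B" for n y
  proof -
    have "norm (test_fun \<phi> (rotation k l (t n) ** y) - test_fun \<phi> (rotation k l 0 ** y)) \<le> B *
        norm (t n - 0)"
    proof (rule differentiable_bound[where S = UNIV and f = "\<lambda>t. test_fun \<phi> (rotation k l t ** y)"])
      show "((\<lambda>t. test_fun \<phi> (rotation k l t ** y)) has_derivative
        (\<lambda>h. h *\<^sub>R test_fun (left_rot k l \<phi>) (rotation k l t ** y))) (at t within UNIV)" for t
        using d[of y t UNIV] by (simp add: has_vector_derivative_def)
      show "onorm (\<lambda>h. h *\<^sub>R test_fun (left_rot k l \<phi>) (rotation k l t ** y)) \<le> B" for t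
        by (rule onorm_bound)
          (use B order_trans[OF norm_ge_zero B] in \<open>auto simp: mult.commute[of B] intro!:
              mult_left_mono\<close>)
    qed auto
    then show ?thesis
      using t[of n] by (simp add: s_def rotation_0 divide_inverse_commute[symmetric]
          pos_divide_le_eq)
  qed
  have lim: "(\<lambda>n. s n y) \<longlonglongrightarrow> test_fun (left_rot k l \<phi>) y" for y
  proof -
    have "((\<lambda>h. norm (test_fun \<phi> (rotation k l (0 + h) ** y) - test_fun \<phi> (rotation k l 0 ** y) -
      h *\<^sub>R test_fun (left_rot k l \<phi>) (rotation k l 0 ** y)) / norm h) \<longlongrightarrow> 0) (at 0)"
      using d[of y 0 UNIV] by (simp add: has_vector_derivative_def has_derivative_at)
    moreover have "filterlim t (at 0) sequentially"
      using tlim t by (intro filterlim_atI) (auto simp: less_imp_neq[symmetric])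
    ultimately have "(\<lambda>n. norm (test_fun \<phi> (rotation k l (0 +
        t n) ** y) - test_fun \<phi> (rotation k l 0 ** y) -
      t n *\<^sub>R test_fun (left_rot k l \<phi>) (rotation k l 0 ** y)) / norm (t n)) \<longlonglongrightarrow> 0"
      by (rule filterlim_compose)
    moreover have "norm (test_fun \<phi> (rotation k l (0 +
        t n) ** y) - test_fun \<phi> (rotation k l 0 ** y) -
      t n *\<^sub>R test_fun (left_rot k l \<phi>) (rotation k l 0 ** y)) / norm (t n) =
          norm (s n y - test_fun (left_rot k l \<phi>) y)" for n
    proof -
      have "test_fun \<phi> (rotation k l (0 + t n) ** y) - test_fun \<phi> (rotation k l 0 ** y) -
        t n *\<^sub>R test_fun (left_rot k l \<phi>) (rotation k l 0 ** y) =
            t n *\<^sub>R (s n y - test_fun (left_rot k l \<phi>) y)"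
        using t[of n] by (simp add: s_def rotation_0 scaleR_diff_right)
      then show ?thesis using t[of n] by simp
    qed
    ultimately show ?thesis by (simp add: tendsto_norm_zero_iff LIM_zero_iff)
  qed
  have int0: "(\<integral>y. s n y \<partial>M) = 0" for n
    unfolding s_def using integral_translate[OF rotation_in_SO[OF False]] integrable_test[of \<phi>] by
        simp
  have "(\<lambda>n. \<integral>y. s n y \<partial>M) \<longlonglongrightarrow> (\<integral>y. test_fun (left_rot k l \<phi>) y \<partial>M)"
  proof (rule integral_dominated_convergence[where w = "\<lambda>_. B"])
    show "s n \<in> borel_measurable M" for n
      unfolding s_def using integral_translate(2)[OF rotation_in_SO[OF False]] integrable_test[of \<phi>]
      by (intro borel_measurable_scaleR borel_measurable_diff borel_measurable_integrable) auto
  qed (use bound lim integrable_test in \<open>auto intro: borel_measurable_integrable\<close>)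
  then have "(\<lambda>n. 0) \<longlonglongrightarrow> (\<integral>y. test_fun (left_rot k l \<phi>) y \<partial>M)" unfolding int0 .
  from LIMSEQ_unique[OF this tendsto_const] show ?thesis .
qed

end

section \<open>The annihilator\<close>

text \<open>The first two terms come from differentiating the coefficients \<open>y $ k $ i\<close>
  and \<open>y $ l $ j\<close>; they cancel after summation over \<open>k\<close> and
  \<open>l\<close>.\<close>

lemma left_rot_coord:
  "test_fun (left_rot k l (test_coord k i (test_coord l j \<phi>))) y =
    complex_of_real (y $ l $ i * y $ l $ j) * test_fun \<phi> y -
    complex_of_real (y $ k $ i * y $ k $ j) * test_fun \<phi> y +
    (\<Sum>a\<in>UNIV. complex_of_real (y $ k $ i * (y $ l $ j * y $ l $ a)) * pd k a (test_fun \<phi>) y) -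
    (\<Sum>a\<in>UNIV. complex_of_real (y $ l $ j * (y $ k $ i * y $ k $ a)) * pd l a (test_fun \<phi>) y)"
proof -
  let ?Y = "\<lambda>a b. complex_of_real (y $ a $ b)" and ?P = "\<lambda>a b. pd a b (test_fun \<phi>) y"
  have tf: "test_fun (test_coord k i (test_coord l j \<phi>)) =
    (\<lambda>y. complex_of_real (y $ k $ i) * (complex_of_real (y $ l $ j) * test_fun \<phi> y))"
    by (simp add: fun_eq_iff)
  \<comment> \<open>For \<open>k = l\<close> each derivative also hits the other coefficient; these
    extra terms cancel in the sum over \<open>a\<close>.\<close>
  have "?Y l a * pd k a (test_fun (test_coord k i (test_coord l j \<phi>))) y -
      ?Y k a * pd l a (test_fun (test_coord k i (test_coord l j \<phi>))) y =
    (if a = i then ?Y l i * ?Y l j * test_fun \<phi> y else 0) - (if a =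
        j then ?Y k i * ?Y k j * test_fun \<phi> y else 0) +
    ((if a = j then of_bool (k = l) * ?Y l j * ?Y k i * test_fun \<phi> y else 0) -
     (if a = i then of_bool (k = l) * ?Y l j * ?Y k i * test_fun \<phi> y else 0)) +
    (?Y k i * (?Y l j * ?Y l a) * ?P k a - ?Y l j * (?Y k i * ?Y k a) * ?P l a)" for a
    unfolding tf pd_coord_mult[OF smooth_coord_mult[OF smooth_test_fun]] pd_coord_mult[OF
        smooth_test_fun]
    by (auto simp: algebra_simps)
  then show ?thesis
    by (simp add: left_rot_fun sum.distrib sum_subtractf)
qed

text \<open>
  For orthogonal \<open>y\<close> the right invariant fields span the left invariant ones: \<open>y J =
      (y J y\<^sup>T) y\<close>. The
  coefficients have total divergence \<open>0\<close>, so they can be moved inside the derivatives.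
\<close>

lemma sum_left_rot:
  assumes y: "y \<in> SO"
  shows "(\<Sum>k\<in>UNIV. \<Sum>l\<in>UNIV. test_fun (left_rot k l (test_coord k i (test_coord l j \<phi>))) y) =
    (\<Sum>k\<in>UNIV. complex_of_real (y $ k $ i) * pd k j (test_fun \<phi>) y -
      complex_of_real (y $ k $ j) * pd k i (test_fun \<phi>) y)"
proof -
  let ?P = "\<lambda>a b. pd a b (test_fun \<phi>) y"
  \<comment> \<open>Summation over \<open>l\<close> contracts two columns of \<open>y\<close>, and
    orthogonality leaves only \<open>a = t\<close>.\<close>
  have *: "(\<Sum>k\<in>UNIV. \<Sum>l\<in>UNIV. \<Sum>a\<in>UNIV. complex_of_real (y $ k $ s * (y $ l $ t * y $ l $ a)) * ?P
      k a) =
    (\<Sum>k\<in>UNIV. complex_of_real (y $ k $ s) * ?P k t)" for s t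
  proof (rule sum.cong[OF refl])
    fix k
    have "(\<Sum>l\<in>UNIV. \<Sum>a\<in>UNIV. complex_of_real (y $ k $ s * (y $ l $ t * y $ l $ a)) * ?P k a) =
      (\<Sum>a\<in>UNIV. \<Sum>l\<in>UNIV. complex_of_real (y $ k $ s * (y $ l $ t * y $ l $ a)) * ?P k a)"
      by (rule sum.swap)
    also have "\<dots> = (\<Sum>a\<in>UNIV. complex_of_real (y $ k $ s * (\<Sum>l\<in>UNIV. y $ l $ t * y $ l $ a)) * ?P k
        a)"
      by (simp only: sum_distrib_left sum_distrib_right of_real_sum)
    also have "\<dots> = (\<Sum>a\<in>UNIV. if t = a then complex_of_real (y $ k $ s) * ?P k a else 0)"
      unfolding SO_columns[OF y] by (intro sum.cong) auto
    finally show "(\<Sum>l\<in>UNIV. \<Sum>a\<in>UNIV. complex_of_real (y $ k $ s * (y $ l $ t * y $ l $ a)) * ?P k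
        a) =
      complex_of_real (y $ k $ s) * ?P k t" by simp
  qed
  have "(\<Sum>k\<in>UNIV. \<Sum>l\<in>UNIV. \<Sum>a\<in>UNIV. complex_of_real (y $ l $ j * (y $ k $ i * y $ k $ a)) * ?P l
      a) =
    (\<Sum>k\<in>UNIV. complex_of_real (y $ k $ j) * ?P k i)"
    using *[of j i] by (subst sum.swap)
  then show ?thesis
    by (simp add: left_rot_coord sum.distrib sum_subtractf * sum_distrib_left[of "of_nat _"] del:
        of_real_mult)
qed

lemma pairing_diff: "pairing u (\<phi> - \<psi>) = pairing u \<phi> - pairing u \<psi>"
  using pairing_linear(1)[of u \<phi> "- \<psi>"] by (simp add: pairing_uminus)

lemma pairing_sum: "pairing u (sum f A) = (\<Sum>a\<in>A. pairing u (f a))"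
proof (induction A rule: infinite_finite_induct)
  show "pairing u (sum f {}) = (\<Sum>a\<in>{}. pairing u (f a))"
    using pairing_diff[of u 0 0] by simp
  then show "infinite A \<Longrightarrow> pairing u (sum f A) = (\<Sum>a\<in>A. pairing u (f a))" for A by simp
qed (simp add: pairing_linear)

lemma weyl_act_zero: "weyl_act 0 u = 0"
  using weyl_act_add[of 0 0 u] by simp

lemma weyl_act_zero_right: "weyl_act p 0 = 0"
  by (rule distribution_eqI) (simp add: weyl_act.rep_eq)

lemma weyl_act_diff: "weyl_act (p - q) u = weyl_act p u - weyl_act q u"
  using weyl_act_add[of "p - q" q u] by (simp add: algebra_simps)

lemma weyl_act_sum: "weyl_act (sum p A) u = (\<Sum>a\<in>A. weyl_act (p a) u)"
  by (induction A rule: infinite_finite_induct) (simp_all add: weyl_act_zero weyl_act_add)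

lemma pairing_distribution_sum: "pairing (sum u A) \<phi> = (\<Sum>a\<in>A. pairing (u a) \<phi>)"
  by (induction A rule: infinite_finite_induct) simp_all

lemma pairing_distribution_diff: "pairing (u - v) \<phi> = pairing u \<phi> - pairing v \<phi>"
  using pairing_simps(2)[of u "- v" \<phi>] by simp

lemma left_ideal_weyl_ann: "left_ideal (weyl_ann u)"
  by (auto simp: left_ideal_def weyl_ann_def weyl_act_zero weyl_act_zero_right weyl_act_add
      weyl_act_mult)

text \<open>Transposition turns the pairing into minus the integral of \<open>\<psi>\<close>. On the
  group \<open>\<psi>\<close> agrees with \<open>\<theta>\<close>, a sum of derivatives along left
  rotations, whose integrals vanish.\<close>

lemma (in SO_haar) rot_field_annihilates: "weyl_act (rot_field i j) \<mu> = 0"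
proof (rule distribution_eqI)
  fix \<phi>
  define \<psi> where "\<psi> = (\<Sum>k\<in>UNIV. test_pd k j (test_coord k i \<phi>) - test_pd k i (test_coord k j \<phi>))"
  define \<theta> where "\<theta> = (\<Sum>k\<in>UNIV. \<Sum>l\<in>UNIV. left_rot k l (test_coord k i (test_coord l j \<phi>)))"
  have "pairing (weyl_act (weyl_y a b * weyl_d c d) \<mu>) \<phi> =
      - pairing \<mu> (test_pd c d (test_coord a b \<phi>))"
    for a b c d
    by (simp add: weyl_act_mult pairing_weyl_act_y pairing_weyl_act_d)
  then have "pairing (weyl_act (rot_field i j) \<mu>) \<phi> = - pairing \<mu> \<psi>"
    by (simp add: rot_field_def \<psi>_def weyl_act_sum weyl_act_diff pairing_distribution_sum
        pairing_distribution_diff pairing_sum pairing_diff flip: sum_negf)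
  also have "pairing \<mu> \<psi> = pairing \<mu> \<theta>"
    unfolding pairing_SO_haar[OF haar]
  proof (rule Bochner_Integration.integral_cong[OF refl])
    fix y assume "y \<in> space M"
    then have y: "y \<in> SO" by (simp add: space_M)
    have tf: "test_fun (test_coord k i \<phi>) = (\<lambda>y. complex_of_real (y $ k $ i) * test_fun \<phi> y)" for
        k i
      by (simp add: fun_eq_iff)
    show "test_fun \<psi> y = test_fun \<theta> y"
      unfolding \<psi>_def \<theta>_def test_fun_sum sum_left_rot[OF y]
      by (auto simp: tf pd_coord_mult[OF smooth_test_fun] intro!: sum.cong)
  qed
  also have "\<dots> = 0"
    unfolding \<theta>_def pairing_sum by (simp add: pairing_SO_haar[OF haar] integral_left_rot)
  finally show "pairing (weyl_act (rot_field i j) \<mu>) \<phi> = pairing 0 \<phi>" by simp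
qed

section \<open>Generated left ideals and their comparison with the annihilator\<close>

lemma left_ideal_left_ideal_generated: "left_ideal (left_ideal_generated G)"
  unfolding left_ideal_def left_ideal_generated_def by blast

lemma left_ideal_generated_least: "left_ideal I \<Longrightarrow> G \<subseteq> I \<Longrightarrow> left_ideal_generated G \<subseteq> I"
  unfolding left_ideal_generated_def by blast

lemma left_ideal_generated_base: "g \<in> G \<Longrightarrow> g \<in> left_ideal_generated G"
  unfolding left_ideal_generated_def by blast

lemma col_prod_commute: "col_prod i j = col_prod j i"
  by (simp add: col_prod_mulop mult.commute)

lemma row_prod_commute: "row_prod i j = row_prod j i"
  by (simp add: row_prod_mulop mult.commute)

lemma kronecker_diff_mulop:
  "f \<in> polyfun \<Longrightarrow> (if i = j then 1 else 0) - mulop f = mulop (\<lambda>y. (if i = j then 1 else 0) - f y)"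
  by (cases "i = j") (simp_all add: weyl_one_mulop mulop_diff mulop_uminus polyfun.const)

lemma one_minus_weyl_det: "1 - weyl_det = mulop (\<lambda>y. 1 - complex_of_real (det y))"
  by (simp add: weyl_one_mulop weyl_det_mulop mulop_diff polyfun_det polyfun_intros)

theorem theorem1:
  fixes M :: "(real^'n::{finite,linorder}^'n::{finite,linorder}) measure"
  assumes "SO_haar_measure M"
  shows "weyl_ann (measure_distribution M) = left_ideal_generated
    ({\<Sum>k\<in>UNIV. weyl_y k i * weyl_d k j - weyl_y k j * weyl_d k i | i j. i < j} \<union>
     {(if i = j then 1 else 0) - (\<Sum>k\<in>UNIV. weyl_y k i * weyl_y k j) | i j. i \<le> j} \<union>
     {(if i = j then 1 else 0) - (\<Sum>k\<in>UNIV. weyl_y i k * weyl_y j k) | i j. i \<le> j} \<union>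
     {1 - weyl_det})"
proof -
  interpret SO_haar M by unfold_locales (rule assms)
  define G :: "'n weyl set" where "G =
    {rot_field i j | i j. i < j} \<union> {(if i = j then 1 else 0) - col_prod i j | i j. i \<le> j} \<union>
    {(if i = j then 1 else 0) - row_prod i j | i j. i \<le> j} \<union> {1 - weyl_det}"
  define I where "I = left_ideal_generated G"
  have left: "left_ideal I" unfolding I_def by (rule left_ideal_left_ideal_generated)
  have I_zero: "0 \<in> I" and I_add: "\<And>x y. x \<in> I \<Longrightarrow> y \<in> I \<Longrightarrow> x + y \<in> I"
    and I_mult: "\<And>r x. x \<in> I \<Longrightarrow> r * x \<in> I"
    using left unfolding left_ideal_def by blast+
  have G: "g \<in> I" if "g \<in> G" for g
    using that unfolding I_def by (rule left_ideal_generated_base)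
  \<comment> \<open>The generators are listed for \<open>i < j\<close> or \<open>i \<le> j\<close>;
    antisymmetry of \<open>rot_field\<close> and symmetry of the products supply the remaining
    indices.\<close>
  interpret orthogonal_ideal I
  proof
    show "left_ideal I" by (rule left)
    show "rot_field i j \<in> I" for i j
    proof (cases i j rule: linorder_cases)
      case less
      then show ?thesis by (auto simp: G_def intro!: G)
    next
      case equal
      then show ?thesis by (simp add: rot_field_eq I_zero)
    next
      case greater
      then have "rot_field j i \<in> I" by (auto simp: G_def intro!: G)
      from I_mult[OF this, of "- 1"] show ?thesis by (simp add: rot_field_eq)
    qed
    have row: "(if i = j then 1 else 0) - row_prod i j \<in> I" if "i \<le> j" for i j
      using that unfolding G_def by (intro G[unfolded G_def]) blast
    show "(if i = j then 1 else 0) - row_prod i j \<in> I" for i j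
      using row[of i j] row[of j i] row_prod_commute[of i j] by (cases "i \<le> j") auto
    have col: "(if i = j then 1 else 0) - col_prod i j \<in> I" if "i \<le> j" for i j
      using that unfolding G_def by (intro G[unfolded G_def]) blast
    show "(if i = j then 1 else 0) - col_prod i j \<in> I" for i j
      using col[of i j] col[of j i] col_prod_commute[of i j] by (cases "i \<le> j") auto
  qed
  \<comment> \<open>The order zero part of \<open>I\<close>; it is an ideal because multiplication
    operators form a copy of the polynomial ring inside the Weyl algebra.\<close>
  define J where "J = {f \<in> polyfun. mulop f \<in> I}"
  interpret J: SO_polyfun_ideal J
  proof
    show "(\<lambda>y. f y + g y) \<in> J" if "f \<in> J" "g \<in> J" for f g
      using that I_add unfolding J_def by (auto simp: polyfun.add simp flip: mulop_add)
    show "(\<lambda>y. f y * g y) \<in> J" if "f \<in> polyfun" "g \<in> J" for f g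
      using that I_mult unfolding J_def by (auto simp: polyfun.mult simp flip: mulop_mult)
    show "(\<lambda>y. complex_of_real ((mat 1 - transpose y ** y) $ i $ j)) \<in> J" for i j
    proof -
      have eq: "(\<lambda>y. complex_of_real ((mat 1 - transpose y ** y) $ i $ j)) = (\<lambda>y. (if i =
          j then 1 else 0) -
        (\<Sum>k\<in>UNIV. complex_of_real (y $ k $ i) * complex_of_real (y $ k $ j)))"
        by (auto simp: mat_def matrix_matrix_mult_def transpose_def)
      show ?thesis
        using col[of i j] unfolding eq J_def col_prod_mulop kronecker_diff_mulop[OF
            polyfun_sum_coord]
        by (auto intro!: polyfun_intros)
    qed
    show "(\<lambda>y. 1 - complex_of_real (det y)) \<in> J"
      unfolding J_def using G[of "1 - weyl_det"]
      by (auto simp: G_def one_minus_weyl_det polyfun_det polyfun_intros)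
  qed (auto simp: J_def polyfun.const mulop_zero I_zero)
  have kronecker: "weyl_act ((if i = j then 1 else 0) - mulop f) \<mu> = 0"
    if "f \<in> polyfun" "\<And>y. y \<in> SO \<Longrightarrow> f y = (if i = j then 1 else 0)" for i j :: 'n and f
    unfolding kronecker_diff_mulop[OF that(1)] using that
    by (intro mulop_annihilates) (auto intro!: polyfun_intros)
  have "weyl_act g \<mu> = 0" if "g \<in> G" for g
    using that unfolding G_def
  proof (elim UnE CollectE exE conjE singletonE)
    show "weyl_act g \<mu> = 0" if "g = rot_field i j" for i j
      using that rot_field_annihilates by simp
    show "weyl_act g \<mu> = 0" if "g = (if i = j then 1 else 0) - col_prod i j" for i j
      unfolding that col_prod_mulop
      by (rule kronecker[OF polyfun_sum_coord]) (simp only: SO_columns flip: of_real_mult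
          of_real_sum, simp)
    show "weyl_act g \<mu> = 0" if "g = (if i = j then 1 else 0) - row_prod i j" for i j
      unfolding that row_prod_mulop
      by (rule kronecker[OF polyfun_sum_coord]) (simp only: SO_rows flip: of_real_mult
          of_real_sum, simp)
    show "weyl_act g \<mu> = 0" if "g = 1 - weyl_det"
      unfolding that one_minus_weyl_det by (rule mulop_annihilates)
          (auto simp: SO_def intro!: polyfun_intros polyfun_det)
  qed
  then have "I \<subseteq> weyl_ann \<mu>"
    unfolding I_def by (intro left_ideal_generated_least left_ideal_weyl_ann)
        (auto simp: weyl_ann_def)
  then have "weyl_ann \<mu> = I"
  proof (rule ideal_eqI[OF left_ideal_weyl_ann])
    fix f assume f: "f \<in> polyfun" "mulop f \<in> weyl_ann \<mu>"
    \<comment> \<open>A polynomial that annihilates \<open>\<mu>\<close> vanishes on the group, and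
      then the equations in \<open>J\<close> generate it.\<close>
    then have "f \<in> J"
      by (intro J.vanishing_in_ideal mulop_annihilates_imp_zero) (auto simp: weyl_ann_def)
    then show "mulop f \<in> I" by (simp add: J_def)
  qed
  then show ?thesis
    unfolding I_def G_def rot_field_def col_prod_def row_prod_def .
qed

end
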